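(* Let $\mathcal K$ be an enhanced 2-category and let $P:\mathcal E\to\mathcal K$ be a (split) enhanced discrete 2-fibration over it, with $\mathcal E$ marked by its $P$-cartesian 1-cells. For an object $U\in\mathcal E$, the following are equivalent: (1) $U$ is marked-lax terminal in $\mathcal E$. (2) The enhanced 2-functor $(-)^*U:\mathcal K/\!/_{\mathrm{lx}}PU\to\mathcal E$ corresponding to $U$ under the Yoneda lemma is a (right adjoint) equivalence over $\mathcal K$. (The inverse need not preserve chosen lifts.)
   Context: An enhanced 2-category is a 2-category, whose 1-cells are called loose (written $\rightsquigarrow$), with a wide and locally full sub-2-category whose 1-cells are called tight. An enhanced 2-functor is a 2-functor preserving tight 1-cells. A (split) enhanced discrete 2-fibration $P:\mathcal E\to\mathcal K$ is an enhanced 2-functor such that: (i) its underlying functor of 1-categories is a split fibration (with chosen cartesian lifts $\lambda_f:f^*B\rightsquigarrow B$ of $f:A\rightsquigarrow PB$), and the chosen lift of a tight map is tight; (ii) for all $X,Y$, the functor $P:\mathcal E(X,Y)\to\mathcal K(PX,PY)$ is a discrete opfibration; (iii) for $f:A\rightsquigarrow PB$, $x:X\rightsquigarrow B$ and $y:PX\to A$ with $Px=f\circ y$, if $y$ is tight then so is the unique $\hat y:X\to f^*B$ over $y$ with $\lambda_f\hat y=x$. The lax slice $\mathcal K/\!/_{\mathrm{lx}}X$ has objects the loose 1-cells $a:A\rightsquigarrow X$; 1-cells $a\to b$ are pairs $(h:A\rightsquigarrow B,\ \varphi:a\Rightarrow b\circ h)$, tight when $h$ is tight; 2-cells $(h,\varphi)\Rightarrow(h',\varphi')$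 are 2-cells $\theta:h\Rightarrow h'$ with $(b\theta)\varphi=\varphi'$. It projects to $\mathcal K$ by taking domains. The enhanced 2-functor $(-)^*U$ over $\mathcal K$ is the morphism of split enhanced discrete 2-fibrations determined by $\mathrm{id}_{PU}\mapsto U$: it sends $a:A\rightsquigarrow PU$ to $a^*U$; a 1-cell $(h,\varphi):a\to b$ to the unique 1-cell $a^*U\rightsquigarrow b^*U$ over $h$ whose composite with $\lambda_b$ is the codomain of the unique lift of the 2-cell $\varphi$ starting at $\lambda_a$; and 2-cells to their unique lifts. An equivalence over $\mathcal K$ means an inverse enhanced 2-functor commuting with the projections to $\mathcal K$ and with invertible 2-natural unit and counit lying over identities. Marking. A marking on an enhanced 2-category is a wide, locally full subcategory of 1-cells called marked. Here $\mathcal E$ is marked by its cartesian 1-cells (not only the chosen lifts). For marked $\mathcal E$ and $X\in\mathcal E$, the marked lax slice is the full sub-2-category of $\mathcal E/\!/_{\mathrm{lx}}X$ on the marked 1-cells $A\rightsquigarrow X$, its marked 1-cells being the $(h,\varphi)$ with $h$ marked and $\varphi$ invertible. $U$ is marked-lax terminal in $\mathcal E$ if there are an enhanced 2-functor $d$ from $\mathcal E$ to the marked lax slice over $U$, preserving marked 1-cells and strictly a section of the domain projection, and an isomorphism $!_U:d(U)\cong\mathrm{id}_U$ in the slice lying over $\mathrm{id}_U$. *)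

theory Defs
  imports Main
begin

section \<open>Enhanced 2-categories\<close>

text \<open>
  2-categories and 2-functors are strict. The 1-cells \<open>One\<close> are the loose ones. Composition is
  written in applicative order: \<open>g \<odot> f\<close> for 1-cells, \<open>\<beta> \<cdot> \<alpha>\<close> for vertical and \<open>\<beta> \<star> \<alpha>\<close> for
  horizontal composition of 2-cells. All operations are meaningful only on composable cells.
\<close>

record ('o, 'm, 'c) two_cat =
  Obj :: "'o set"
  One :: "'m set"
  Two :: "'c set"
  Dom :: "'m \<Rightarrow> 'o"
  Cod :: "'m \<Rightarrow> 'o"
  Src :: "'c \<Rightarrow> 'm"
  Tgt :: "'c \<Rightarrow> 'm"
  Id1 :: "'o \<Rightarrow> 'm"
  Id2 :: "'m \<Rightarrow> 'c"
  Comp1 :: "'m \<Rightarrow> 'm \<Rightarrow> 'm"  (infixl "\<odot>\<index>" 70)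
  VComp :: "'c \<Rightarrow> 'c \<Rightarrow> 'c"  (infixl "\<cdot>\<index>" 65)
  HComp :: "'c \<Rightarrow> 'c \<Rightarrow> 'c"  (infixl "\<star>\<index>" 70)
  Tight :: "'m set"

definition hom1 :: "('o, 'm, 'c) two_cat \<Rightarrow> 'o \<Rightarrow> 'o \<Rightarrow> 'm set" where
  "hom1 C A B = {f \<in> One C. Dom C f = A \<and> Cod C f = B}"

definition hom2 :: "('o, 'm, 'c) two_cat \<Rightarrow> 'm \<Rightarrow> 'm \<Rightarrow> 'c set" where
  "hom2 C f g = {\<alpha> \<in> Two C. Src C \<alpha> = f \<and> Tgt C \<alpha> = g}"

locale enhanced_two_category =
  fixes C :: "('o, 'm, 'c) two_cat" (structure)
  assumes dom_closed: "f \<in> One C \<Longrightarrow> Dom C f \<in> Obj C"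
    and cod_closed: "f \<in> One C \<Longrightarrow> Cod C f \<in> Obj C"
    and id1_closed: "A \<in> Obj C \<Longrightarrow> Id1 C A \<in> hom1 C A A"
    and comp1_closed: "f \<in> hom1 C A B \<Longrightarrow> g \<in> hom1 C B D \<Longrightarrow> g \<odot> f \<in> hom1 C A D"
    and comp1_id_left: "f \<in> One C \<Longrightarrow> Id1 C (Cod C f) \<odot> f = f"
    and comp1_id_right: "f \<in> One C \<Longrightarrow> f \<odot> Id1 C (Dom C f) = f"
    and comp1_assoc: "f \<in> One C \<Longrightarrow> g \<in> One C \<Longrightarrow> h \<in> One C \<Longrightarrow>
      Cod C f = Dom C g \<Longrightarrow> Cod C g = Dom C h \<Longrightarrow> (h \<odot> g) \<odot> f = h \<odot> (g \<odot> f)"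
    and src_closed: "\<alpha> \<in> Two C \<Longrightarrow> Src C \<alpha> \<in> One C"
    and tgt_closed: "\<alpha> \<in> Two C \<Longrightarrow> Tgt C \<alpha> \<in> hom1 C (Dom C (Src C \<alpha>)) (Cod C (Src C \<alpha>))"
    and id2_closed: "f \<in> One C \<Longrightarrow> Id2 C f \<in> hom2 C f f"
    and vcomp_closed: "\<alpha> \<in> hom2 C f g \<Longrightarrow> \<beta> \<in> hom2 C g h \<Longrightarrow> \<beta> \<cdot> \<alpha> \<in> hom2 C f h"
    and vcomp_id_left: "\<alpha> \<in> Two C \<Longrightarrow> Id2 C (Tgt C \<alpha>) \<cdot> \<alpha> = \<alpha>"
    and vcomp_id_right: "\<alpha> \<in> Two C \<Longrightarrow> \<alpha> \<cdot> Id2 C (Src C \<alpha>) = \<alpha>"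
    and vcomp_assoc: "\<alpha> \<in> Two C \<Longrightarrow> \<beta> \<in> Two C \<Longrightarrow> \<gamma> \<in> Two C \<Longrightarrow>
      Tgt C \<alpha> = Src C \<beta> \<Longrightarrow> Tgt C \<beta> = Src C \<gamma> \<Longrightarrow> (\<gamma> \<cdot> \<beta>) \<cdot> \<alpha> = \<gamma> \<cdot> (\<beta> \<cdot> \<alpha>)"
    and hcomp_closed: "\<alpha> \<in> hom2 C f f' \<Longrightarrow> \<beta> \<in> hom2 C g g' \<Longrightarrow> Cod C f = Dom C g \<Longrightarrow>
      \<beta> \<star> \<alpha> \<in> hom2 C (g \<odot> f) (g' \<odot> f')"
    and hcomp_id_left: "\<alpha> \<in> Two C \<Longrightarrow> Id2 C (Id1 C (Cod C (Src C \<alpha>))) \<star> \<alpha> = \<alpha>"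
    and hcomp_id_right: "\<alpha> \<in> Two C \<Longrightarrow> \<alpha> \<star> Id2 C (Id1 C (Dom C (Src C \<alpha>))) = \<alpha>"
    and hcomp_assoc: "\<alpha> \<in> Two C \<Longrightarrow> \<beta> \<in> Two C \<Longrightarrow> \<gamma> \<in> Two C \<Longrightarrow>
      Cod C (Src C \<alpha>) = Dom C (Src C \<beta>) \<Longrightarrow> Cod C (Src C \<beta>) = Dom C (Src C \<gamma>) \<Longrightarrow>
      (\<gamma> \<star> \<beta>) \<star> \<alpha> = \<gamma> \<star> (\<beta> \<star> \<alpha>)"
    and hcomp_id2: "f \<in> One C \<Longrightarrow> g \<in> One C \<Longrightarrow> Cod C f = Dom C g \<Longrightarrow>
      Id2 C g \<star> Id2 C f = Id2 C (g \<odot> f)"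
    and interchange: "\<alpha> \<in> Two C \<Longrightarrow> \<alpha>' \<in> Two C \<Longrightarrow> \<beta> \<in> Two C \<Longrightarrow> \<beta>' \<in> Two C \<Longrightarrow>
      Tgt C \<alpha> = Src C \<alpha>' \<Longrightarrow> Tgt C \<beta> = Src C \<beta>' \<Longrightarrow> Cod C (Src C \<alpha>) = Dom C (Src C \<beta>) \<Longrightarrow>
      (\<beta>' \<cdot> \<beta>) \<star> (\<alpha>' \<cdot> \<alpha>) = (\<beta>' \<star> \<alpha>') \<cdot> (\<beta> \<star> \<alpha>)"
    and tight_subset: "Tight C \<subseteq> One C"
    and tight_id: "A \<in> Obj C \<Longrightarrow> Id1 C A \<in> Tight C"
    and tight_comp: "f \<in> Tight C \<Longrightarrow> g \<in> Tight C \<Longrightarrow> Cod C f = Dom C g \<Longrightarrow> g \<odot> f \<in> Tight C"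

definition invertible1 :: "('o, 'm, 'c) two_cat \<Rightarrow> 'm \<Rightarrow> bool" where
  "invertible1 C f \<longleftrightarrow> f \<in> One C \<and> (\<exists>g \<in> hom1 C (Cod C f) (Dom C f).
     g \<odot>\<^bsub>C\<^esub> f = Id1 C (Dom C f) \<and> f \<odot>\<^bsub>C\<^esub> g = Id1 C (Cod C f))"

definition invertible2 :: "('o, 'm, 'c) two_cat \<Rightarrow> 'c \<Rightarrow> bool" where
  "invertible2 C \<alpha> \<longleftrightarrow> \<alpha> \<in> Two C \<and> (\<exists>\<beta> \<in> hom2 C (Tgt C \<alpha>) (Src C \<alpha>).
     \<beta> \<cdot>\<^bsub>C\<^esub> \<alpha> = Id2 C (Src C \<alpha>) \<and> \<alpha> \<cdot>\<^bsub>C\<^esub> \<beta> = Id2 C (Tgt C \<alpha>))"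

definition full_sub :: "('o, 'm, 'c) two_cat \<Rightarrow> 'o set \<Rightarrow> ('o, 'm, 'c) two_cat" where
  "full_sub C S = C\<lparr>
     Obj := Obj C \<inter> S,
     One := {f \<in> One C. Dom C f \<in> S \<and> Cod C f \<in> S},
     Two := {\<alpha> \<in> Two C. Dom C (Src C \<alpha>) \<in> S \<and> Cod C (Src C \<alpha>) \<in> S},
     Tight := {f \<in> Tight C. Dom C f \<in> S \<and> Cod C f \<in> S}\<rparr>"


section \<open>Enhanced 2-functors and 2-natural transformations\<close>

record ('o, 'm, 'c, 'p, 'n, 'd) two_map =
  map0 :: "'o \<Rightarrow> 'p"
  map1 :: "'m \<Rightarrow> 'n"
  map2 :: "'c \<Rightarrow> 'd"

locale enhanced_two_functor =
  dom: enhanced_two_category C + cod: enhanced_two_category D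
  for C :: "('o, 'm, 'c) two_cat" and D :: "('p, 'n, 'd) two_cat" +
  fixes F :: "('o, 'm, 'c, 'p, 'n, 'd) two_map"
  assumes map0_closed: "A \<in> Obj C \<Longrightarrow> map0 F A \<in> Obj D"
    and map1_closed: "f \<in> hom1 C A B \<Longrightarrow> map1 F f \<in> hom1 D (map0 F A) (map0 F B)"
    and map2_closed: "\<alpha> \<in> hom2 C f g \<Longrightarrow> map2 F \<alpha> \<in> hom2 D (map1 F f) (map1 F g)"
    and map1_id: "A \<in> Obj C \<Longrightarrow> map1 F (Id1 C A) = Id1 D (map0 F A)"
    and map1_comp: "f \<in> One C \<Longrightarrow> g \<in> One C \<Longrightarrow> Cod C f = Dom C g \<Longrightarrow>
      map1 F (g \<odot>\<^bsub>C\<^esub> f) = map1 F g \<odot>\<^bsub>D\<^esub> map1 F f"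
    and map2_id: "f \<in> One C \<Longrightarrow> map2 F (Id2 C f) = Id2 D (map1 F f)"
    and map2_vcomp: "\<alpha> \<in> Two C \<Longrightarrow> \<beta> \<in> Two C \<Longrightarrow> Tgt C \<alpha> = Src C \<beta> \<Longrightarrow>
      map2 F (\<beta> \<cdot>\<^bsub>C\<^esub> \<alpha>) = map2 F \<beta> \<cdot>\<^bsub>D\<^esub> map2 F \<alpha>"
    and map2_hcomp: "\<alpha> \<in> Two C \<Longrightarrow> \<beta> \<in> Two C \<Longrightarrow> Cod C (Src C \<alpha>) = Dom C (Src C \<beta>) \<Longrightarrow>
      map2 F (\<beta> \<star>\<^bsub>C\<^esub> \<alpha>) = map2 F \<beta> \<star>\<^bsub>D\<^esub> map2 F \<alpha>"
    and map1_tight: "f \<in> Tight C \<Longrightarrow> map1 F f \<in> Tight D"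

definition id_map :: "('o, 'm, 'c, 'o, 'm, 'c) two_map" where
  "id_map = \<lparr>map0 = id, map1 = id, map2 = id\<rparr>"

definition comp_map :: "('p, 'n, 'd, 'q, 'k, 'e) two_map \<Rightarrow> ('o, 'm, 'c, 'p, 'n, 'd) two_map \<Rightarrow>
    ('o, 'm, 'c, 'q, 'k, 'e) two_map" where
  "comp_map G F = \<lparr>map0 = map0 G \<circ> map0 F, map1 = map1 G \<circ> map1 F, map2 = map2 G \<circ> map2 F\<rparr>"

text \<open>Equality of 2-functors, which only concerns their values on the cells of \<open>C\<close>.\<close>

definition map_eq_on :: "('o, 'm, 'c) two_cat \<Rightarrow> ('o, 'm, 'c, 'p, 'n, 'd) two_map \<Rightarrow>
    ('o, 'm, 'c, 'p, 'n, 'd) two_map \<Rightarrow> bool" where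
  "map_eq_on C F G \<longleftrightarrow> (\<forall>A \<in> Obj C. map0 F A = map0 G A) \<and>
     (\<forall>f \<in> One C. map1 F f = map1 G f) \<and> (\<forall>\<alpha> \<in> Two C. map2 F \<alpha> = map2 G \<alpha>)"

definition two_natural :: "('o, 'm, 'c) two_cat \<Rightarrow> ('p, 'n, 'd) two_cat \<Rightarrow>
    ('o, 'm, 'c, 'p, 'n, 'd) two_map \<Rightarrow> ('o, 'm, 'c, 'p, 'n, 'd) two_map \<Rightarrow> ('o \<Rightarrow> 'n) \<Rightarrow> bool" where
  "two_natural C D F G \<tau> \<longleftrightarrow>
     (\<forall>A \<in> Obj C. \<tau> A \<in> hom1 D (map0 F A) (map0 G A)) \<and>
     (\<forall>f \<in> One C. map1 G f \<odot>\<^bsub>D\<^esub> \<tau> (Dom C f) = \<tau> (Cod C f) \<odot>\<^bsub>D\<^esub> map1 F f) \<and>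
     (\<forall>\<alpha> \<in> Two C. map2 G \<alpha> \<star>\<^bsub>D\<^esub> Id2 D (\<tau> (Dom C (Src C \<alpha>))) =
        Id2 D (\<tau> (Cod C (Src C \<alpha>))) \<star>\<^bsub>D\<^esub> map2 F \<alpha>)"


section \<open>Split enhanced discrete 2-fibrations\<close>

text \<open>Cartesianness refers to the underlying functor of 1-categories.\<close>

definition cartesian :: "('p, 'n, 'd) two_cat \<Rightarrow> ('o, 'm, 'c) two_cat \<Rightarrow>
    ('p, 'n, 'd, 'o, 'm, 'c) two_map \<Rightarrow> 'n \<Rightarrow> bool" where
  "cartesian E K P k \<longleftrightarrow> k \<in> One E \<and>
     (\<forall>x \<in> One E. \<forall>y \<in> hom1 K (map0 P (Dom E x)) (map0 P (Dom E k)).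
        Cod E x = Cod E k \<and> map1 P x = map1 P k \<odot>\<^bsub>K\<^esub> y \<longrightarrow>
        (\<exists>!z. z \<in> hom1 E (Dom E x) (Dom E k) \<and> map1 P z = y \<and> k \<odot>\<^bsub>E\<^esub> z = x))"

text \<open>
  The cleavage is part of the structure: \<open>lift f B\<close> is the chosen cartesian lift
  \<open>\<lambda>\<^sub>f : f\<^sup>*B \<rightarrow> B\<close> of \<open>f : A \<rightarrow> P B\<close>, so that \<open>f\<^sup>*B\<close> is \<open>Dom E (lift f B)\<close>.
\<close>

locale enhanced_discrete_two_fibration = enhanced_two_functor E K P
  for E :: "('p, 'n, 'd) two_cat" and K :: "('o, 'm, 'c) two_cat"
    and P :: "('p, 'n, 'd, 'o, 'm, 'c) two_map" +
  fixes lift :: "'m \<Rightarrow> 'p \<Rightarrow> 'n"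
  assumes lift_cartesian: "B \<in> Obj E \<Longrightarrow> f \<in> One K \<Longrightarrow> Cod K f = map0 P B \<Longrightarrow>
      cartesian E K P (lift f B) \<and> Cod E (lift f B) = B \<and> map1 P (lift f B) = f"
    and lift_id: "B \<in> Obj E \<Longrightarrow> lift (Id1 K (map0 P B)) B = Id1 E B"
    and lift_comp: "B \<in> Obj E \<Longrightarrow> f \<in> One K \<Longrightarrow> g \<in> One K \<Longrightarrow> Cod K f = map0 P B \<Longrightarrow>
      Cod K g = Dom K f \<Longrightarrow> lift (f \<odot>\<^bsub>K\<^esub> g) B = lift f B \<odot>\<^bsub>E\<^esub> lift g (Dom E (lift f B))"
    and lift_tight: "B \<in> Obj E \<Longrightarrow> f \<in> Tight K \<Longrightarrow> Cod K f = map0 P B \<Longrightarrow> lift f B \<in> Tight E"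
    and discrete_opfibration: "x \<in> One E \<Longrightarrow> \<phi> \<in> Two K \<Longrightarrow> Src K \<phi> = map1 P x \<Longrightarrow>
      \<exists>!\<alpha>. \<alpha> \<in> Two E \<and> Src E \<alpha> = x \<and> map2 P \<alpha> = \<phi>"
    and factor_tight: "B \<in> Obj E \<Longrightarrow> f \<in> One K \<Longrightarrow> Cod K f = map0 P B \<Longrightarrow>
      x \<in> hom1 E X B \<Longrightarrow> y \<in> hom1 K (map0 P X) (Dom K f) \<Longrightarrow> map1 P x = f \<odot>\<^bsub>K\<^esub> y \<Longrightarrow> y \<in> Tight K \<Longrightarrow>
      z \<in> hom1 E X (Dom E (lift f B)) \<Longrightarrow> map1 P z = y \<Longrightarrow> lift f B \<odot>\<^bsub>E\<^esub> z = x \<Longrightarrow> z \<in> Tight E"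


section \<open>Lax slices\<close>

text \<open>
  A 1-cell \<open>(h, \<phi>) : a \<rightarrow> b\<close> of the lax slice is \<open>Slice1 a h \<phi> b\<close> and a 2-cell \<open>\<theta> : s \<Rightarrow> t\<close> is
  \<open>Slice2 s \<theta> t\<close>; the boundaries are recorded because \<open>h\<close>, \<open>\<phi>\<close> and \<open>\<theta>\<close> do not determine them.
\<close>

datatype ('m, 'c) slice1 =
  Slice1 (slice_dom: 'm) (slice_arr: 'm) (slice_cell: 'c) (slice_cod: 'm)

datatype ('m, 'c) slice2 =
  Slice2 (slice_src: "('m, 'c) slice1") (slice_map: 'c) (slice_tgt: "('m, 'c) slice1")

definition slice_One :: "('o, 'm, 'c) two_cat \<Rightarrow> 'o \<Rightarrow> ('m, 'c) slice1 set" where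
  "slice_One K X = {Slice1 a h \<phi> b | a h \<phi> b.
     a \<in> One K \<and> Cod K a = X \<and> b \<in> One K \<and> Cod K b = X \<and>
     h \<in> hom1 K (Dom K a) (Dom K b) \<and> \<phi> \<in> hom2 K a (b \<odot>\<^bsub>K\<^esub> h)}"

definition slice_Two :: "('o, 'm, 'c) two_cat \<Rightarrow> 'o \<Rightarrow> ('m, 'c) slice2 set" where
  "slice_Two K X = {Slice2 s \<theta> t | s \<theta> t.
     s \<in> slice_One K X \<and> t \<in> slice_One K X \<and>
     slice_dom s = slice_dom t \<and> slice_cod s = slice_cod t \<and>
     \<theta> \<in> hom2 K (slice_arr s) (slice_arr t) \<and>
     (Id2 K (slice_cod s) \<star>\<^bsub>K\<^esub> \<theta>) \<cdot>\<^bsub>K\<^esub> slice_cell s = slice_cell t}"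

definition slice_comp :: "('o, 'm, 'c) two_cat \<Rightarrow> ('m, 'c) slice1 \<Rightarrow> ('m, 'c) slice1 \<Rightarrow>
    ('m, 'c) slice1" where
  "slice_comp K t s = Slice1 (slice_dom s) (slice_arr t \<odot>\<^bsub>K\<^esub> slice_arr s)
     ((slice_cell t \<star>\<^bsub>K\<^esub> Id2 K (slice_arr s)) \<cdot>\<^bsub>K\<^esub> slice_cell s) (slice_cod t)"

definition lax_slice :: "('o, 'm, 'c) two_cat \<Rightarrow> 'o \<Rightarrow>
    ('m, ('m, 'c) slice1, ('m, 'c) slice2) two_cat" where
  "lax_slice K X = \<lparr>
     Obj = {a \<in> One K. Cod K a = X},
     One = slice_One K X,
     Two = slice_Two K X,
     Dom = slice_dom,
     Cod = slice_cod,
     Src = slice_src,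
     Tgt = slice_tgt,
     Id1 = (\<lambda>a. Slice1 a (Id1 K (Dom K a)) (Id2 K a) a),
     Id2 = (\<lambda>s. Slice2 s (Id2 K (slice_arr s)) s),
     Comp1 = slice_comp K,
     VComp = (\<lambda>\<tau> \<sigma>. Slice2 (slice_src \<sigma>) (slice_map \<tau> \<cdot>\<^bsub>K\<^esub> slice_map \<sigma>) (slice_tgt \<tau>)),
     HComp = (\<lambda>\<tau> \<sigma>. Slice2 (slice_comp K (slice_src \<tau>) (slice_src \<sigma>))
        (slice_map \<tau> \<star>\<^bsub>K\<^esub> slice_map \<sigma>) (slice_comp K (slice_tgt \<tau>) (slice_tgt \<sigma>))),
     Tight = {s \<in> slice_One K X. slice_arr s \<in> Tight K}\<rparr>"

definition slice_proj :: "('o, 'm, 'c) two_cat \<Rightarrow>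
    ('m, ('m, 'c) slice1, ('m, 'c) slice2, 'o, 'm, 'c) two_map" where
  "slice_proj K = \<lparr>map0 = Dom K, map1 = slice_arr, map2 = slice_map\<rparr>"


section \<open>Markings and marked-lax terminal objects\<close>

text \<open>
  A marking is a set of 1-cells; the wide locally full sub-2-category it spans is determined by it.
\<close>

locale marked_enhanced_two_category = enhanced_two_category E
  for E :: "('p, 'n, 'd) two_cat" (structure) +
  fixes M :: "'n set"
  assumes marked_subset: "M \<subseteq> One E"
    and marked_id: "A \<in> Obj E \<Longrightarrow> Id1 E A \<in> M"
    and marked_comp: "f \<in> M \<Longrightarrow> g \<in> M \<Longrightarrow> Cod E f = Dom E g \<Longrightarrow> g \<odot> f \<in> M"

definition marked_lax_slice :: "('p, 'n, 'd) two_cat \<Rightarrow> 'n set \<Rightarrow> 'p \<Rightarrow>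
    ('n, ('n, 'd) slice1, ('n, 'd) slice2) two_cat" where
  "marked_lax_slice E M X = full_sub (lax_slice E X) M"

definition marked_lax_slice_marking :: "('p, 'n, 'd) two_cat \<Rightarrow> 'n set \<Rightarrow> 'p \<Rightarrow>
    ('n, 'd) slice1 set" where
  "marked_lax_slice_marking E M X =
     {s \<in> One (marked_lax_slice E M X). slice_arr s \<in> M \<and> invertible2 E (slice_cell s)}"

definition marked_lax_terminal :: "('p, 'n, 'd) two_cat \<Rightarrow> 'n set \<Rightarrow> 'p \<Rightarrow> bool" where
  "marked_lax_terminal E M U \<longleftrightarrow> (\<exists>d.
     enhanced_two_functor E (marked_lax_slice E M U) d \<and>
     (\<forall>k \<in> M. map1 d k \<in> marked_lax_slice_marking E M U) \<and>
     map_eq_on E (comp_map (slice_proj E) d) id_map \<and>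
     (\<exists>s \<in> hom1 (marked_lax_slice E M U) (map0 d U) (Id1 E U).
        invertible1 (marked_lax_slice E M U) s \<and> slice_arr s = Id1 E U))"

definition cartesian_marking :: "('p, 'n, 'd) two_cat \<Rightarrow> ('o, 'm, 'c) two_cat \<Rightarrow>
    ('p, 'n, 'd, 'o, 'm, 'c) two_map \<Rightarrow> 'n set" where
  "cartesian_marking E K P = {k. cartesian E K P k}"


section \<open>The 2-functor \<open>(-)\<^sup>*U\<close> and equivalences over the base\<close>

text \<open>The unique lift of the 2-cell \<open>\<phi>\<close> starting at the 1-cell \<open>x\<close>.\<close>

definition cell_lift :: "('p, 'n, 'd) two_cat \<Rightarrow> ('p, 'n, 'd, 'o, 'm, 'c) two_map \<Rightarrow>
    'n \<Rightarrow> 'c \<Rightarrow> 'd" where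
  "cell_lift E P x \<phi> = (THE \<alpha>. \<alpha> \<in> Two E \<and> Src E \<alpha> = x \<and> map2 P \<alpha> = \<phi>)"

definition pullback1 :: "('p, 'n, 'd) two_cat \<Rightarrow> ('p, 'n, 'd, 'o, 'm, 'c) two_map \<Rightarrow>
    ('m \<Rightarrow> 'p \<Rightarrow> 'n) \<Rightarrow> 'p \<Rightarrow> ('m, 'c) slice1 \<Rightarrow> 'n" where
  "pullback1 E P lift U s = (THE k.
     k \<in> hom1 E (Dom E (lift (slice_dom s) U)) (Dom E (lift (slice_cod s) U)) \<and>
     map1 P k = slice_arr s \<and>
     lift (slice_cod s) U \<odot>\<^bsub>E\<^esub> k = Tgt E (cell_lift E P (lift (slice_dom s) U) (slice_cell s)))"

definition pullback :: "('p, 'n, 'd) two_cat \<Rightarrow> ('p, 'n, 'd, 'o, 'm, 'c) two_map \<Rightarrow>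
    ('m \<Rightarrow> 'p \<Rightarrow> 'n) \<Rightarrow> 'p \<Rightarrow> ('m, ('m, 'c) slice1, ('m, 'c) slice2, 'p, 'n, 'd) two_map" where
  "pullback E P lift U = \<lparr>
     map0 = (\<lambda>a. Dom E (lift a U)),
     map1 = pullback1 E P lift U,
     map2 = (\<lambda>\<sigma>. cell_lift E P (pullback1 E P lift U (slice_src \<sigma>)) (slice_map \<sigma>))\<rparr>"

text \<open>
  \<open>Q : A \<rightarrow> K\<close> and \<open>P : E \<rightarrow> K\<close> are the projections, \<open>G : A \<rightarrow> E\<close> is the 2-functor over \<open>K\<close> under
  consideration and \<open>F : E \<rightarrow> A\<close> its inverse over \<open>K\<close>, with unit \<open>\<eta> : 1 \<Rightarrow> G F\<close> and counit
  \<open>\<epsilon> : F G \<Rightarrow> 1\<close>, both invertible and vertical.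
\<close>

definition inverse_over :: "('o, 'm, 'c) two_cat \<Rightarrow>
    ('r, 's, 't) two_cat \<Rightarrow> ('r, 's, 't, 'o, 'm, 'c) two_map \<Rightarrow>
    ('p, 'n, 'd) two_cat \<Rightarrow> ('p, 'n, 'd, 'o, 'm, 'c) two_map \<Rightarrow>
    ('r, 's, 't, 'p, 'n, 'd) two_map \<Rightarrow> ('p, 'n, 'd, 'r, 's, 't) two_map \<Rightarrow>
    ('p \<Rightarrow> 'n) \<Rightarrow> ('r \<Rightarrow> 's) \<Rightarrow> bool" where
  "inverse_over K A Q E P G F \<eta> \<epsilon> \<longleftrightarrow>
     enhanced_two_functor A E G \<and> map_eq_on A (comp_map P G) Q \<and>
     enhanced_two_functor E A F \<and> map_eq_on E (comp_map Q F) P \<and>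
     two_natural E E id_map (comp_map G F) \<eta> \<and>
     (\<forall>X \<in> Obj E. invertible1 E (\<eta> X) \<and> map1 P (\<eta> X) = Id1 K (map0 P X)) \<and>
     two_natural A A (comp_map F G) id_map \<epsilon> \<and>
     (\<forall>a \<in> Obj A. invertible1 A (\<epsilon> a) \<and> map1 Q (\<epsilon> a) = Id1 K (map0 Q a))"

definition equivalence_over :: "('o, 'm, 'c) two_cat \<Rightarrow>
    ('r, 's, 't) two_cat \<Rightarrow> ('r, 's, 't, 'o, 'm, 'c) two_map \<Rightarrow>
    ('p, 'n, 'd) two_cat \<Rightarrow> ('p, 'n, 'd, 'o, 'm, 'c) two_map \<Rightarrow>
    ('r, 's, 't, 'p, 'n, 'd) two_map \<Rightarrow> bool" where
  "equivalence_over K A Q E P G \<longleftrightarrow> (\<exists>F \<eta> \<epsilon>. inverse_over K A Q E P G F \<eta> \<epsilon>)"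

text \<open>The same with the triangle identities, so that \<open>G\<close> is right adjoint to \<open>F\<close>.\<close>

definition right_adjoint_equivalence_over :: "('o, 'm, 'c) two_cat \<Rightarrow>
    ('r, 's, 't) two_cat \<Rightarrow> ('r, 's, 't, 'o, 'm, 'c) two_map \<Rightarrow>
    ('p, 'n, 'd) two_cat \<Rightarrow> ('p, 'n, 'd, 'o, 'm, 'c) two_map \<Rightarrow>
    ('r, 's, 't, 'p, 'n, 'd) two_map \<Rightarrow> bool" where
  "right_adjoint_equivalence_over K A Q E P G \<longleftrightarrow> (\<exists>F \<eta> \<epsilon>.
     inverse_over K A Q E P G F \<eta> \<epsilon> \<and>
     (\<forall>a \<in> Obj A. map1 G (\<epsilon> a) \<odot>\<^bsub>E\<^esub> \<eta> (map0 G a) = Id1 E (map0 G a)) \<and>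
     (\<forall>X \<in> Obj E. \<epsilon> (map0 F X) \<odot>\<^bsub>A\<^esub> map1 F (\<eta> X) = Id1 A (map0 F X)))"

end

theory Submission
  imports Defs
begin

text \<open>
  Condition (1) can be unwound: a 2-functor into the marked lax slice over \<open>U\<close> that is strictly a
  section of the domain projection amounts to cartesian 1-cells \<open>k\<^sub>X : X \<rightarrow> U\<close> together with 2-cells
  \<open>\<delta>\<^sub>x : k\<^sub>X \<Rightarrow> k\<^sub>Y \<circ> x\<close>, functorial in \<open>x\<close>, natural in 2-cells and invertible for cartesian \<open>x\<close>, and
  the isomorphism \<open>!\<^sub>U\<close> amounts to an invertible \<open>\<sigma> : k\<^sub>U \<Rightarrow> 1\<^sub>U\<close>.  These data form the locale
  \<open>marked_lax_cocone\<close>.  It remains to compare such cocones with inverses of \<open>G = (-)\<^sup>*U\<close> over \<open>K\<close>.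
  Throughout, \<open>V\<close> is \<open>P U\<close>, and \<open>\<lambda>\<^sub>a : a\<^sup>*U \<rightarrow> U\<close> is the chosen lift of \<open>a : A \<rightarrow> V\<close>.

  From a cocone to an equivalence.  The image of the cocone under \<open>P\<close> is a 2-functor \<open>F\<close> from \<open>E\<close>
  to \<open>K//V\<close> over \<open>K\<close>, given by \<open>F X = P k\<^sub>X\<close> and \<open>F x = (P x, P \<delta>\<^sub>x)\<close>.  Both \<open>k\<^sub>X\<close> and \<open>\<lambda>\<^bsub>F X\<^esub>\<close> are cartesian
  over the same 1-cell, and the vertical comparison between them is the unit.  The counit
  at \<open>a\<close> is \<open>P\<close> applied to the pasting \<open>k\<^bsub>a\<^sup>*U\<^esub> \<Rightarrow> k\<^sub>U \<circ> \<lambda>\<^sub>a \<Rightarrow> \<lambda>\<^sub>a\<close> of \<open>\<delta>\<close> and \<open>\<sigma>\<close> (called \<open>mediator\<close>), which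
  is invertible because \<open>\<lambda>\<^sub>a\<close> is marked.  Mediators \<open>k\<^sub>X \<Rightarrow> p\<close> exist for all \<open>p : X \<rightarrow> U\<close> and are
  natural in \<open>p\<close> and compatible with precomposition; this gives naturality of the counit.  One
  triangle identity is a direct computation, and the other one is formal (\<open>second_triangle\<close>).

  From an equivalence to a cocone.  Given \<open>F\<close>, \<open>\<eta>\<close> and \<open>\<epsilon>\<close>, put \<open>k\<^sub>X = \<lambda>\<^bsub>F X\<^esub> \<circ> \<eta>\<^sub>X\<close>, a cartesian 1-cell
  over \<open>F X\<close>, and let \<open>\<delta>\<^sub>x\<close> be the lift at \<open>k\<^sub>X\<close> of the 2-cell of \<open>F x\<close>; naturality of \<open>\<eta>\<close> says that
  \<open>\<delta>\<^sub>x\<close> ends at \<open>k\<^sub>Y \<circ> x\<close>, and all equations follow from uniqueness of lifts.  The remaining data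
  come from \<open>G\<close> being full (\<open>G_full\<close>) and conservative (\<open>G_conservative\<close>): conservativity shows
  that \<open>\<delta>\<^sub>x\<close> is invertible for cartesian \<open>x\<close> (\<open>cocone_cell_invertible\<close>), and \<open>\<sigma>\<close> is the lift of the
  2-cell of a preimage of \<open>\<eta>\<^sub>U\<^sup>-\<^sup>1 : G F U \<rightarrow> U = G 1\<^sub>V\<close> under \<open>G\<close> (\<open>cocone_point\<close>).

  Nearly every equation between 2-cells of \<open>E\<close> is checked in \<open>K\<close>: two 2-cells of \<open>E\<close> with the same
  source and the same image under \<open>P\<close> are equal, and then so are their targets.
\<close>

section \<open>Calculus of 2-cells\<close>

lemma hom1_I: "f \<in> One C \<Longrightarrow> Dom C f = A \<Longrightarrow> Cod C f = B \<Longrightarrow> f \<in> hom1 C A B"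
  by (simp add: hom1_def)

lemma hom2_I: "\<alpha> \<in> Two C \<Longrightarrow> Src C \<alpha> = f \<Longrightarrow> Tgt C \<alpha> = g \<Longrightarrow> \<alpha> \<in> hom2 C f g"
  by (simp add: hom2_def)

lemma hom1_D:
  assumes "f \<in> hom1 C A B"
  shows "f \<in> One C" "Dom C f = A" "Cod C f = B"
  using assms by (simp_all add: hom1_def)

lemma hom2_D:
  assumes "\<alpha> \<in> hom2 C f g"
  shows "\<alpha> \<in> Two C" "Src C \<alpha> = f" "Tgt C \<alpha> = g"
  using assms by (simp_all add: hom2_def)

context enhanced_two_category
begin

lemma hom2_parallel:
  assumes "\<alpha> \<in> hom2 C f g"
  shows "f \<in> One C" "g \<in> One C" "Dom C g = Dom C f" "Cod C g = Cod C f"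
  using src_closed tgt_closed hom2_D[OF assms] by (auto simp: hom1_def)

lemma hom2_hom1:
  assumes "\<alpha> \<in> hom2 C f g" "f \<in> hom1 C A B"
  shows "g \<in> hom1 C A B"
  using hom2_parallel[OF assms(1)] assms(2) by (auto simp: hom1_def)

lemma id1_One:
  assumes "A \<in> Obj C"
  shows "Id1 C A \<in> One C" "Dom C (Id1 C A) = A" "Cod C (Id1 C A) = A"
  using hom1_D[OF id1_closed[OF assms]] by auto

lemma comp1_One:
  assumes "f \<in> One C" "g \<in> One C" "Cod C f = Dom C g"
  shows "g \<odot> f \<in> One C" "Dom C (g \<odot> f) = Dom C f" "Cod C (g \<odot> f) = Cod C g"
  using hom1_D[OF comp1_closed[OF hom1_I[OF assms(1) refl assms(3)] hom1_I[OF assms(2) refl refl]]]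
  by auto

lemma comp1_id_left': "f \<in> hom1 C A B \<Longrightarrow> Id1 C B \<odot> f = f"
  using comp1_id_left by (auto simp: hom1_def)

lemma comp1_id_right': "f \<in> hom1 C A B \<Longrightarrow> f \<odot> Id1 C A = f"
  using comp1_id_right by (auto simp: hom1_def)

lemma comp1_assoc':
  "f \<in> hom1 C A B \<Longrightarrow> g \<in> hom1 C B D \<Longrightarrow> h \<in> hom1 C D F \<Longrightarrow> (h \<odot> g) \<odot> f = h \<odot> (g \<odot> f)"
  using comp1_assoc by (auto simp: hom1_def)

lemma vcomp_id_left': "\<alpha> \<in> hom2 C f g \<Longrightarrow> Id2 C g \<cdot> \<alpha> = \<alpha>"
  using vcomp_id_left by (auto simp: hom2_def)

lemma vcomp_id_right': "\<alpha> \<in> hom2 C f g \<Longrightarrow> \<alpha> \<cdot> Id2 C f = \<alpha>"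
  using vcomp_id_right by (auto simp: hom2_def)

lemma vcomp_assoc':
  "\<alpha> \<in> hom2 C f g \<Longrightarrow> \<beta> \<in> hom2 C g h \<Longrightarrow> \<gamma> \<in> hom2 C h k \<Longrightarrow> (\<gamma> \<cdot> \<beta>) \<cdot> \<alpha> = \<gamma> \<cdot> (\<beta> \<cdot> \<alpha>)"
  using vcomp_assoc by (auto simp: hom2_def)

lemma hcomp_assoc':
  assumes "\<alpha> \<in> hom2 C f f'" "\<beta> \<in> hom2 C g g'" "\<gamma> \<in> hom2 C h h'"
    and "Cod C f = Dom C g" "Cod C g = Dom C h"
  shows "(\<gamma> \<star> \<beta>) \<star> \<alpha> = \<gamma> \<star> (\<beta> \<star> \<alpha>)"
  using assms by (intro hcomp_assoc) (auto simp: hom2_def)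

lemma interchange':
  assumes "\<alpha> \<in> hom2 C f f'" "\<alpha>' \<in> hom2 C f' f''" "\<beta> \<in> hom2 C g g'" "\<beta>' \<in> hom2 C g' g''"
    and "Cod C f = Dom C g"
  shows "(\<beta>' \<cdot> \<beta>) \<star> (\<alpha>' \<cdot> \<alpha>) = (\<beta>' \<star> \<alpha>') \<cdot> (\<beta> \<star> \<alpha>)"
  using assms by (intro interchange) (auto simp: hom2_def)

lemma postwhisker_closed:
  assumes "\<alpha> \<in> hom2 C f f'" "g \<in> One C" "Cod C f = Dom C g"
  shows "Id2 C g \<star> \<alpha> \<in> hom2 C (g \<odot> f) (g \<odot> f')"
  using hcomp_closed[OF assms(1) id2_closed[OF assms(2)] assms(3)] .

lemma prewhisker_closed:
  assumes "\<beta> \<in> hom2 C g g'" "f \<in> One C" "Cod C f = Dom C g"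
  shows "\<beta> \<star> Id2 C f \<in> hom2 C (g \<odot> f) (g' \<odot> f)"
  using hcomp_closed[OF id2_closed[OF assms(2)] assms(1) assms(3)] .

lemma postwhisker_vcomp:
  assumes "\<alpha> \<in> hom2 C f f'" "\<alpha>' \<in> hom2 C f' f''" "g \<in> One C" "Cod C f = Dom C g"
  shows "Id2 C g \<star> (\<alpha>' \<cdot> \<alpha>) = (Id2 C g \<star> \<alpha>') \<cdot> (Id2 C g \<star> \<alpha>)"
  using interchange'[OF assms(1,2) id2_closed[OF assms(3)] id2_closed[OF assms(3)] assms(4)]
    vcomp_id_left'[OF id2_closed[OF assms(3)]] by simp

lemma prewhisker_vcomp:
  assumes "\<beta> \<in> hom2 C g g'" "\<beta>' \<in> hom2 C g' g''" "f \<in> One C" "Cod C f = Dom C g"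
  shows "(\<beta>' \<cdot> \<beta>) \<star> Id2 C f = (\<beta>' \<star> Id2 C f) \<cdot> (\<beta> \<star> Id2 C f)"
  using interchange'[OF id2_closed[OF assms(3)] id2_closed[OF assms(3)] assms(1,2,4)]
    vcomp_id_left'[OF id2_closed[OF assms(3)]] by simp

lemma whisker_exchange:
  assumes a: "\<alpha> \<in> hom2 C f f'" and b: "\<beta> \<in> hom2 C g g'" and c: "Cod C f = Dom C g"
  shows "(Id2 C g' \<star> \<alpha>) \<cdot> (\<beta> \<star> Id2 C f) = (\<beta> \<star> Id2 C f') \<cdot> (Id2 C g \<star> \<alpha>)"
proof -
  note pa = hom2_parallel[OF a] and pb = hom2_parallel[OF b]
  have "(Id2 C g' \<cdot> \<beta>) \<star> (\<alpha> \<cdot> Id2 C f) = (\<beta> \<cdot> Id2 C g) \<star> (Id2 C f' \<cdot> \<alpha>)"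
    using a b by (simp add: vcomp_id_left' vcomp_id_right')
  moreover have "(Id2 C g' \<cdot> \<beta>) \<star> (\<alpha> \<cdot> Id2 C f) = (Id2 C g' \<star> \<alpha>) \<cdot> (\<beta> \<star> Id2 C f)"
    by (rule interchange'[OF id2_closed[OF pa(1)] a b id2_closed[OF pb(2)] c])
  moreover have "(\<beta> \<cdot> Id2 C g) \<star> (Id2 C f' \<cdot> \<alpha>) = (\<beta> \<star> Id2 C f') \<cdot> (Id2 C g \<star> \<alpha>)"
    by (rule interchange'[OF a id2_closed[OF pa(2)] id2_closed[OF pb(1)] b c])
  ultimately show ?thesis by simp
qed

lemma prewhisker_comp1:
  assumes "\<beta> \<in> hom2 C h h'" "f \<in> One C" "g \<in> One C" "Cod C f = Dom C g" "Cod C g = Dom C h"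
  shows "(\<beta> \<star> Id2 C g) \<star> Id2 C f = \<beta> \<star> Id2 C (g \<odot> f)"
  using hcomp_assoc'[OF id2_closed[OF assms(2)] id2_closed[OF assms(3)] assms(1)] assms
    hcomp_id2[of f g] by simp

lemma postwhisker_id1: "\<alpha> \<in> hom2 C f f' \<Longrightarrow> Cod C f = A \<Longrightarrow> Id2 C (Id1 C A) \<star> \<alpha> = \<alpha>"
  using hcomp_id_left[of \<alpha>] by (auto simp: hom2_def)

lemma prewhisker_id1: "\<alpha> \<in> hom2 C f f' \<Longrightarrow> Dom C f = A \<Longrightarrow> \<alpha> \<star> Id2 C (Id1 C A) = \<alpha>"
  using hcomp_id_right[of \<alpha>] by (auto simp: hom2_def)

lemma invertible1E:
  assumes "invertible1 C f" "f \<in> hom1 C A B"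
  obtains g where "g \<in> hom1 C B A" "g \<odot> f = Id1 C A" "f \<odot> g = Id1 C B"
  using assms by (auto simp: invertible1_def dest: hom1_D)

lemma invertible1I:
  assumes "f \<in> hom1 C A B" "g \<in> hom1 C B A" "g \<odot> f = Id1 C A" "f \<odot> g = Id1 C B"
  shows "invertible1 C f"
  using assms by (auto simp: invertible1_def hom1_def)

lemma invertible2E:
  assumes "invertible2 C \<alpha>" "\<alpha> \<in> hom2 C f g"
  obtains \<beta> where "\<beta> \<in> hom2 C g f" "\<beta> \<cdot> \<alpha> = Id2 C f" "\<alpha> \<cdot> \<beta> = Id2 C g"
  using assms by (auto simp: invertible2_def dest: hom2_D)

lemma invertible2I:
  assumes "\<alpha> \<in> hom2 C f g" "\<beta> \<in> hom2 C g f" "\<beta> \<cdot> \<alpha> = Id2 C f" "\<alpha> \<cdot> \<beta> = Id2 C g"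
  shows "invertible2 C \<alpha>"
  using assms by (auto simp: invertible2_def hom2_def)

lemma invertible2_vcomp:
  assumes a: "\<alpha> \<in> hom2 C f g" "invertible2 C \<alpha>" and b: "\<beta> \<in> hom2 C g h" "invertible2 C \<beta>"
  shows "invertible2 C (\<beta> \<cdot> \<alpha>)"
proof -
  obtain a' where a': "a' \<in> hom2 C g f" "a' \<cdot> \<alpha> = Id2 C f" "\<alpha> \<cdot> a' = Id2 C g"
    using invertible2E[OF a(2,1)] .
  obtain b' where b': "b' \<in> hom2 C h g" "b' \<cdot> \<beta> = Id2 C g" "\<beta> \<cdot> b' = Id2 C h"
    using invertible2E[OF b(2,1)] .
  have "(a' \<cdot> b') \<cdot> (\<beta> \<cdot> \<alpha>) = a' \<cdot> ((b' \<cdot> \<beta>) \<cdot> \<alpha>)"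
    using vcomp_assoc'[OF vcomp_closed[OF a(1) b(1)] b'(1) a'(1)] vcomp_assoc'[OF a(1) b(1) b'(1)]
    by simp
  moreover have "(\<beta> \<cdot> \<alpha>) \<cdot> (a' \<cdot> b') = \<beta> \<cdot> ((\<alpha> \<cdot> a') \<cdot> b')"
    using vcomp_assoc'[OF vcomp_closed[OF b'(1) a'(1)] a(1) b(1)] vcomp_assoc'[OF b'(1) a'(1) a(1)]
    by simp
  ultimately show ?thesis
    using a' b' vcomp_id_left'[OF a(1)] vcomp_id_left'[OF b'(1)]
    by (intro invertible2I[OF vcomp_closed[OF a(1) b(1)] vcomp_closed[OF b'(1) a'(1)]]) simp_all
qed

lemma invertible2_prewhisker:
  assumes b: "\<beta> \<in> hom2 C g g'" "invertible2 C \<beta>" and f: "f \<in> One C" "Cod C f = Dom C g"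
  shows "invertible2 C (\<beta> \<star> Id2 C f)"
proof -
  obtain b' where b': "b' \<in> hom2 C g' g" "b' \<cdot> \<beta> = Id2 C g" "\<beta> \<cdot> b' = Id2 C g'"
    using invertible2E[OF b(2,1)] .
  note p = hom2_parallel[OF b(1)]
  show ?thesis
  proof (rule invertible2I[OF prewhisker_closed[OF b(1) f]])
    show "b' \<star> Id2 C f \<in> hom2 C (g' \<odot> f) (g \<odot> f)"
      using prewhisker_closed[OF b'(1)] f p by simp
    show "(b' \<star> Id2 C f) \<cdot> (\<beta> \<star> Id2 C f) = Id2 C (g \<odot> f)"
      using prewhisker_vcomp[OF b(1) b'(1) f] b'(2) hcomp_id2[OF f(1) p(1)] f by simp
    show "(\<beta> \<star> Id2 C f) \<cdot> (b' \<star> Id2 C f) = Id2 C (g' \<odot> f)"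
      using prewhisker_vcomp[OF b'(1) b(1) f(1)] b'(3) hcomp_id2[OF f(1) p(2)] f p by simp
  qed
qed

end

section \<open>Lax slices and full sub-2-categories\<close>

lemma lax_slice_simps [simp]:
  "Obj (lax_slice K X) = {a \<in> One K. Cod K a = X}"
  "One (lax_slice K X) = slice_One K X"
  "Two (lax_slice K X) = slice_Two K X"
  "Dom (lax_slice K X) = slice_dom"
  "Cod (lax_slice K X) = slice_cod"
  "Src (lax_slice K X) = slice_src"
  "Tgt (lax_slice K X) = slice_tgt"
  "Id1 (lax_slice K X) = (\<lambda>a. Slice1 a (Id1 K (Dom K a)) (Id2 K a) a)"
  "Id2 (lax_slice K X) = (\<lambda>s. Slice2 s (Id2 K (slice_arr s)) s)"
  "Comp1 (lax_slice K X) = slice_comp K"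
  "VComp (lax_slice K X) =
    (\<lambda>\<tau> \<sigma>. Slice2 (slice_src \<sigma>) (VComp K (slice_map \<tau>) (slice_map \<sigma>)) (slice_tgt \<tau>))"
  "HComp (lax_slice K X) =
    (\<lambda>\<tau> \<sigma>. Slice2 (slice_comp K (slice_src \<tau>) (slice_src \<sigma>))
      (HComp K (slice_map \<tau>) (slice_map \<sigma>)) (slice_comp K (slice_tgt \<tau>) (slice_tgt \<sigma>)))"
  "Tight (lax_slice K X) = {s \<in> slice_One K X. slice_arr s \<in> Tight K}"
  by (simp_all add: lax_slice_def)

lemma slice_proj_simps [simp]:
  "map0 (slice_proj K) = Dom K"
  "map1 (slice_proj K) = slice_arr"
  "map2 (slice_proj K) = slice_map"
  by (simp_all add: slice_proj_def)

lemma slice_One_iff: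
  "Slice1 a h \<phi> b \<in> slice_One K X \<longleftrightarrow>
    a \<in> One K \<and> Cod K a = X \<and> b \<in> One K \<and> Cod K b = X \<and>
    h \<in> hom1 K (Dom K a) (Dom K b) \<and> \<phi> \<in> hom2 K a (b \<odot>\<^bsub>K\<^esub> h)"
  by (auto simp: slice_One_def)

lemma slice_One_E:
  assumes "s \<in> slice_One K X"
  obtains a h \<phi> b where "s = Slice1 a h \<phi> b" "a \<in> One K" "Cod K a = X" "b \<in> One K" "Cod K b = X"
    "h \<in> hom1 K (Dom K a) (Dom K b)" "\<phi> \<in> hom2 K a (b \<odot>\<^bsub>K\<^esub> h)"
  using assms by (auto simp: slice_One_def)

lemma slice_One_D:
  assumes "s \<in> slice_One K X"
  shows "slice_dom s \<in> One K" "Cod K (slice_dom s) = X" "slice_cod s \<in> One K"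
    "Cod K (slice_cod s) = X" "slice_arr s \<in> hom1 K (Dom K (slice_dom s)) (Dom K (slice_cod s))"
    "slice_cell s \<in> hom2 K (slice_dom s) (slice_cod s \<odot>\<^bsub>K\<^esub> slice_arr s)"
  using assms by (auto simp: slice_One_def)

lemma slice_Two_iff:
  "Slice2 s \<theta> t \<in> slice_Two K X \<longleftrightarrow>
    s \<in> slice_One K X \<and> t \<in> slice_One K X \<and>
    slice_dom s = slice_dom t \<and> slice_cod s = slice_cod t \<and>
    \<theta> \<in> hom2 K (slice_arr s) (slice_arr t) \<and>
    (Id2 K (slice_cod s) \<star>\<^bsub>K\<^esub> \<theta>) \<cdot>\<^bsub>K\<^esub> slice_cell s = slice_cell t"
  by (auto simp: slice_Two_def)

lemma slice_Two_D:
  assumes "\<sigma> \<in> slice_Two K X"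
  shows "slice_src \<sigma> \<in> slice_One K X" "slice_tgt \<sigma> \<in> slice_One K X"
    "slice_dom (slice_tgt \<sigma>) = slice_dom (slice_src \<sigma>)"
    "slice_cod (slice_tgt \<sigma>) = slice_cod (slice_src \<sigma>)"
    "slice_map \<sigma> \<in> hom2 K (slice_arr (slice_src \<sigma>)) (slice_arr (slice_tgt \<sigma>))"
    "(Id2 K (slice_cod (slice_src \<sigma>)) \<star>\<^bsub>K\<^esub> slice_map \<sigma>) \<cdot>\<^bsub>K\<^esub> slice_cell (slice_src \<sigma>) =
      slice_cell (slice_tgt \<sigma>)"
  using assms by (auto simp: slice_Two_def)

lemma slice_Two_I:
  assumes "slice_src \<sigma> \<in> slice_One K X" "slice_tgt \<sigma> \<in> slice_One K X"
    "slice_dom (slice_tgt \<sigma>) = slice_dom (slice_src \<sigma>)"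
    "slice_cod (slice_tgt \<sigma>) = slice_cod (slice_src \<sigma>)"
    "slice_map \<sigma> \<in> hom2 K (slice_arr (slice_src \<sigma>)) (slice_arr (slice_tgt \<sigma>))"
    "(Id2 K (slice_cod (slice_src \<sigma>)) \<star>\<^bsub>K\<^esub> slice_map \<sigma>) \<cdot>\<^bsub>K\<^esub> slice_cell (slice_src \<sigma>) =
      slice_cell (slice_tgt \<sigma>)"
  shows "\<sigma> \<in> slice_Two K X"
  using assms by (cases \<sigma>) (auto simp: slice_Two_iff)

lemma slice_comp_simps [simp]:
  "slice_dom (slice_comp K t s) = slice_dom s"
  "slice_cod (slice_comp K t s) = slice_cod t"
  "slice_arr (slice_comp K t s) = slice_arr t \<odot>\<^bsub>K\<^esub> slice_arr s"
  "slice_cell (slice_comp K t s) =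
    (slice_cell t \<star>\<^bsub>K\<^esub> Id2 K (slice_arr s)) \<cdot>\<^bsub>K\<^esub> slice_cell s"
  by (simp_all add: slice_comp_def)

lemma slice1_eqI:
  "slice_dom s = slice_dom t \<Longrightarrow> slice_arr s = slice_arr t \<Longrightarrow> slice_cell s = slice_cell t \<Longrightarrow>
    slice_cod s = slice_cod t \<Longrightarrow> s = t"
  by (cases s; cases t) simp

lemma slice2_eqI:
  "slice_src \<sigma> = slice_src \<tau> \<Longrightarrow> slice_map \<sigma> = slice_map \<tau> \<Longrightarrow> slice_tgt \<sigma> = slice_tgt \<tau> \<Longrightarrow> \<sigma> = \<tau>"
  by (cases \<sigma>; cases \<tau>) simp

context enhanced_two_category
begin

lemma slice_comp_closed:
  assumes s: "s \<in> slice_One C X" and t: "t \<in> slice_One C X" and st: "slice_cod s = slice_dom t"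
  shows "slice_comp C t s \<in> slice_One C X"
proof -
  note S = slice_One_D[OF s] and T = slice_One_D[OF t]
  note h = hom1_D[OF S(5)] and k = hom1_D[OF T(5)]
  have "slice_cell t \<star> Id2 C (slice_arr s) \<in>
      hom2 C (slice_dom t \<odot> slice_arr s) ((slice_cod t \<odot> slice_arr t) \<odot> slice_arr s)"
    using prewhisker_closed[OF T(6) h(1)] h st by simp
  moreover have "(slice_cod t \<odot> slice_arr t) \<odot> slice_arr s = slice_cod t \<odot> (slice_arr t \<odot> slice_arr s)"
    using comp1_assoc[of "slice_arr s" "slice_arr t" "slice_cod t"] h k T st by simp
  ultimately have "(slice_cell t \<star> Id2 C (slice_arr s)) \<cdot> slice_cell s \<in>
      hom2 C (slice_dom s) (slice_cod t \<odot> (slice_arr t \<odot> slice_arr s))"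
    using vcomp_closed S(6) st by simp
  moreover have "slice_arr t \<odot> slice_arr s \<in> hom1 C (Dom C (slice_dom s)) (Dom C (slice_cod t))"
    using comp1_closed S(5) T(5) st by simp
  ultimately show ?thesis
    using S T by (simp add: slice_comp_def slice_One_iff)
qed

lemma slice_comp_assoc:
  assumes s: "s \<in> slice_One C X" and t: "t \<in> slice_One C X" and u: "u \<in> slice_One C X"
    and st: "slice_cod s = slice_dom t" and tu: "slice_cod t = slice_dom u"
  shows "slice_comp C (slice_comp C u t) s = slice_comp C u (slice_comp C t s)"
proof (rule slice1_eqI)
  note S = slice_One_D[OF s] and T = slice_One_D[OF t] and U = slice_One_D[OF u]
  note h = hom1_D[OF S(5)] and k = hom1_D[OF T(5)] and l = hom1_D[OF U(5)]
  show "slice_arr (slice_comp C (slice_comp C u t) s) = slice_arr (slice_comp C u (slice_comp C t s))"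
    using comp1_assoc h k l st tu by simp
  let ?h = "slice_arr s" and ?k = "slice_arr t"
  note uk = prewhisker_closed[OF U(6) k(1)]
  have c1: "slice_cell u \<star> Id2 C ?k \<in>
      hom2 C (slice_dom u \<odot> ?k) ((slice_cod u \<odot> slice_arr u) \<odot> ?k)"
    using uk k tu by simp
  have c0: "slice_cell t \<in> hom2 C (slice_dom t) (slice_dom u \<odot> ?k)"
    using T(6) tu by simp
  have "((slice_cell u \<star> Id2 C ?k) \<cdot> slice_cell t) \<star> Id2 C ?h =
      ((slice_cell u \<star> Id2 C ?k) \<star> Id2 C ?h) \<cdot> (slice_cell t \<star> Id2 C ?h)"
    by (rule prewhisker_vcomp[OF c0 c1 h(1)]) (use h st in simp)
  also have "(slice_cell u \<star> Id2 C ?k) \<star> Id2 C ?h = slice_cell u \<star> Id2 C (?k \<odot> ?h)"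
    by (rule prewhisker_comp1[OF U(6) h(1) k(1)]) (use h k st tu in simp_all)
  finally have e: "((slice_cell u \<star> Id2 C ?k) \<cdot> slice_cell t) \<star> Id2 C ?h =
      (slice_cell u \<star> Id2 C (?k \<odot> ?h)) \<cdot> (slice_cell t \<star> Id2 C ?h)" .
  have d0: "slice_cell s \<in> hom2 C (slice_dom s) (slice_dom t \<odot> ?h)"
    using S(6) st by simp
  have d1: "slice_cell t \<star> Id2 C ?h \<in> hom2 C (slice_dom t \<odot> ?h) (slice_dom u \<odot> (?k \<odot> ?h))"
    using prewhisker_closed[OF c0 h(1)] h k st tu U comp1_assoc[of ?h ?k "slice_dom u"] by simp
  have d2: "slice_cell u \<star> Id2 C (?k \<odot> ?h) \<in>
      hom2 C (slice_dom u \<odot> (?k \<odot> ?h)) ((slice_cod u \<odot> slice_arr u) \<odot> (?k \<odot> ?h))"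
    by (rule prewhisker_closed[OF U(6)]) (use comp1_One h k st tu in simp_all)
  show "slice_cell (slice_comp C (slice_comp C u t) s) =
      slice_cell (slice_comp C u (slice_comp C t s))"
    using e vcomp_assoc'[OF d0 d1 d2] by simp
qed simp_all

lemma slice_id_closed:
  assumes "a \<in> One C" "Cod C a = X"
  shows "Slice1 a (Id1 C (Dom C a)) (Id2 C a) a \<in> slice_One C X"
  using assms id1_closed dom_closed id2_closed comp1_id_right by (simp add: slice_One_iff)

lemma slice_comp_id_left:
  assumes s: "s \<in> slice_One C X" and b: "slice_cod s = b"
  shows "slice_comp C (Slice1 b (Id1 C (Dom C b)) (Id2 C b) b) s = s"
proof -
  note S = slice_One_D[OF s] and h = hom1_D[OF slice_One_D(5)[OF s]]
  show ?thesis
    using b comp1_id_left[OF h(1)] h S hcomp_id2[of "slice_arr s" b] vcomp_id_left'[OF S(6)]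
    by (intro slice1_eqI) simp_all
qed

lemma slice_comp_id_right:
  assumes s: "s \<in> slice_One C X" and a: "slice_dom s = a"
  shows "slice_comp C s (Slice1 a (Id1 C (Dom C a)) (Id2 C a) a) = s"
proof -
  note S = slice_One_D[OF s] and h = hom1_D[OF slice_One_D(5)[OF s]]
  show ?thesis
    using a comp1_id_right[OF h(1)] h S prewhisker_id1[OF S(6)] vcomp_id_right'[OF S(6)]
    by (intro slice1_eqI) simp_all
qed

lemma slice_vcomp_closed:
  assumes s: "\<sigma> \<in> slice_Two C X" and t: "\<tau> \<in> slice_Two C X" and st: "slice_tgt \<sigma> = slice_src \<tau>"
  shows "Slice2 (slice_src \<sigma>) (slice_map \<tau> \<cdot> slice_map \<sigma>) (slice_tgt \<tau>) \<in> slice_Two C X"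
proof -
  note S = slice_Two_D[OF s] and T = slice_Two_D[OF t]
  note h = hom1_D[OF slice_One_D(5)[OF S(1)]] and A = slice_One_D[OF S(1)]
  let ?b = "slice_cod (slice_src \<sigma>)"
  have t': "slice_map \<tau> \<in> hom2 C (slice_arr (slice_tgt \<sigma>)) (slice_arr (slice_tgt \<tau>))"
    using T(5) st by simp
  have hb: "Cod C (slice_arr (slice_src \<sigma>)) = Dom C ?b" using h by simp
  have hb': "Cod C (slice_arr (slice_tgt \<sigma>)) = Dom C ?b"
    using hom2_parallel(4)[OF S(5)] hb by simp
  have "(Id2 C ?b \<star> (slice_map \<tau> \<cdot> slice_map \<sigma>)) \<cdot> slice_cell (slice_src \<sigma>) =
      ((Id2 C ?b \<star> slice_map \<tau>) \<cdot> (Id2 C ?b \<star> slice_map \<sigma>)) \<cdot> slice_cell (slice_src \<sigma>)"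
    using postwhisker_vcomp[OF S(5) t' A(3) hb] by simp
  also have "\<dots> = (Id2 C ?b \<star> slice_map \<tau>) \<cdot> ((Id2 C ?b \<star> slice_map \<sigma>) \<cdot> slice_cell (slice_src \<sigma>))"
    by (rule vcomp_assoc'[OF A(6) postwhisker_closed[OF S(5) A(3) hb] postwhisker_closed[OF t' A(3) hb']])
  also have "\<dots> = slice_cell (slice_tgt \<tau>)"
    using S(6) T(6) S(4) st by simp
  finally show ?thesis
    using S T st vcomp_closed[OF S(5) t'] by (intro slice_Two_I) simp_all
qed

lemma slice_hcomp_closed:
  assumes s: "\<sigma> \<in> slice_Two C X" and t: "\<tau> \<in> slice_Two C X"
    and st: "slice_cod (slice_src \<sigma>) = slice_dom (slice_src \<tau>)"
  shows "Slice2 (slice_comp C (slice_src \<tau>) (slice_src \<sigma>)) (slice_map \<tau> \<star> slice_map \<sigma>)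
    (slice_comp C (slice_tgt \<tau>) (slice_tgt \<sigma>)) \<in> slice_Two C X"
proof -
  note S = slice_Two_D[OF s] and T = slice_Two_D[OF t]
  note A = slice_One_D[OF S(1)] and B = slice_One_D[OF T(1)] and A' = slice_One_D[OF S(2)]
  note h = hom1_D[OF A(5)] and k = hom1_D[OF B(5)]
  let ?h = "slice_arr (slice_src \<sigma>)" and ?h' = "slice_arr (slice_tgt \<sigma>)"
  let ?k = "slice_arr (slice_src \<tau>)" and ?k' = "slice_arr (slice_tgt \<tau>)"
  let ?\<theta> = "slice_map \<sigma>" and ?\<kappa> = "slice_map \<tau>"
  let ?c = "slice_cod (slice_src \<tau>)" and ?b = "slice_dom (slice_src \<tau>)"
  let ?\<phi> = "slice_cell (slice_src \<sigma>)" and ?\<psi> = "slice_cell (slice_src \<tau>)"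
  note ph = hom2_parallel[OF S(5)] and pk = hom2_parallel[OF T(5)]
  have hk: "Cod C ?h = Dom C ?k" using h k st by simp
  have kc: "Cod C ?k = Dom C ?c" using k by simp
  have ck: "?c \<odot> ?k \<in> One C" "Dom C (?c \<odot> ?k) = Dom C ?k"
    using comp1_One k B by simp_all
  have hb: "Cod C ?h = Dom C ?b" using h st by simp
  have ft: "?\<phi> \<in> hom2 C (slice_dom (slice_src \<sigma>)) (?b \<odot> ?h)" using A(6) st by simp
  have p1: "?\<psi> \<star> Id2 C ?h \<in> hom2 C (?b \<odot> ?h) ((?c \<odot> ?k) \<odot> ?h)"
    by (rule prewhisker_closed[OF B(6) h(1) hb])
  have kt: "?\<kappa> \<star> ?\<theta> \<in> hom2 C (?k \<odot> ?h) (?k' \<odot> ?h')"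
    by (rule hcomp_closed[OF S(5) T(5) hk])
  have ckt: "Id2 C ?c \<star> (?\<kappa> \<star> ?\<theta>) = (Id2 C ?c \<star> ?\<kappa>) \<star> ?\<theta>"
    using hcomp_assoc'[OF S(5) T(5) id2_closed[OF B(3)] hk kc] by simp
  have ckk: "Id2 C ?c \<star> ?\<kappa> \<in> hom2 C (?c \<odot> ?k) (?c \<odot> ?k')"
    by (rule postwhisker_closed[OF T(5) B(3) kc])
  have ckt': "(Id2 C ?c \<star> ?\<kappa>) \<star> ?\<theta> \<in> hom2 C ((?c \<odot> ?k) \<odot> ?h) ((?c \<odot> ?k') \<odot> ?h')"
    by (rule hcomp_closed[OF S(5) ckk]) (use hk ck in simp)
  have "(Id2 C ?c \<star> (?\<kappa> \<star> ?\<theta>)) \<cdot> ((?\<psi> \<star> Id2 C ?h) \<cdot> ?\<phi>) =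
      (((Id2 C ?c \<star> ?\<kappa>) \<star> ?\<theta>) \<cdot> (?\<psi> \<star> Id2 C ?h)) \<cdot> ?\<phi>"
    using ckt vcomp_assoc'[OF ft p1 ckt'] by simp
  also have "((Id2 C ?c \<star> ?\<kappa>) \<star> ?\<theta>) \<cdot> (?\<psi> \<star> Id2 C ?h) = ((Id2 C ?c \<star> ?\<kappa>) \<cdot> ?\<psi>) \<star> (?\<theta> \<cdot> Id2 C ?h)"
    by (rule interchange'[OF id2_closed[OF h(1)] S(5) B(6) ckk hb, symmetric])
  also have "\<dots> = slice_cell (slice_tgt \<tau>) \<star> ?\<theta>"
    using T(6) vcomp_id_right'[OF S(5)] by simp
  also have "\<dots> = (slice_cell (slice_tgt \<tau>) \<cdot> Id2 C ?b) \<star> (Id2 C ?h' \<cdot> ?\<theta>)"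
    using vcomp_id_right'[OF slice_One_D(6)[OF T(2)]] vcomp_id_left'[OF S(5)] T(3) by simp
  also have "\<dots> = (slice_cell (slice_tgt \<tau>) \<star> Id2 C ?h') \<cdot> (Id2 C ?b \<star> ?\<theta>)"
    by (rule interchange'[OF S(5) id2_closed[OF ph(2)] id2_closed[OF B(1)] _ hb,
          of _ "slice_cod (slice_tgt \<tau>) \<odot> ?k'"])
       (use slice_One_D(6)[OF T(2)] T(3) in simp)
  also have "\<dots> \<cdot> ?\<phi> = (slice_cell (slice_tgt \<tau>) \<star> Id2 C ?h') \<cdot> ((Id2 C ?b \<star> ?\<theta>) \<cdot> ?\<phi>)"
    by (rule vcomp_assoc'[OF ft postwhisker_closed[OF S(5) B(1) hb]
          prewhisker_closed[OF _ ph(2)], of _ "slice_cod (slice_tgt \<tau>) \<odot> ?k'"])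
       (use slice_One_D(6)[OF T(2)] T(3) ph hb in simp_all)
  also have "(Id2 C ?b \<star> ?\<theta>) \<cdot> ?\<phi> = slice_cell (slice_tgt \<sigma>)"
    using S(6) st by simp
  finally show ?thesis
    using S T st kt slice_comp_closed[OF S(1) T(1)] slice_comp_closed[OF S(2) T(2)]
    by (intro slice_Two_I) simp_all
qed

lemma lax_slice_two_category: "enhanced_two_category (lax_slice C X)"
proof (unfold_locales, goal_cases)
  case (3 A) then show ?case using slice_id_closed by (simp add: hom1_def)
next
  case (4 f A B g D) then show ?case using slice_comp_closed by (simp add: hom1_def)
next
  case (5 f) then show ?case using slice_comp_id_left by simp
next
  case (6 f) then show ?case using slice_comp_id_right by simp
next
  case (7 f g h) then show ?case using slice_comp_assoc by simp
next
  case (10 f)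
  then show ?case
    using slice_One_D(3)[of f C X] hom1_D[OF slice_One_D(5)[of f C X]]
      vcomp_id_left'[OF slice_One_D(6)[of f C X]] id2_closed[of "slice_arr f"]
      hcomp_id2[of "slice_arr f" "slice_cod f"]
    by (simp add: hom2_def slice_Two_iff)
next
  case (11 \<alpha> f g \<beta> h) then show ?case using slice_vcomp_closed[of \<alpha> X \<beta>] by (simp add: hom2_def)
next
  case (12 \<alpha>)
  then show ?case using vcomp_id_left'[OF slice_Two_D(5)] by (auto intro!: slice2_eqI)
next
  case (13 \<alpha>)
  then show ?case using vcomp_id_right'[OF slice_Two_D(5)] by (auto intro!: slice2_eqI)
next
  case (14 \<alpha> \<beta> \<gamma>)
  then have "slice_map \<alpha> \<in> hom2 C (slice_arr (slice_src \<alpha>)) (slice_arr (slice_src \<beta>))"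
    "slice_map \<beta> \<in> hom2 C (slice_arr (slice_src \<beta>)) (slice_arr (slice_src \<gamma>))"
    "slice_map \<gamma> \<in> hom2 C (slice_arr (slice_src \<gamma>)) (slice_arr (slice_tgt \<gamma>))"
    using slice_Two_D(5)[of \<alpha> C X] slice_Two_D(5)[of \<beta> C X] slice_Two_D(5)[of \<gamma> C X] by simp_all
  from vcomp_assoc'[OF this] show ?case by simp
next
  case (15 \<alpha> f f' \<beta> g g')
  then show ?case using slice_hcomp_closed by (auto simp: hom2_def)
next
  case (16 \<alpha>)
  then have a: "\<alpha> \<in> slice_Two C X" by simp
  note D = slice_Two_D[OF a]
  show ?case
    using slice_comp_id_left[OF D(1)] slice_comp_id_left[OF D(2)] D
      postwhisker_id1[OF D(5)] hom1_D[OF slice_One_D(5)[OF D(1)]]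
    by (intro slice2_eqI) simp_all
next
  case (17 \<alpha>)
  then have a: "\<alpha> \<in> slice_Two C X" by simp
  note D = slice_Two_D[OF a]
  show ?case
    using slice_comp_id_right[OF D(1)] slice_comp_id_right[OF D(2)] D
      prewhisker_id1[OF D(5)] hom1_D[OF slice_One_D(5)[OF D(1)]]
    by (intro slice2_eqI) simp_all
next
  case (18 \<alpha> \<beta> \<gamma>)
  then have a: "\<alpha> \<in> slice_Two C X" "\<beta> \<in> slice_Two C X" "\<gamma> \<in> slice_Two C X"
    "slice_cod (slice_src \<alpha>) = slice_dom (slice_src \<beta>)"
    "slice_cod (slice_src \<beta>) = slice_dom (slice_src \<gamma>)" by simp_all
  note A = slice_Two_D[OF a(1)] and B = slice_Two_D[OF a(2)] and G = slice_Two_D[OF a(3)]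
  have "(slice_map \<gamma> \<star> slice_map \<beta>) \<star> slice_map \<alpha> = slice_map \<gamma> \<star> (slice_map \<beta> \<star> slice_map \<alpha>)"
    by (rule hcomp_assoc'[OF A(5) B(5) G(5)])
      (use a hom1_D[OF slice_One_D(5)[OF A(1)]] hom1_D[OF slice_One_D(5)[OF B(1)]]
        hom1_D[OF slice_One_D(5)[OF G(1)]] in simp_all)
  then show ?case
    using slice_comp_assoc[OF A(1) B(1) G(1)] slice_comp_assoc[OF A(2) B(2) G(2)] a A B G
    by simp
next
  case (19 f g)
  then show ?case
    using hcomp_id2[of "slice_arr f" "slice_arr g"] hom1_D[OF slice_One_D(5)[of f C X]]
      hom1_D[OF slice_One_D(5)[of g C X]]
    by simp
next
  case (20 \<alpha> \<alpha>' \<beta> \<beta>')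
  then have a: "\<alpha> \<in> slice_Two C X" "\<alpha>' \<in> slice_Two C X" "\<beta> \<in> slice_Two C X" "\<beta>' \<in> slice_Two C X"
    "slice_tgt \<alpha> = slice_src \<alpha>'" "slice_tgt \<beta> = slice_src \<beta>'"
    "slice_cod (slice_src \<alpha>) = slice_dom (slice_src \<beta>)" by simp_all
  have "(slice_map \<beta>' \<cdot> slice_map \<beta>) \<star> (slice_map \<alpha>' \<cdot> slice_map \<alpha>) =
      (slice_map \<beta>' \<star> slice_map \<alpha>') \<cdot> (slice_map \<beta> \<star> slice_map \<alpha>)"
    by (rule interchange'[OF slice_Two_D(5)[OF a(1)] _ slice_Two_D(5)[OF a(3)]])
      (use a slice_Two_D(5)[OF a(2)] slice_Two_D(5)[OF a(4)]
        hom1_D[OF slice_One_D(5)[OF slice_Two_D(1)[OF a(1)]]]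
        hom1_D[OF slice_One_D(5)[OF slice_Two_D(1)[OF a(3)]]] in simp_all)
  then show ?case by simp
next
  case (22 A)
  then show ?case using slice_id_closed tight_id dom_closed by simp
next
  case (23 f g)
  then show ?case
    using slice_comp_closed[of f X g] tight_comp[of "slice_arr f" "slice_arr g"]
      hom1_D[OF slice_One_D(5)[of f C X]] hom1_D[OF slice_One_D(5)[of g C X]]
    by simp
qed (auto simp: hom1_def dest: slice_One_D slice_Two_D)

lemma slice_vertical_comp:
  assumes "\<phi> \<in> hom2 C a b" "\<psi> \<in> hom2 C b c"
  shows "slice_comp C (Slice1 b (Id1 C (Dom C a)) \<psi> c) (Slice1 a (Id1 C (Dom C a)) \<phi> b) =
    Slice1 a (Id1 C (Dom C a)) (\<psi> \<cdot> \<phi>) c"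
proof -
  note p = hom2_parallel[OF assms(1)]
  show ?thesis
    using prewhisker_id1[OF assms(2) p(3)] comp1_id_left'[OF id1_closed[OF dom_closed[OF p(1)]]]
    by (simp add: slice_comp_def)
qed

lemma slice_vertical_One:
  assumes "Dom C b = Dom C a" "Cod C a = X" "Cod C b = X" "a \<in> One C" "b \<in> One C"
  shows "Slice1 a (Id1 C (Dom C a)) \<phi> b \<in> slice_One C X \<longleftrightarrow> \<phi> \<in> hom2 C a b"
  using assms id1_closed[OF dom_closed[OF assms(4)]] comp1_id_right[OF assms(5)]
  by (simp add: slice_One_iff)

text \<open>
  An inverse in the slice of a 1-cell with underlying identity again has underlying identity.
\<close>

lemma slice_vertical_invertible:
  assumes f: "\<phi> \<in> hom2 C a b" and X: "Cod C a = X"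
  shows "invertible1 (lax_slice C X) (Slice1 a (Id1 C (Dom C a)) \<phi> b) \<longleftrightarrow> invertible2 C \<phi>"
    (is "invertible1 ?S ?s \<longleftrightarrow> _")
proof
  interpret S: enhanced_two_category ?S by (rule lax_slice_two_category)
  note p = hom2_parallel[OF f] and id = id1_closed[OF dom_closed[OF hom2_parallel(1)[OF f]]]
  have b: "Cod C b = X" using p X by simp
  have s: "?s \<in> hom1 ?S a b"
    using slice_vertical_One[OF p(3) X b p(1,2)] f by (simp add: hom1_def)
  {
    assume "invertible1 ?S ?s"
    then obtain t where t: "t \<in> hom1 ?S b a" "slice_comp C t ?s = Id1 ?S a" "slice_comp C ?s t = Id1 ?S b"
      using S.invertible1E[OF _ s] by (metis lax_slice_simps(10))
    obtain h \<psi> where t': "t = Slice1 b h \<psi> a" and "h \<in> hom1 C (Dom C b) (Dom C a)"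
        "\<psi> \<in> hom2 C b (a \<odot> h)"
      using t(1) by (auto simp: hom1_def elim!: slice_One_E)
    then have h: "h \<in> hom1 C (Dom C a) (Dom C a)" and y: "\<psi> \<in> hom2 C b (a \<odot> h)"
      using p by simp_all
    have h1: "h = Id1 C (Dom C a)"
      using t(2) comp1_id_right'[OF h] by (simp add: t' slice_comp_def)
    have y': "\<psi> \<in> hom2 C b a" using y h1 comp1_id_right[OF p(1)] by simp
    show "invertible2 C \<phi>"
      using t(2,3) slice_vertical_comp[OF f y'] slice_vertical_comp[OF y' f]
      by (intro invertible2I[OF f y']) (simp_all add: t' h1 p)
  }
  {
    assume "invertible2 C \<phi>"
    then obtain \<psi> where y: "\<psi> \<in> hom2 C b a" "\<psi> \<cdot> \<phi> = Id2 C a" "\<phi> \<cdot> \<psi> = Id2 C b"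
      using invertible2E[OF _ f] by metis
    have "Slice1 b (Id1 C (Dom C a)) \<psi> a \<in> hom1 ?S b a"
      using slice_vertical_One[of a b X \<psi>] y(1) p X b by (simp add: hom1_def)
    then show "invertible1 ?S ?s"
      using slice_vertical_comp[OF f y(1)] slice_vertical_comp[OF y(1) f] y p
      by (intro S.invertible1I[OF s]) simp_all
  }
qed

lemma full_sub_two_category: "enhanced_two_category (full_sub C S)"
proof -
  have [simp]: "Obj (full_sub C S) = Obj C \<inter> S"
    "One (full_sub C S) = {f \<in> One C. Dom C f \<in> S \<and> Cod C f \<in> S}"
    "Two (full_sub C S) = {\<alpha> \<in> Two C. Dom C (Src C \<alpha>) \<in> S \<and> Cod C (Src C \<alpha>) \<in> S}"
    "Tight (full_sub C S) = {f \<in> Tight C. Dom C f \<in> S \<and> Cod C f \<in> S}"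
    "Dom (full_sub C S) = Dom C" "Cod (full_sub C S) = Cod C"
    "Src (full_sub C S) = Src C" "Tgt (full_sub C S) = Tgt C"
    "Id1 (full_sub C S) = Id1 C" "Id2 (full_sub C S) = Id2 C"
    "Comp1 (full_sub C S) = Comp1 C" "VComp (full_sub C S) = VComp C" "HComp (full_sub C S) = HComp C"
    by (simp_all add: full_sub_def)
  have h1: "hom1 (full_sub C S) A B = {f \<in> hom1 C A B. A \<in> S \<and> B \<in> S}" for A B
    by (auto simp: hom1_def)
  have h2: "hom2 (full_sub C S) f g = {\<alpha> \<in> hom2 C f g. Dom C f \<in> S \<and> Cod C f \<in> S}" for f g
    by (auto simp: hom2_def)
  show ?thesis
  proof (unfold_locales, goal_cases)
    case (15 \<alpha> f f' \<beta> g g')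
    then have "\<alpha> \<in> hom2 C f f'" "\<beta> \<in> hom2 C g g'" "Cod C f = Dom C g" "Dom C f \<in> S" "Cod C g \<in> S"
      by (auto simp: h2)
    then show ?case
      using hcomp_closed comp1_One[of f g] hom2_parallel(1) by (auto simp: h2)
  next
    case (23 f g)
    then have "f \<in> One C" "g \<in> One C" using tight_subset by auto
    with 23 show ?case using tight_comp comp1_One[of f g] by auto
  next
    case (11 \<alpha> f g \<beta> h) then show ?case using vcomp_closed by (auto simp: h2)
  next
    case (4 f A B g D) then show ?case using comp1_closed by (auto simp: h1)
  next
    case (20 \<alpha> \<alpha>' \<beta> \<beta>') then show ?case using interchange by auto
  next
    case (9 \<alpha>) then show ?case using tgt_closed by (auto simp: h1)
  next
    case (22 A) then show ?case using tight_id id1_One by auto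
  qed (auto simp: h1 h2 dom_closed cod_closed id1_closed comp1_id_left comp1_id_right comp1_assoc
      src_closed id2_closed vcomp_id_left vcomp_id_right vcomp_assoc
      hcomp_id_left hcomp_id_right hcomp_assoc hcomp_id2
      dest: tight_subset[THEN subsetD])
qed

end

section \<open>Marked-lax terminal objects as marked lax cocones\<close>

text \<open>
  A strict section of the domain projection sends a 1-cell \<open>x\<close> to \<open>(x, \<delta>\<^sub>x)\<close> and a 2-cell \<open>\<alpha>\<close> to \<open>\<alpha>\<close>,
  so that it carries no data on 2-cells and the slice condition on its value there is naturality of
  \<open>\<delta>\<close>.  Thus it is a lax cocone from the identity of \<open>E\<close> to the constant 2-functor at \<open>U\<close>.  As
  \<open>!\<^sub>U : k\<^sub>U \<cong> 1\<^sub>U\<close> lies over an identity, all that is left of it is an invertible 2-cell \<open>\<sigma>\<close>.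
\<close>

locale marked_lax_cocone = enhanced_two_category E
  for E :: "('p, 'n, 'd) two_cat" (structure) +
  fixes M :: "'n set" and U :: 'p and k :: "'p \<Rightarrow> 'n" and \<delta> :: "'n \<Rightarrow> 'd" and \<sigma> :: 'd
  assumes apex: "U \<in> Obj E"
    and k_closed: "X \<in> Obj E \<Longrightarrow> k X \<in> hom1 E X U"
    and k_marked: "X \<in> Obj E \<Longrightarrow> k X \<in> M"
    and \<delta>_closed: "x \<in> hom1 E X Y \<Longrightarrow> \<delta> x \<in> hom2 E (k X) (k Y \<odot> x)"
    and \<delta>_id: "X \<in> Obj E \<Longrightarrow> \<delta> (Id1 E X) = Id2 E (k X)"
    and \<delta>_comp: "x \<in> hom1 E X Y \<Longrightarrow> y \<in> hom1 E Y Z \<Longrightarrow> \<delta> (y \<odot> x) = (\<delta> y \<star> Id2 E x) \<cdot> \<delta> x"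
    and \<delta>_natural: "\<alpha> \<in> hom2 E x x' \<Longrightarrow> x \<in> hom1 E X Y \<Longrightarrow> (Id2 E (k Y) \<star> \<alpha>) \<cdot> \<delta> x = \<delta> x'"
    and \<delta>_marked: "x \<in> M \<Longrightarrow> x \<in> One E \<Longrightarrow> invertible2 E (\<delta> x)"
    and \<sigma>_closed: "\<sigma> \<in> hom2 E (k U) (Id1 E U)"
    and \<sigma>_invertible: "invertible2 E \<sigma>"

lemma marked_lax_slice_simps:
  "Obj (marked_lax_slice E M X) = {a \<in> One E. Cod E a = X} \<inter> M"
  "One (marked_lax_slice E M X) = {s \<in> slice_One E X. slice_dom s \<in> M \<and> slice_cod s \<in> M}"
  "Two (marked_lax_slice E M X) =
    {\<sigma> \<in> slice_Two E X. slice_dom (slice_src \<sigma>) \<in> M \<and> slice_cod (slice_src \<sigma>) \<in> M}"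
  "Dom (marked_lax_slice E M X) = slice_dom"
  "Cod (marked_lax_slice E M X) = slice_cod"
  "Src (marked_lax_slice E M X) = slice_src"
  "Tgt (marked_lax_slice E M X) = slice_tgt"
  "Id1 (marked_lax_slice E M X) = Id1 (lax_slice E X)"
  "Id2 (marked_lax_slice E M X) = Id2 (lax_slice E X)"
  "Comp1 (marked_lax_slice E M X) = slice_comp E"
  "VComp (marked_lax_slice E M X) = VComp (lax_slice E X)"
  "HComp (marked_lax_slice E M X) = HComp (lax_slice E X)"
  "Tight (marked_lax_slice E M X) =
    {s \<in> Tight (lax_slice E X). slice_dom s \<in> M \<and> slice_cod s \<in> M}"
  by (simp_all add: marked_lax_slice_def full_sub_def)

lemma marked_lax_slice_hom1:
  "hom1 (marked_lax_slice E M X) a b = {s \<in> hom1 (lax_slice E X) a b. a \<in> M \<and> b \<in> M}"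
  by (auto simp: hom1_def marked_lax_slice_simps)

lemma marked_lax_slice_invertible1:
  assumes "slice_dom s \<in> M" "slice_cod s \<in> M"
  shows "invertible1 (marked_lax_slice E M X) s \<longleftrightarrow> invertible1 (lax_slice E X) s"
  using assms by (simp add: invertible1_def marked_lax_slice_hom1 marked_lax_slice_simps)

context enhanced_two_category
begin

lemma marked_lax_terminal_imp_cocone:
  assumes U: "U \<in> Obj C" and t: "marked_lax_terminal C M U"
  shows "\<exists>k \<delta> \<sigma>. marked_lax_cocone C M U k \<delta> \<sigma>"
proof -
  obtain d s where d: "enhanced_two_functor C (marked_lax_slice C M U) d"
    and dm: "\<And>k. k \<in> M \<Longrightarrow> map1 d k \<in> marked_lax_slice_marking C M U"
    and sec: "map_eq_on C (comp_map (slice_proj C) d) id_map"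
    and s: "s \<in> hom1 (marked_lax_slice C M U) (map0 d U) (Id1 C U)"
      "invertible1 (marked_lax_slice C M U) s" "slice_arr s = Id1 C U"
    using t by (auto simp: marked_lax_terminal_def)
  interpret d: enhanced_two_functor C "marked_lax_slice C M U" d by (rule d)
  have sec0: "X \<in> Obj C \<Longrightarrow> Dom C (map0 d X) = X" and sec1: "x \<in> One C \<Longrightarrow> slice_arr (map1 d x) = x"
    and sec2: "\<alpha> \<in> Two C \<Longrightarrow> slice_map (map2 d \<alpha>) = \<alpha>" for X x \<alpha>
    using sec by (auto simp: map_eq_on_def comp_map_def id_map_def)
  have k: "map0 d X \<in> hom1 C X U" "map0 d X \<in> M" if "X \<in> Obj C" for X
    using d.map0_closed[OF that] sec0[OF that] by (auto simp: marked_lax_slice_simps hom1_def)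
  have d1: "map1 d x \<in> slice_One C U" "slice_dom (map1 d x) = map0 d X"
      "slice_cod (map1 d x) = map0 d Y" "slice_arr (map1 d x) = x"
    if "x \<in> hom1 C X Y" for x X Y
    using d.map1_closed[OF that] sec1 that by (auto simp: marked_lax_slice_simps hom1_def)
  define \<sigma> where "\<sigma> = slice_cell s"
  have s': "s = Slice1 (map0 d U) (Id1 C U) \<sigma> (Id1 C U)" and sO: "s \<in> slice_One C U"
    and sM: "slice_dom s \<in> M" "slice_cod s \<in> M"
    using s by (cases s, auto simp: \<sigma>_def hom1_def marked_lax_slice_simps)+
  have \<sigma>: "\<sigma> \<in> hom2 C (map0 d U) (Id1 C U)"
    using slice_One_D(6)[OF sO] comp1_id_left[OF id1_One(1)[OF U]] id1_One[OF U] by (simp add: s')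
  have "invertible1 (lax_slice C U) (Slice1 (map0 d U) (Id1 C (Dom C (map0 d U))) \<sigma> (Id1 C U))"
    using s(2) marked_lax_slice_invertible1[OF sM, of C U] sec0[OF U] by (simp add: s')
  then have \<sigma>i: "invertible2 C \<sigma>"
    using slice_vertical_invertible[OF \<sigma>] hom1_D[OF k(1)[OF U]] by simp
  have "marked_lax_cocone C M U (map0 d) (\<lambda>x. slice_cell (map1 d x)) \<sigma>"
  proof (unfold_locales, goal_cases)
    case 1 show ?case by (rule U)
  next
    case (2 X) then show ?case by (rule k)
  next
    case (3 X) then show ?case by (rule k)
  next
    case (4 x X Y) then show ?case using slice_One_D(6)[OF d1(1)[OF 4]] d1[OF 4] by simp
  next
    case (5 X) then show ?case using d.map1_id by (simp add: marked_lax_slice_simps)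
  next
    case (6 x X Y y Z)
    then show ?case
      using d.map1_comp[of x y] d1[OF 6(1)] hom1_D[OF 6(1)] hom1_D[OF 6(2)]
      by (simp add: marked_lax_slice_simps)
  next
    case (7 \<alpha> x x' X Y)
    have "map2 d \<alpha> \<in> slice_Two C U" "slice_src (map2 d \<alpha>) = map1 d x" "slice_tgt (map2 d \<alpha>) = map1 d x'"
      using d.map2_closed[OF 7(1)] by (auto simp: hom2_def marked_lax_slice_simps)
    then show ?case
      using slice_Two_D(6) d1[OF 7(2)] sec2[of \<alpha>] hom2_D(1)[OF 7(1)] by metis
  next
    case (8 x) then show ?case using dm[of x] by (simp add: marked_lax_slice_marking_def)
  next
    case 9 show ?case by (rule \<sigma>)
  next
    case 10 show ?case by (rule \<sigma>i)
  qed
  then show ?thesis by blast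
qed

end

context marked_lax_cocone
begin

definition section_map :: "('p, 'n, 'd, 'n, ('n, 'd) slice1, ('n, 'd) slice2) two_map" where
  "section_map = (let d1 = (\<lambda>x. Slice1 (k (Dom E x)) x (\<delta> x) (k (Cod E x))) in
    \<lparr>map0 = k, map1 = d1, map2 = (\<lambda>\<alpha>. Slice2 (d1 (Src E \<alpha>)) \<alpha> (d1 (Tgt E \<alpha>)))\<rparr>)"

lemma section_map_simps [simp]:
  "map0 section_map = k"
  "map1 section_map x = Slice1 (k (Dom E x)) x (\<delta> x) (k (Cod E x))"
  "map2 section_map \<alpha> = Slice2 (map1 section_map (Src E \<alpha>)) \<alpha> (map1 section_map (Tgt E \<alpha>))"
  by (simp_all add: section_map_def)

lemma section_map_One:
  assumes "x \<in> One E"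
  shows "Slice1 (k (Dom E x)) x (\<delta> x) (k (Cod E x)) \<in> slice_One E U"
  using hom1_D[OF k_closed[OF dom_closed[OF assms]]] hom1_D[OF k_closed[OF cod_closed[OF assms]]]
    \<delta>_closed[OF hom1_I[OF assms refl refl]] assms
  by (simp add: slice_One_iff hom1_def)

lemma section_map_Two:
  assumes "\<alpha> \<in> Two E"
  shows "map2 section_map \<alpha> \<in> slice_Two E U"
proof -
  have a: "\<alpha> \<in> hom2 E (Src E \<alpha>) (Tgt E \<alpha>)" using assms by (simp add: hom2_def)
  note p = hom2_parallel[OF a]
  show ?thesis
    using section_map_One[OF p(1)] section_map_One[OF p(2)] p a
      \<delta>_natural[OF a hom1_I[OF p(1) refl refl]]
    by (simp add: slice_Two_iff)
qed

lemma section_map_functor: "enhanced_two_functor E (marked_lax_slice E M U) section_map"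
proof -
  interpret S: enhanced_two_category "lax_slice E U" by (rule lax_slice_two_category)
  interpret M: enhanced_two_category "marked_lax_slice E M U"
    unfolding marked_lax_slice_def by (rule S.full_sub_two_category)
  have kD: "X \<in> Obj E \<Longrightarrow> k X \<in> One E" "X \<in> Obj E \<Longrightarrow> Dom E (k X) = X" "X \<in> Obj E \<Longrightarrow> Cod E (k X) = U" for X
    using hom1_D[OF k_closed] by auto
  show ?thesis
  proof (unfold_locales, goal_cases)
    case (1 A) then show ?case using kD k_marked by (simp add: marked_lax_slice_simps)
  next
    case (2 f A B)
    then show ?case
      using section_map_One[of f] hom1_D[OF 2] k_marked dom_closed[of f] cod_closed[of f]
      by (auto simp: hom1_def marked_lax_slice_simps)
  next
    case (3 \<alpha> f g)
    then show ?case
      using section_map_Two[of \<alpha>] hom2_D[OF 3] hom2_parallel[OF 3] k_marked dom_closed cod_closed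
      by (auto simp: hom2_def marked_lax_slice_simps)
  next
    case (4 A) then show ?case using id1_One[of A] kD \<delta>_id by (simp add: marked_lax_slice_simps)
  next
    case (5 f g)
    then show ?case
      using comp1_One[of f g] \<delta>_comp[OF hom1_I[OF 5(1) refl refl] hom1_I[OF 5(2) 5(3)[symmetric] refl]]
      by (simp add: marked_lax_slice_simps slice_comp_def)
  next
    case (6 f)
    then show ?case using hom2_D[OF id2_closed[of f]] by (simp add: marked_lax_slice_simps)
  next
    case (7 \<alpha> \<beta>)
    then show ?case
      using hom2_D[OF vcomp_closed[OF hom2_I[OF 7(1) refl refl] hom2_I[OF 7(2) 7(3)[symmetric] refl]]]
      by (simp add: marked_lax_slice_simps)
  next
    case (8 \<alpha> \<beta>)
    then have a: "\<alpha> \<in> hom2 E (Src E \<alpha>) (Tgt E \<alpha>)" "\<beta> \<in> hom2 E (Src E \<beta>) (Tgt E \<beta>)"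
      by (simp_all add: hom2_def)
    note pa = hom2_parallel[OF a(1)] and pb = hom2_parallel[OF a(2)]
    have e: "slice_comp E (Slice1 (k (Dom E y)) y (\<delta> y) (k (Cod E y)))
        (Slice1 (k (Dom E x)) x (\<delta> x) (k (Cod E x))) =
        Slice1 (k (Dom E x)) (y \<odot> x) (\<delta> (y \<odot> x)) (k (Cod E y))"
      if "x \<in> One E" "y \<in> One E" "Cod E x = Dom E y" for x y
      using \<delta>_comp[OF hom1_I[OF that(1) refl refl] hom1_I[OF that(2) that(3)[symmetric] refl]]
      by (simp add: slice_comp_def)
    show ?case
      using 8 hom2_D[OF hcomp_closed[OF a 8(3)]] pa pb
        e[of "Src E \<alpha>" "Src E \<beta>"] e[of "Tgt E \<alpha>" "Tgt E \<beta>"]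
        comp1_One[of "Src E \<alpha>" "Src E \<beta>"] comp1_One[of "Tgt E \<alpha>" "Tgt E \<beta>"]
      by (simp add: marked_lax_slice_simps)
  next
    case (9 f)
    then have f: "f \<in> One E" using tight_subset by auto
    show ?case
      using section_map_One[OF f] 9 k_marked[OF dom_closed[OF f]] k_marked[OF cod_closed[OF f]]
      by (simp add: marked_lax_slice_simps)
  qed
qed

lemma marked_lax_terminal:
  assumes M: "M \<subseteq> One E" and U: "Id1 E U \<in> M"
  shows "marked_lax_terminal E M U"
  unfolding marked_lax_terminal_def
proof (intro exI[of _ section_map] conjI)
  show "\<forall>x\<in>M. map1 section_map x \<in> marked_lax_slice_marking E M U"
  proof
    fix x assume x: "x \<in> M"
    then have x1: "x \<in> One E" using M by auto
    show "map1 section_map x \<in> marked_lax_slice_marking E M U"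
      using section_map_One[OF x1] k_marked[OF dom_closed[OF x1]] k_marked[OF cod_closed[OF x1]] x
        \<delta>_marked[OF x x1]
      by (simp add: marked_lax_slice_marking_def marked_lax_slice_simps)
  qed
  show "map_eq_on E (comp_map (slice_proj E) section_map) id_map"
    using hom1_D[OF k_closed] by (auto simp: map_eq_on_def comp_map_def id_map_def)
  let ?s = "Slice1 (k U) (Id1 E U) \<sigma> (Id1 E U)"
  have kU: "k U \<in> One E" "Dom E (k U) = U" "Cod E (k U) = U" "k U \<in> M"
    using hom1_D[OF k_closed[OF apex]] k_marked[OF apex] by auto
  have "?s \<in> slice_One E U"
    using slice_vertical_One[of "Id1 E U" "k U" U \<sigma>] kU id1_One[OF apex] \<sigma>_closed by simp
  then have "?s \<in> hom1 (marked_lax_slice E M U) (map0 section_map U) (Id1 E U)"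
    using kU U by (simp add: marked_lax_slice_hom1) (simp add: hom1_def)
  moreover have "invertible1 (marked_lax_slice E M U) ?s"
    using slice_vertical_invertible[OF \<sigma>_closed kU(3)] \<sigma>_invertible kU U
    by (simp add: marked_lax_slice_invertible1)
  ultimately show "\<exists>s\<in>hom1 (marked_lax_slice E M U) (map0 section_map U) (Id1 E U).
      invertible1 (marked_lax_slice E M U) s \<and> slice_arr s = Id1 E U"
    by (intro bexI[of _ ?s]) simp_all
qed (rule section_map_functor)

end

section \<open>Lifting along a split enhanced discrete 2-fibration\<close>

context enhanced_two_functor
begin

lemma map_invertible2:
  assumes a: "\<alpha> \<in> hom2 C f g" "invertible2 C \<alpha>"
  shows "invertible2 D (map2 F \<alpha>)"
proof -
  obtain \<beta> where b: "\<beta> \<in> hom2 C g f" "\<beta> \<cdot>\<^bsub>C\<^esub> \<alpha> = Id2 C f" "\<alpha> \<cdot>\<^bsub>C\<^esub> \<beta> = Id2 C g"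
    using dom.invertible2E[OF a(2,1)] .
  show ?thesis
    using b map2_vcomp[of \<alpha> \<beta>] map2_vcomp[of \<beta> \<alpha>] map2_id dom.hom2_parallel[OF a(1)]
      hom2_D[OF a(1)] hom2_D[OF b(1)]
    by (intro cod.invertible2I[OF map2_closed[OF a(1)] map2_closed[OF b(1)]]) simp_all
qed

lemma map1_One:
  assumes "f \<in> One C"
  shows "map1 F f \<in> One D" "Dom D (map1 F f) = map0 F (Dom C f)" "Cod D (map1 F f) = map0 F (Cod C f)"
  using hom1_D[OF map1_closed[OF hom1_I[OF assms refl refl]]] by auto

lemma map1_comp': "f \<in> hom1 C A B \<Longrightarrow> g \<in> hom1 C B X \<Longrightarrow>
    map1 F (g \<odot>\<^bsub>C\<^esub> f) = map1 F g \<odot>\<^bsub>D\<^esub> map1 F f"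
  using map1_comp by (auto simp: hom1_def)

lemma map2_vcomp': "\<alpha> \<in> hom2 C f g \<Longrightarrow> \<beta> \<in> hom2 C g h \<Longrightarrow>
    map2 F (\<beta> \<cdot>\<^bsub>C\<^esub> \<alpha>) = map2 F \<beta> \<cdot>\<^bsub>D\<^esub> map2 F \<alpha>"
  using map2_vcomp by (auto simp: hom2_def)

lemma map2_prewhisker:
  assumes "\<beta> \<in> hom2 C g g'" "f \<in> One C" "Cod C f = Dom C g"
  shows "map2 F (\<beta> \<star>\<^bsub>C\<^esub> Id2 C f) = map2 F \<beta> \<star>\<^bsub>D\<^esub> Id2 D (map1 F f)"
  using map2_hcomp[of "Id2 C f" \<beta>] map2_id[OF assms(2)] hom2_D[OF dom.id2_closed[OF assms(2)]]
    hom2_D[OF assms(1)] assms(3) by simp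

lemma map2_postwhisker:
  assumes "\<alpha> \<in> hom2 C f f'" "g \<in> One C" "Cod C f = Dom C g"
  shows "map2 F (Id2 C g \<star>\<^bsub>C\<^esub> \<alpha>) = Id2 D (map1 F g) \<star>\<^bsub>D\<^esub> map2 F \<alpha>"
  using map2_hcomp[of \<alpha> "Id2 C g"] map2_id[OF assms(2)] hom2_D[OF dom.id2_closed[OF assms(2)]]
    hom2_D[OF assms(1)] assms(3) by simp

end

context enhanced_discrete_two_fibration
begin

lemma two_cell_unique:
  assumes "\<alpha> \<in> hom2 E x y" "\<beta> \<in> hom2 E x z" "map2 P \<alpha> = map2 P \<beta>"
  shows "\<alpha> = \<beta>"
  using discrete_opfibration[of x "map2 P \<alpha>"] dom.hom2_parallel[OF assms(1)]
    hom2_D[OF map2_closed[OF assms(1)]] hom2_D[OF assms(1)] hom2_D[OF assms(2)] assms(3)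
  by metis

lemma two_cell_target_unique:
  assumes "\<alpha> \<in> hom2 E x y" "\<beta> \<in> hom2 E x z" "map2 P \<alpha> = map2 P \<beta>"
  shows "y = z"
  using two_cell_unique[OF assms] hom2_D[OF assms(1)] hom2_D[OF assms(2)] by simp

lemma cell_lift:
  assumes x: "x \<in> One E" and f: "\<phi> \<in> hom2 K (map1 P x) g"
  shows "cell_lift E P x \<phi> \<in> hom2 E x (Tgt E (cell_lift E P x \<phi>))" "map2 P (cell_lift E P x \<phi>) = \<phi>"
proof -
  have "\<exists>!\<alpha>. \<alpha> \<in> Two E \<and> Src E \<alpha> = x \<and> map2 P \<alpha> = \<phi>"
    using discrete_opfibration[OF x] hom2_D[OF f] by simp
  from theI'[OF this]
  show "cell_lift E P x \<phi> \<in> hom2 E x (Tgt E (cell_lift E P x \<phi>))" "map2 P (cell_lift E P x \<phi>) = \<phi>"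
    by (simp_all add: cell_lift_def hom2_def)
qed

lemma cell_lift_target:
  assumes x: "x \<in> hom1 E X Y" and f: "\<phi> \<in> hom2 K (map1 P x) g"
  shows "Tgt E (cell_lift E P x \<phi>) \<in> hom1 E X Y" "map1 P (Tgt E (cell_lift E P x \<phi>)) = g"
proof -
  note c = cell_lift[OF hom1_D(1)[OF x] f]
  show "Tgt E (cell_lift E P x \<phi>) \<in> hom1 E X Y"
    using dom.hom2_hom1[OF c(1) x] .
  show "map1 P (Tgt E (cell_lift E P x \<phi>)) = g"
    using hom2_D(3)[OF map2_closed[OF c(1)]] c(2) hom2_D(3)[OF f] by simp
qed

text \<open>
  A discrete opfibration reflects isomorphisms: the inverse lifts along the target, and both
  composites are lifts of identities.
\<close>

lemma invertible2_lift:
  assumes a: "\<alpha> \<in> hom2 E x y" and inv: "invertible2 K (map2 P \<alpha>)"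
  shows "invertible2 E \<alpha>"
proof -
  note p = dom.hom2_parallel[OF a]
  obtain \<psi> where s: "\<psi> \<in> hom2 K (map1 P y) (map1 P x)"
      "\<psi> \<cdot>\<^bsub>K\<^esub> map2 P \<alpha> = Id2 K (map1 P x)" "map2 P \<alpha> \<cdot>\<^bsub>K\<^esub> \<psi> = Id2 K (map1 P y)"
    using cod.invertible2E[OF inv map2_closed[OF a]] .
  note b = cell_lift[OF p(2) s(1)]
  let ?b = "cell_lift E P y \<psi>"
  note ba = dom.vcomp_closed[OF a b(1)]
  have e: "map2 P (?b \<cdot>\<^bsub>E\<^esub> \<alpha>) = map2 P (Id2 E x)"
    using map2_vcomp'[OF a b(1)] b(2) s(2) map2_id[OF p(1)] by simp
  have z: "Tgt E ?b = x"
    using two_cell_target_unique[OF ba dom.id2_closed[OF p(1)] e] .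
  have b': "?b \<in> hom2 E y x" using b(1) z by simp
  have "?b \<cdot>\<^bsub>E\<^esub> \<alpha> = Id2 E x"
    using two_cell_unique[OF ba dom.id2_closed[OF p(1)] e] .
  moreover have "\<alpha> \<cdot>\<^bsub>E\<^esub> ?b = Id2 E y"
    by (rule two_cell_unique[OF dom.vcomp_closed[OF b' a] dom.id2_closed[OF p(2)]])
      (use map2_vcomp'[OF b' a] b(2) s(3) map2_id[OF p(2)] in simp)
  ultimately show ?thesis using dom.invertible2I[OF a b'] by blast
qed

lemma cartesian_One: "cartesian E K P k \<Longrightarrow> k \<in> One E"
  by (simp add: cartesian_def)

lemma cartesian_factor:
  assumes c: "cartesian E K P k" and k: "k \<in> hom1 E B A" and x: "x \<in> hom1 E X A"
    and y: "y \<in> hom1 K (map0 P X) (map0 P B)" and xy: "map1 P x = map1 P k \<odot>\<^bsub>K\<^esub> y"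
  shows "\<exists>!z. z \<in> hom1 E X B \<and> map1 P z = y \<and> k \<odot>\<^bsub>E\<^esub> z = x"
proof -
  note * = bspec[OF bspec[OF conjunct2[OF c[unfolded cartesian_def]] hom1_D(1)[OF x]], of y,
      unfolded hom1_D(2)[OF k] hom1_D(2)[OF x]]
  show ?thesis
    by (rule mp[OF *[OF y]]) (use hom1_D(3)[OF x] hom1_D(3)[OF k] xy in simp)
qed

lemma cartesian_cancel:
  assumes c: "cartesian E K P k" and k: "k \<in> hom1 E B A"
    and z: "z \<in> hom1 E X B" and z': "z' \<in> hom1 E X B"
    and P: "map1 P z = map1 P z'" and e: "k \<odot>\<^bsub>E\<^esub> z = k \<odot>\<^bsub>E\<^esub> z'"
  shows "z = z'"
proof -
  note * = the1_equality[OF cartesian_factor[OF c k dom.comp1_closed[OF z k] map1_closed[OF z]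
        map1_comp'[OF z k]]]
  show ?thesis
    using *[of z] *[of z'] z z' P e by simp
qed

lemma cartesian_invertible1:
  assumes f: "f \<in> hom1 E A B" "invertible1 E f"
  shows "cartesian E K P f"
proof -
  obtain g where g: "g \<in> hom1 E B A" "g \<odot>\<^bsub>E\<^esub> f = Id1 E A" "f \<odot>\<^bsub>E\<^esub> g = Id1 E B"
    using dom.invertible1E[OF f(2,1)] .
  note fD = hom1_D[OF f(1)]
  have A: "A \<in> Obj E" using fD dom.dom_closed by auto
  show ?thesis
    unfolding cartesian_def
  proof (intro conjI ballI impI)
    fix x y
    assume x: "x \<in> One E" and y: "y \<in> hom1 K (map0 P (Dom E x)) (map0 P (Dom E f))"
      and c: "Cod E x = Cod E f \<and> map1 P x = map1 P f \<odot>\<^bsub>K\<^esub> y"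
    have x': "x \<in> hom1 E (Dom E x) B" using x c fD by (simp add: hom1_def)
    have y': "y \<in> hom1 K (map0 P (Dom E x)) (map0 P A)" using y fD by simp
    have "map1 P (g \<odot>\<^bsub>E\<^esub> x) = map1 P g \<odot>\<^bsub>K\<^esub> (map1 P f \<odot>\<^bsub>K\<^esub> y)"
      using map1_comp'[OF x' g(1)] c by simp
    also have "\<dots> = map1 P (g \<odot>\<^bsub>E\<^esub> f) \<odot>\<^bsub>K\<^esub> y"
      using cod.comp1_assoc'[OF y' map1_closed[OF f(1)] map1_closed[OF g(1)]]
        map1_comp'[OF f(1) g(1)] by simp
    also have "\<dots> = y"
      unfolding g(2) map1_id[OF A] by (rule cod.comp1_id_left'[OF y'])
    finally have Py: "map1 P (g \<odot>\<^bsub>E\<^esub> x) = y" .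
    have fgx: "f \<odot>\<^bsub>E\<^esub> (g \<odot>\<^bsub>E\<^esub> x) = x"
      using dom.comp1_assoc'[OF x' g(1) f(1)] g(3) dom.comp1_id_left'[OF x'] by simp
    have uniq: "z = g \<odot>\<^bsub>E\<^esub> x" if z: "z \<in> hom1 E (Dom E x) (Dom E f)" "f \<odot>\<^bsub>E\<^esub> z = x" for z
    proof -
      have z': "z \<in> hom1 E (Dom E x) A" using z(1) fD(2) by simp
      have "g \<odot>\<^bsub>E\<^esub> (f \<odot>\<^bsub>E\<^esub> z) = z"
        unfolding dom.comp1_assoc'[OF z' f(1) g(1), symmetric] g(2) by (rule dom.comp1_id_left'[OF z'])
      then show ?thesis using z(2) by simp
    qed
    show "\<exists>!z. z \<in> hom1 E (Dom E x) (Dom E f) \<and> map1 P z = y \<and> f \<odot>\<^bsub>E\<^esub> z = x"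
    proof (rule ex1I[of _ "g \<odot>\<^bsub>E\<^esub> x"])
      show "g \<odot>\<^bsub>E\<^esub> x \<in> hom1 E (Dom E x) (Dom E f) \<and> map1 P (g \<odot>\<^bsub>E\<^esub> x) = y \<and> f \<odot>\<^bsub>E\<^esub> (g \<odot>\<^bsub>E\<^esub> x) = x"
        using Py dom.comp1_closed[OF x' g(1)] fD(2) fgx by simp
    qed (rule uniq, simp_all)
  qed (use fD in simp)
qed

lemma cartesian_comp:
  assumes k: "cartesian E K P k" "k \<in> hom1 E B A" and l: "cartesian E K P l" "l \<in> hom1 E D B"
  shows "cartesian E K P (k \<odot>\<^bsub>E\<^esub> l)"
proof -
  note kl = dom.comp1_closed[OF l(2) k(2)] and klD = hom1_D[OF dom.comp1_closed[OF l(2) k(2)]]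
  show ?thesis
    unfolding cartesian_def
  proof (intro conjI ballI impI)
    fix x y
    assume x: "x \<in> One E" and y: "y \<in> hom1 K (map0 P (Dom E x)) (map0 P (Dom E (k \<odot>\<^bsub>E\<^esub> l)))"
      and c: "Cod E x = Cod E (k \<odot>\<^bsub>E\<^esub> l) \<and> map1 P x = map1 P (k \<odot>\<^bsub>E\<^esub> l) \<odot>\<^bsub>K\<^esub> y"
    let ?X = "Dom E x"
    have x': "x \<in> hom1 E ?X A" using x c klD by (simp add: hom1_def)
    have y': "y \<in> hom1 K (map0 P ?X) (map0 P D)" using y klD by simp
    have ly: "map1 P l \<odot>\<^bsub>K\<^esub> y \<in> hom1 K (map0 P ?X) (map0 P B)"
      using cod.comp1_closed[OF y' map1_closed[OF l(2)]] .
    have "map1 P x = map1 P k \<odot>\<^bsub>K\<^esub> (map1 P l \<odot>\<^bsub>K\<^esub> y)"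
      using c map1_comp'[OF l(2) k(2)] cod.comp1_assoc'[OF y' map1_closed[OF l(2)] map1_closed[OF k(2)]]
      by simp
    then obtain w where w: "w \<in> hom1 E ?X B" "map1 P w = map1 P l \<odot>\<^bsub>K\<^esub> y" "k \<odot>\<^bsub>E\<^esub> w = x"
      using cartesian_factor[OF k x' ly] by blast
    obtain z where z: "z \<in> hom1 E ?X D" "map1 P z = y" "l \<odot>\<^bsub>E\<^esub> z = w"
      using cartesian_factor[OF l w(1) y' w(2)] by blast
    have klz: "(k \<odot>\<^bsub>E\<^esub> l) \<odot>\<^bsub>E\<^esub> z = x"
      using dom.comp1_assoc'[OF z(1) l(2) k(2)] z(3) w(3) by simp
    have uniq: "z' = z" if z': "z' \<in> hom1 E ?X D" "map1 P z' = y" "(k \<odot>\<^bsub>E\<^esub> l) \<odot>\<^bsub>E\<^esub> z' = x" for z'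
    proof (rule cartesian_cancel[OF l z'(1) z(1)])
      show "l \<odot>\<^bsub>E\<^esub> z' = l \<odot>\<^bsub>E\<^esub> z"
      proof (rule cartesian_cancel[OF k dom.comp1_closed[OF z'(1) l(2)] dom.comp1_closed[OF z(1) l(2)]])
        show "map1 P (l \<odot>\<^bsub>E\<^esub> z') = map1 P (l \<odot>\<^bsub>E\<^esub> z)"
          using map1_comp'[OF z'(1) l(2)] map1_comp'[OF z(1) l(2)] z z' by simp
        show "k \<odot>\<^bsub>E\<^esub> (l \<odot>\<^bsub>E\<^esub> z') = k \<odot>\<^bsub>E\<^esub> (l \<odot>\<^bsub>E\<^esub> z)"
          using dom.comp1_assoc'[OF z'(1) l(2) k(2)] dom.comp1_assoc'[OF z(1) l(2) k(2)] z z' w by simp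
      qed
    qed (use z z' in simp)
    show "\<exists>!z. z \<in> hom1 E ?X (Dom E (k \<odot>\<^bsub>E\<^esub> l)) \<and> map1 P z = y \<and> (k \<odot>\<^bsub>E\<^esub> l) \<odot>\<^bsub>E\<^esub> z = x"
    proof (rule ex1I[of _ z])
      show "z \<in> hom1 E ?X (Dom E (k \<odot>\<^bsub>E\<^esub> l)) \<and> map1 P z = y \<and> (k \<odot>\<^bsub>E\<^esub> l) \<odot>\<^bsub>E\<^esub> z = x"
        using z klD(2) klz by simp
    qed (rule uniq, use klD(2) in simp_all)
  qed (use klD in simp)
qed

lemma vertical_comparison:
  assumes p: "p \<in> hom1 E A D" and q: "cartesian E K P q" "q \<in> hom1 E B D"
    and e: "map1 P p = map1 P q"
  shows "\<exists>!w. w \<in> hom1 E A B \<and> map1 P w = Id1 K (map0 P A) \<and> q \<odot>\<^bsub>E\<^esub> w = p"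
proof -
  have d: "map0 P A = map0 P B"
    using hom1_D[OF map1_closed[OF p]] hom1_D[OF map1_closed[OF q(2)]] e by simp
  have A: "map0 P A \<in> Obj K" using map0_closed dom.dom_closed hom1_D[OF p] by auto
  show ?thesis
    by (rule cartesian_factor[OF q p])
      (use cod.id1_closed[OF A] d e cod.comp1_id_right'[OF map1_closed[OF q(2)]] in simp_all)
qed

lemma vertical_comparison_invertible:
  assumes p: "cartesian E K P p" "p \<in> hom1 E A D" and q: "cartesian E K P q" "q \<in> hom1 E B D"
    and w: "w \<in> hom1 E A B" "map1 P w = Id1 K (map0 P A)" "q \<odot>\<^bsub>E\<^esub> w = p"
  shows "invertible1 E w"
proof -
  have A: "A \<in> Obj E" "B \<in> Obj E" using dom.dom_closed hom1_D[OF p(2)] hom1_D[OF q(2)] by auto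
  have "map0 P A = map0 P B"
    using hom1_D(3)[OF map1_closed[OF w(1)]] w(2) cod.id1_One[OF map0_closed[OF A(1)]] by simp
  then have d: "map0 P B = map0 P A" ..
  have e: "map1 P q = map1 P p"
    using map1_comp'[OF w(1) q(2)] w(2,3) cod.comp1_id_right'[OF map1_closed[OF q(2)]] d by simp
  obtain v where v: "v \<in> hom1 E B A" "map1 P v = Id1 K (map0 P B)" "p \<odot>\<^bsub>E\<^esub> v = q"
    using vertical_comparison[OF q(2) p e] by blast
  have id: "Id1 K (map0 P A) \<odot>\<^bsub>K\<^esub> Id1 K (map0 P A) = Id1 K (map0 P A)"
    using cod.comp1_id_left'[OF cod.id1_closed[OF map0_closed[OF A(1)]]] .
  have "v \<odot>\<^bsub>E\<^esub> w = Id1 E A"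
  proof (rule cartesian_cancel[OF p dom.comp1_closed[OF w(1) v(1)] dom.id1_closed[OF A(1)]])
    show "p \<odot>\<^bsub>E\<^esub> (v \<odot>\<^bsub>E\<^esub> w) = p \<odot>\<^bsub>E\<^esub> Id1 E A"
      using dom.comp1_assoc'[OF w(1) v(1) p(2)] v(3) w(3) dom.comp1_id_right'[OF p(2)] by simp
  qed (use map1_comp'[OF w(1) v(1)] v(2) w(2) d id map1_id[OF A(1)] in simp)
  moreover have "w \<odot>\<^bsub>E\<^esub> v = Id1 E B"
  proof (rule cartesian_cancel[OF q dom.comp1_closed[OF v(1) w(1)] dom.id1_closed[OF A(2)]])
    show "q \<odot>\<^bsub>E\<^esub> (w \<odot>\<^bsub>E\<^esub> v) = q \<odot>\<^bsub>E\<^esub> Id1 E B"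
      using dom.comp1_assoc'[OF v(1) w(1) q(2)] v(3) w(3) dom.comp1_id_right'[OF q(2)] by simp
  qed (use map1_comp'[OF v(1) w(1)] v(2) w(2) d id map1_id[OF A(2)] in simp)
  ultimately show ?thesis using dom.invertible1I[OF w(1) v(1)] by blast
qed

lemma lift_hom:
  assumes "B \<in> Obj E" "f \<in> One K" "Cod K f = map0 P B"
  shows "lift f B \<in> hom1 E (Dom E (lift f B)) B" "cartesian E K P (lift f B)"
    "map1 P (lift f B) = f" "map0 P (Dom E (lift f B)) = Dom K f" "Dom E (lift f B) \<in> Obj E"
proof -
  note l = lift_cartesian[OF assms]
  then show a: "lift f B \<in> hom1 E (Dom E (lift f B)) B" "cartesian E K P (lift f B)"
    "map1 P (lift f B) = f" by (auto simp: hom1_def cartesian_def)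
  show "map0 P (Dom E (lift f B)) = Dom K f" "Dom E (lift f B) \<in> Obj E"
    using map1_One(2)[of "lift f B"] a hom1_D[OF a(1)] dom.dom_closed by auto
qed

end

section \<open>The 2-functor given by pulling back an object\<close>

locale fibration_with_object = enhanced_discrete_two_fibration E K P lift
  for E :: "('p, 'n, 'd) two_cat" and K :: "('o, 'm, 'c) two_cat"
    and P :: "('p, 'n, 'd, 'o, 'm, 'c) two_map" and lift :: "'m \<Rightarrow> 'p \<Rightarrow> 'n" +
  fixes U :: 'p
  assumes U_Obj: "U \<in> Obj E"
begin

abbreviation "V \<equiv> map0 P U"
abbreviation "\<L> a \<equiv> lift a U"
abbreviation "S \<equiv> lax_slice K V"
abbreviation "G \<equiv> pullback E P lift U"

lemma pullback_simps [simp]: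
  "map0 G a = Dom E (\<L> a)"
  "map1 G s = pullback1 E P lift U s"
  "map2 G \<tau> = cell_lift E P (map1 G (slice_src \<tau>)) (slice_map \<tau>)"
  by (simp_all add: pullback_def)

lemmas \<L>_hom = lift_hom[OF U_Obj]

text \<open>
  The value of \<open>(-)\<^sup>*U\<close> on a 1-cell of the slice is characterized by the existence of a single 2-cell
  \<open>\<lambda>\<^sub>a \<Rightarrow> \<lambda>\<^sub>b \<circ> g\<close> over the given one; all later computations with \<open>(-)\<^sup>*U\<close> go through this.
\<close>

lemma pullback1:
  assumes s: "s \<in> slice_One K V"
  shows "map1 G s \<in> hom1 E (map0 G (slice_dom s)) (map0 G (slice_cod s))"
    "map1 P (map1 G s) = slice_arr s"
    "cell_lift E P (\<L> (slice_dom s)) (slice_cell s) \<in> hom2 E (\<L> (slice_dom s)) (\<L> (slice_cod s) \<odot>\<^bsub>E\<^esub> map1 G s)"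
    "map2 P (cell_lift E P (\<L> (slice_dom s)) (slice_cell s)) = slice_cell s"
proof -
  note D = slice_One_D[OF s]
  note a = \<L>_hom[OF D(1,2)] and b = \<L>_hom[OF D(3,4)]
  have f: "slice_cell s \<in> hom2 K (map1 P (\<L> (slice_dom s))) (slice_cod s \<odot>\<^bsub>K\<^esub> slice_arr s)"
    using D(6) a(3) by simp
  note c = cell_lift[OF hom1_D(1)[OF a(1)] f] and t = cell_lift_target[OF a(1) f]
  have "\<exists>!k. k \<in> hom1 E (Dom E (\<L> (slice_dom s))) (Dom E (\<L> (slice_cod s))) \<and>
      map1 P k = slice_arr s \<and>
      \<L> (slice_cod s) \<odot>\<^bsub>E\<^esub> k = Tgt E (cell_lift E P (\<L> (slice_dom s)) (slice_cell s))"
    by (rule cartesian_factor[OF b(2,1) t(1)]) (use D(5) a b t in simp_all)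
  from theI'[OF this]
  have "map1 G s \<in> hom1 E (map0 G (slice_dom s)) (map0 G (slice_cod s)) \<and>
      map1 P (map1 G s) = slice_arr s \<and>
      \<L> (slice_cod s) \<odot>\<^bsub>E\<^esub> map1 G s = Tgt E (cell_lift E P (\<L> (slice_dom s)) (slice_cell s))"
    by (simp add: pullback1_def)
  then show "map1 G s \<in> hom1 E (map0 G (slice_dom s)) (map0 G (slice_cod s))"
    "map1 P (map1 G s) = slice_arr s"
    "cell_lift E P (\<L> (slice_dom s)) (slice_cell s) \<in> hom2 E (\<L> (slice_dom s)) (\<L> (slice_cod s) \<odot>\<^bsub>E\<^esub> map1 G s)"
    "map2 P (cell_lift E P (\<L> (slice_dom s)) (slice_cell s)) = slice_cell s"
    using c by simp_all
qed

lemma pullback1_eqI: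
  assumes s: "s \<in> slice_One K V" and g: "g \<in> hom1 E (map0 G (slice_dom s)) (map0 G (slice_cod s))"
    and P: "map1 P g = slice_arr s"
    and a: "\<alpha> \<in> hom2 E (\<L> (slice_dom s)) (\<L> (slice_cod s) \<odot>\<^bsub>E\<^esub> g)" "map2 P \<alpha> = slice_cell s"
  shows "map1 G s = g"
proof -
  note p = pullback1[OF s] and D = slice_One_D[OF s]
  note b = \<L>_hom[OF D(3,4)]
  have "\<L> (slice_cod s) \<odot>\<^bsub>E\<^esub> map1 G s = \<L> (slice_cod s) \<odot>\<^bsub>E\<^esub> g"
    using two_cell_target_unique[OF p(3) a(1)] p(4) a(2) by simp
  then show ?thesis
    using cartesian_cancel[OF b(2,1) _ _ _, of "map1 G s" "map0 G (slice_dom s)" g] p(1,2) g P by simp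
qed

text \<open>
  Whiskering with a vertical 1-cell does not change the 2-cell below, so \<open>(h, \<phi>)\<close> pulled back and
  precomposed with \<open>w\<close> can be read off from any 2-cell out of \<open>\<lambda>\<^sub>a \<circ> w\<close> that lies over \<open>\<phi>\<close>.
\<close>

lemma pullback1_vertical:
  assumes s: "s \<in> slice_One K V" and w: "w \<in> hom1 E X (map0 G (slice_dom s))"
    and Pw: "map1 P w = Id1 K (map0 P X)"
    and a: "\<alpha> \<in> hom2 E (\<L> (slice_dom s) \<odot>\<^bsub>E\<^esub> w) y" "map2 P \<alpha> = slice_cell s"
  shows "\<L> (slice_cod s) \<odot>\<^bsub>E\<^esub> (map1 G s \<odot>\<^bsub>E\<^esub> w) = y"
proof -
  note p = pullback1[OF s] and D = slice_One_D[OF s]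
  note la = \<L>_hom[OF D(1,2)] and lb = \<L>_hom[OF D(3,4)]
  let ?\<Phi> = "cell_lift E P (\<L> (slice_dom s)) (slice_cell s)"
  have c: "Cod E w = Dom E (\<L> (slice_dom s))" using hom1_D[OF w] by simp
  note wh = dom.prewhisker_closed[OF p(3) hom1_D(1)[OF w] c]
  have X: "map0 P X = Dom K (slice_dom s)"
    using hom1_D(3)[OF map1_closed[OF w]] Pw la(4)
      cod.id1_One(3)[OF map0_closed[OF dom.dom_closed[OF hom1_D(1)[OF w]]]] hom1_D(2)[OF w] by simp
  have "map2 P (?\<Phi> \<star>\<^bsub>E\<^esub> Id2 E w) = slice_cell s"
    using map2_prewhisker[OF p(3) hom1_D(1)[OF w] c] p(4) Pw cod.prewhisker_id1[OF D(6)] X by simp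
  then have "(\<L> (slice_cod s) \<odot>\<^bsub>E\<^esub> map1 G s) \<odot>\<^bsub>E\<^esub> w = y"
    using two_cell_target_unique[OF wh a(1)] a(2) by simp
  moreover have "\<L> (slice_cod s) \<in> hom1 E (map0 G (slice_cod s)) U" using lb(1) by simp
  ultimately show ?thesis
    using dom.comp1_assoc'[OF w p(1)] by simp
qed

text \<open>
  Each equation is an instance of the characterization of \<open>(-)\<^sup>*U\<close> on 1-cells or of uniqueness of lifts
  of 2-cells.  Tight 1-cells are preserved because the value on \<open>(h, \<phi>)\<close> is a factorization
  over \<open>h\<close> through a chosen lift.
\<close>

lemma pullback_functor: "enhanced_two_functor S E G"
proof -
  interpret S: enhanced_two_category S by (rule cod.lax_slice_two_category)
  have G2: "map2 G \<tau> \<in> hom2 E (map1 G (slice_src \<tau>)) (map1 G (slice_tgt \<tau>))"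
      "map2 P (map2 G \<tau>) = slice_map \<tau>"
    if t: "\<tau> \<in> slice_Two K V" for \<tau>
  proof -
    note T = slice_Two_D[OF t] and s = pullback1[OF slice_Two_D(1)[OF t]]
    note D = slice_One_D[OF T(1)]
    let ?g = "map1 G (slice_src \<tau>)" and ?c = "slice_cod (slice_src \<tau>)"
    have f: "slice_map \<tau> \<in> hom2 K (map1 P ?g) (slice_arr (slice_tgt \<tau>))" using T(5) s(2) by simp
    note c = cell_lift[OF hom1_D(1)[OF s(1)] f] and g' = cell_lift_target[OF s(1) f]
    note lc = \<L>_hom[OF D(3,4)]
    have gc: "Cod E ?g = Dom E (\<L> ?c)" using hom1_D[OF s(1)] by simp
    let ?\<theta> = "cell_lift E P ?g (slice_map \<tau>)"
    note w = dom.postwhisker_closed[OF c(1) hom1_D(1)[OF lc(1)] gc]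
    have "map1 G (slice_tgt \<tau>) = Tgt E ?\<theta>"
    proof (rule pullback1_eqI[OF T(2)])
      show "(Id2 E (\<L> ?c) \<star>\<^bsub>E\<^esub> ?\<theta>) \<cdot>\<^bsub>E\<^esub> cell_lift E P (\<L> (slice_dom (slice_src \<tau>))) (slice_cell (slice_src \<tau>)) \<in>
          hom2 E (\<L> (slice_dom (slice_tgt \<tau>))) (\<L> (slice_cod (slice_tgt \<tau>)) \<odot>\<^bsub>E\<^esub> Tgt E ?\<theta>)"
        using dom.vcomp_closed[OF s(3) w] T by simp
      show "map2 P ((Id2 E (\<L> ?c) \<star>\<^bsub>E\<^esub> ?\<theta>) \<cdot>\<^bsub>E\<^esub> cell_lift E P (\<L> (slice_dom (slice_src \<tau>))) (slice_cell (slice_src \<tau>)))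
          = slice_cell (slice_tgt \<tau>)"
        using map2_vcomp'[OF s(3) w] map2_postwhisker[OF c(1) hom1_D(1)[OF lc(1)] gc] c(2) s(4) lc(3) T(6)
        by simp
    qed (use g' T in simp_all)
    then show "map2 G \<tau> \<in> hom2 E (map1 G (slice_src \<tau>)) (map1 G (slice_tgt \<tau>))"
      "map2 P (map2 G \<tau>) = slice_map \<tau>"
      using c by simp_all
  qed
  have G1_comp: "map1 G (slice_comp K t s) = map1 G t \<odot>\<^bsub>E\<^esub> map1 G s"
    if s: "s \<in> slice_One K V" and t: "t \<in> slice_One K V" and st: "slice_cod s = slice_dom t" for s t
  proof (rule pullback1_eqI[OF cod.slice_comp_closed[OF s t st]])
    note ps = pullback1[OF s] and pt = pullback1[OF t] and D = slice_One_D[OF s] and D' = slice_One_D[OF t]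
    note ls = \<L>_hom[OF D(3,4)] and lt = \<L>_hom[OF D'(3,4)]
    have pt1: "map1 G t \<in> hom1 E (map0 G (slice_cod s)) (map0 G (slice_cod t))" using pt(1) st by simp
    show "map1 G t \<odot>\<^bsub>E\<^esub> map1 G s \<in> hom1 E (map0 G (slice_dom (slice_comp K t s))) (map0 G (slice_cod (slice_comp K t s)))"
      using dom.comp1_closed[OF ps(1) pt1] by simp
    show "map1 P (map1 G t \<odot>\<^bsub>E\<^esub> map1 G s) = slice_arr (slice_comp K t s)"
      using map1_comp'[OF ps(1) pt1] ps(2) pt(2) by simp
    let ?\<Phi> = "cell_lift E P (\<L> (slice_dom s)) (slice_cell s)"
    let ?\<Psi> = "cell_lift E P (\<L> (slice_dom t)) (slice_cell t)"
    have c: "Cod E (map1 G s) = Dom E (\<L> (slice_dom t))" using hom1_D[OF ps(1)] st by simp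
    note w = dom.prewhisker_closed[OF pt(3) hom1_D(1)[OF ps(1)] c]
    have w': "?\<Psi> \<star>\<^bsub>E\<^esub> Id2 E (map1 G s) \<in>
        hom2 E (\<L> (slice_cod s) \<odot>\<^bsub>E\<^esub> map1 G s) (\<L> (slice_cod t) \<odot>\<^bsub>E\<^esub> (map1 G t \<odot>\<^bsub>E\<^esub> map1 G s))"
      using w st dom.comp1_assoc'[OF ps(1) pt1, of "\<L> (slice_cod t)" U] lt(1) by simp
    show "(?\<Psi> \<star>\<^bsub>E\<^esub> Id2 E (map1 G s)) \<cdot>\<^bsub>E\<^esub> ?\<Phi> \<in>
        hom2 E (\<L> (slice_dom (slice_comp K t s))) (\<L> (slice_cod (slice_comp K t s)) \<odot>\<^bsub>E\<^esub> (map1 G t \<odot>\<^bsub>E\<^esub> map1 G s))"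
      using dom.vcomp_closed[OF ps(3) w'] by simp
    show "map2 P ((?\<Psi> \<star>\<^bsub>E\<^esub> Id2 E (map1 G s)) \<cdot>\<^bsub>E\<^esub> ?\<Phi>) = slice_cell (slice_comp K t s)"
      using map2_vcomp'[OF ps(3) w'] map2_prewhisker[OF pt(3) hom1_D(1)[OF ps(1)] c] ps pt by simp
  qed
  show ?thesis
  proof (unfold_locales, goal_cases)
    case (1 a) then show ?case using \<L>_hom(5) by simp
  next
    case (2 s a b) then show ?case using pullback1(1)[of s] by (simp add: hom1_def)
  next
    case (3 \<tau> s t) then show ?case using G2(1)[of \<tau>] by (simp add: hom2_def)
  next
    case (4 a)
    then have a: "a \<in> One K" "Cod K a = V" by simp_all
    note l = \<L>_hom[OF a]
    show ?case
      unfolding lax_slice_simps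
    proof (rule pullback1_eqI[OF cod.slice_id_closed[OF a]])
      show "Id2 E (\<L> a) \<in> hom2 E (\<L> (slice_dom (Slice1 a (Id1 K (Dom K a)) (Id2 K a) a)))
         (\<L> (slice_cod (Slice1 a (Id1 K (Dom K a)) (Id2 K a) a)) \<odot>\<^bsub>E\<^esub> Id1 E (map0 G a))"
        using dom.id2_closed[OF hom1_D(1)[OF l(1)]] dom.comp1_id_right'[OF l(1)] by simp
    qed (use dom.id1_closed[OF l(5)] map1_id[OF l(5)] l map2_id[OF hom1_D(1)[OF l(1)]] in simp_all)
  next
    case (5 s t) then show ?case using G1_comp[of s t] by simp
  next
    case (6 s)
    then have s: "s \<in> slice_One K V" by simp
    note i = hom2_D[OF S.id2_closed[OF 6]] and p = hom1_D(1)[OF pullback1(1)[OF s]]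
    have "map2 G (Id2 S s) = Id2 E (map1 G s)"
    proof (rule two_cell_unique[OF _ dom.id2_closed[OF p]])
      show "map2 G (Id2 S s) \<in> hom2 E (map1 G s) (map1 G s)"
        using G2(1)[of "Id2 S s"] i by simp
      show "map2 P (map2 G (Id2 S s)) = map2 P (Id2 E (map1 G s))"
        using G2(2)[of "Id2 S s"] i pullback1(2)[OF s] map2_id[OF p] by simp
    qed
    then show ?case .
  next
    case (7 \<sigma> \<tau>)
    then have a: "\<sigma> \<in> slice_Two K V" "\<tau> \<in> slice_Two K V" "slice_tgt \<sigma> = slice_src \<tau>" by simp_all
    note c = cod.slice_vcomp_closed[OF a]
    have t: "map2 G \<tau> \<in> hom2 E (map1 G (slice_tgt \<sigma>)) (map1 G (slice_tgt \<tau>))"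
      using G2(1)[OF a(2)] a(3) by simp
    have "map2 G (Slice2 (slice_src \<sigma>) (slice_map \<tau> \<cdot>\<^bsub>K\<^esub> slice_map \<sigma>) (slice_tgt \<tau>)) =
        map2 G \<tau> \<cdot>\<^bsub>E\<^esub> map2 G \<sigma>"
      by (rule two_cell_unique[OF G2(1)[OF c]])
        (use dom.vcomp_closed[OF G2(1)[OF a(1)] t] G2(2)[OF c] map2_vcomp'[OF G2(1)[OF a(1)] t]
          G2(2)[OF a(1)] G2(2)[OF a(2)] in simp_all)
    then show ?case by simp
  next
    case (8 \<sigma> \<tau>)
    then have a: "\<sigma> \<in> slice_Two K V" "\<tau> \<in> slice_Two K V"
      "slice_cod (slice_src \<sigma>) = slice_dom (slice_src \<tau>)" by simp_all
    note c = cod.slice_hcomp_closed[OF a]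
    note s = slice_Two_D(1)[OF a(1)] and t = slice_Two_D(1)[OF a(2)]
    have e: "Cod E (map1 G (slice_src \<sigma>)) = Dom E (map1 G (slice_src \<tau>))"
      using hom1_D[OF pullback1(1)[OF s]] hom1_D[OF pullback1(1)[OF t]] a(3) by simp
    note h = dom.hcomp_closed[OF G2(1)[OF a(1)] G2(1)[OF a(2)] e]
    have eP: "map2 P (map2 G \<tau> \<star>\<^bsub>E\<^esub> map2 G \<sigma>) = slice_map \<tau> \<star>\<^bsub>K\<^esub> slice_map \<sigma>"
      using map2_hcomp[of "map2 G \<sigma>" "map2 G \<tau>"] hom2_D[OF G2(1)[OF a(1)]] hom2_D[OF G2(1)[OF a(2)]] e
        G2(2)[OF a(1)] G2(2)[OF a(2)] by simp
    have "map2 G (HComp S \<tau> \<sigma>) = map2 G \<tau> \<star>\<^bsub>E\<^esub> map2 G \<sigma>"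
      unfolding lax_slice_simps
      by (rule two_cell_unique[OF G2(1)[OF c]])
        (use h G1_comp[OF s t a(3)] G2(2)[OF c] eP in simp_all)
    then show ?case .
  next
    case (9 s)
    then have s: "s \<in> slice_One K V" "slice_arr s \<in> Tight K" by simp_all
    note p = pullback1[OF s(1)] and D = slice_One_D[OF s(1)]
    note lc = \<L>_hom[OF D(3,4)] and ld = \<L>_hom[OF D(1,2)]
    have "map1 G s \<in> Tight E"
    proof (rule factor_tight[OF U_Obj D(3,4) _ _ _ s(2) _ p(2) refl])
      show "\<L> (slice_cod s) \<odot>\<^bsub>E\<^esub> map1 G s \<in> hom1 E (map0 G (slice_dom s)) U"
        using dom.comp1_closed[OF p(1)] lc(1) by simp
      show "slice_arr s \<in> hom1 K (map0 P (map0 G (slice_dom s))) (Dom K (slice_cod s))"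
        using D(5) ld by simp
      show "map1 P (\<L> (slice_cod s) \<odot>\<^bsub>E\<^esub> map1 G s) = slice_cod s \<odot>\<^bsub>K\<^esub> slice_arr s"
        using map1_comp'[OF p(1)] lc p(2) by simp
      show "map1 G s \<in> hom1 E (map0 G (slice_dom s)) (Dom E (\<L> (slice_cod s)))"
        using p(1) by simp
    qed
    then show ?case .
  qed
qed

lemma map2_pullback_over:
  assumes t: "\<tau> \<in> slice_Two K V"
  shows "map2 P (map2 G \<tau>) = slice_map \<tau>"
proof -
  note s = pullback1[OF slice_Two_D(1)[OF t]]
  have "slice_map \<tau> \<in> hom2 K (map1 P (map1 G (slice_src \<tau>))) (slice_arr (slice_tgt \<tau>))"
    using slice_Two_D(5)[OF t] s(2) by simp
  from cell_lift(2)[OF hom1_D(1)[OF s(1)] this] show ?thesis by simp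
qed

lemma pullback_over: "map_eq_on S (comp_map P G) (slice_proj K)"
  using \<L>_hom(4) pullback1(2) map2_pullback_over by (simp add: map_eq_on_def comp_map_def)

end

section \<open>Equivalences are fully faithful and conservative\<close>

context enhanced_two_category
begin

lemma invertible1_cancel_right:
  assumes e: "e \<in> hom1 C A B" "invertible1 C e" and f: "f \<in> hom1 C B D" and g: "g \<in> hom1 C B D"
    and fg: "f \<odot> e = g \<odot> e"
  shows "f = g"
proof -
  obtain e' where e': "e' \<in> hom1 C B A" "e' \<odot> e = Id1 C A" "e \<odot> e' = Id1 C B"
    using invertible1E[OF e(2,1)] .
  have "(f \<odot> e) \<odot> e' = (g \<odot> e) \<odot> e'" using fg by simp
  then show ?thesis
    using comp1_assoc'[OF e'(1) e(1) f] comp1_assoc'[OF e'(1) e(1) g] e'(3)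
      comp1_id_right'[OF f] comp1_id_right'[OF g] by simp
qed

lemma invertible1_cancel_left:
  assumes e: "e \<in> hom1 C B D" "invertible1 C e" and f: "f \<in> hom1 C A B" and g: "g \<in> hom1 C A B"
    and fg: "e \<odot> f = e \<odot> g"
  shows "f = g"
proof -
  obtain e' where e': "e' \<in> hom1 C D B" "e' \<odot> e = Id1 C B" "e \<odot> e' = Id1 C D"
    using invertible1E[OF e(2,1)] .
  have "e' \<odot> (e \<odot> f) = e' \<odot> (e \<odot> g)" using fg by simp
  then show ?thesis
    using comp1_assoc'[OF f e(1) e'(1)] comp1_assoc'[OF g e(1) e'(1)] e'(2)
      comp1_id_left'[OF f] comp1_id_left'[OF g] by simp
qed

end

locale equivalence_data =
  fixes K :: "('o, 'm, 'c) two_cat"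
    and A :: "('r, 's, 't) two_cat" and Q :: "('r, 's, 't, 'o, 'm, 'c) two_map"
    and E :: "('p, 'n, 'd) two_cat" and P :: "('p, 'n, 'd, 'o, 'm, 'c) two_map"
    and G :: "('r, 's, 't, 'p, 'n, 'd) two_map" and F :: "('p, 'n, 'd, 'r, 's, 't) two_map"
    and \<eta> :: "'p \<Rightarrow> 'n" and \<epsilon> :: "'r \<Rightarrow> 's"
  assumes inverse_over: "inverse_over K A Q E P G F \<eta> \<epsilon>"
begin

sublocale G: enhanced_two_functor A E G
  using inverse_over by (simp add: inverse_over_def)

sublocale F: enhanced_two_functor E A F
  using inverse_over by (simp add: inverse_over_def)

lemma F_over:
  "X \<in> Obj E \<Longrightarrow> map0 Q (map0 F X) = map0 P X"
  "x \<in> One E \<Longrightarrow> map1 Q (map1 F x) = map1 P x"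
  "\<alpha> \<in> Two E \<Longrightarrow> map2 Q (map2 F \<alpha>) = map2 P \<alpha>"
  using inverse_over by (simp_all add: inverse_over_def map_eq_on_def comp_map_def)

lemma \<eta>_hom:
  assumes "X \<in> Obj E"
  shows "\<eta> X \<in> hom1 E X (map0 G (map0 F X))" "invertible1 E (\<eta> X)"
    "map1 P (\<eta> X) = Id1 K (map0 P X)"
  using inverse_over assms by (simp_all add: inverse_over_def two_natural_def id_map_def comp_map_def)

lemma \<epsilon>_hom:
  assumes "a \<in> Obj A"
  shows "\<epsilon> a \<in> hom1 A (map0 F (map0 G a)) a" "invertible1 A (\<epsilon> a)"
  using inverse_over assms by (simp_all add: inverse_over_def two_natural_def id_map_def comp_map_def)

lemma \<eta>_natural:
  assumes "x \<in> hom1 E X Y"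
  shows "map1 G (map1 F x) \<odot>\<^bsub>E\<^esub> \<eta> X = \<eta> Y \<odot>\<^bsub>E\<^esub> x"
  using inverse_over hom1_D[OF assms]
  by (auto simp: inverse_over_def two_natural_def id_map_def comp_map_def)

lemma \<epsilon>_natural:
  assumes "s \<in> hom1 A a b"
  shows "s \<odot>\<^bsub>A\<^esub> \<epsilon> a = \<epsilon> b \<odot>\<^bsub>A\<^esub> map1 F (map1 G s)"
  using inverse_over hom1_D[OF assms]
  by (auto simp: inverse_over_def two_natural_def id_map_def comp_map_def)

lemma hom_Obj:
  "s \<in> hom1 A a b \<Longrightarrow> a \<in> Obj A" "s \<in> hom1 A a b \<Longrightarrow> b \<in> Obj A"
  "x \<in> hom1 E X Y \<Longrightarrow> X \<in> Obj E" "x \<in> hom1 E X Y \<Longrightarrow> Y \<in> Obj E"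
  using G.dom.dom_closed G.dom.cod_closed G.cod.dom_closed G.cod.cod_closed
  by (auto simp: hom1_def)

lemma G_faithful:
  assumes s: "s \<in> hom1 A a b" and t: "t \<in> hom1 A a b" and e: "map1 G s = map1 G t"
  shows "s = t"
  using G.dom.invertible1_cancel_right[OF \<epsilon>_hom[OF hom_Obj(1)[OF s]] s t]
    \<epsilon>_natural[OF s] \<epsilon>_natural[OF t] e by simp

lemma F_faithful:
  assumes x: "x \<in> hom1 E X Y" and y: "y \<in> hom1 E X Y" and e: "map1 F x = map1 F y"
  shows "x = y"
  using G.cod.invertible1_cancel_left[OF \<eta>_hom(1,2)[OF hom_Obj(4)[OF x]] x y]
    \<eta>_natural[OF x] \<eta>_natural[OF y] e by simp

text \<open>
  A preimage of \<open>g\<close> is \<open>\<epsilon>\<^sub>b \<circ> F g \<circ> \<epsilon>\<^sub>a\<^sup>-\<^sup>1\<close>: naturality of \<open>\<epsilon>\<close> shows that its image and \<open>g\<close> have the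
  same image under the faithful \<open>F\<close>.
\<close>

lemma G_full:
  assumes g: "g \<in> hom1 E (map0 G a) (map0 G b)" and a: "a \<in> Obj A" and b: "b \<in> Obj A"
  shows "\<exists>s \<in> hom1 A a b. map1 G s = g"
proof -
  note ea = \<epsilon>_hom[OF a] and eb = \<epsilon>_hom[OF b] and Fg = F.map1_closed[OF g]
  obtain e where e: "e \<in> hom1 A a (map0 F (map0 G a))" "e \<odot>\<^bsub>A\<^esub> \<epsilon> a = Id1 A (map0 F (map0 G a))"
    using G.dom.invertible1E[OF ea(2,1)] by blast
  define s where "s = (\<epsilon> b \<odot>\<^bsub>A\<^esub> map1 F g) \<odot>\<^bsub>A\<^esub> e"
  note bg = G.dom.comp1_closed[OF Fg eb(1)]
  have s: "s \<in> hom1 A a b" unfolding s_def by (rule G.dom.comp1_closed[OF e(1) bg])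
  have "\<epsilon> b \<odot>\<^bsub>A\<^esub> map1 F (map1 G s) = s \<odot>\<^bsub>A\<^esub> \<epsilon> a" using \<epsilon>_natural[OF s] by simp
  also have "\<dots> = \<epsilon> b \<odot>\<^bsub>A\<^esub> map1 F g"
    unfolding s_def G.dom.comp1_assoc'[OF ea(1) e(1) bg] e(2) by (rule G.dom.comp1_id_right'[OF bg])
  finally have "map1 F (map1 G s) = map1 F g"
    using G.dom.invertible1_cancel_left[OF eb F.map1_closed[OF G.map1_closed[OF s]] Fg] by blast
  then have "map1 G s = g" by (rule F_faithful[OF G.map1_closed[OF s] g])
  then show ?thesis using s by blast
qed

lemma G_conservative:
  assumes s: "s \<in> hom1 A a b" and inv: "invertible1 E (map1 G s)"
  shows "invertible1 A s"
proof -
  note ab = hom_Obj(1,2)[OF s]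
  obtain g where g: "g \<in> hom1 E (map0 G b) (map0 G a)" "g \<odot>\<^bsub>E\<^esub> map1 G s = Id1 E (map0 G a)"
      "map1 G s \<odot>\<^bsub>E\<^esub> g = Id1 E (map0 G b)"
    using G.cod.invertible1E[OF inv G.map1_closed[OF s]] .
  obtain t where t: "t \<in> hom1 A b a" "map1 G t = g" using G_full[OF g(1) ab(2,1)] by blast
  have "t \<odot>\<^bsub>A\<^esub> s = Id1 A a"
    by (rule G_faithful[OF G.dom.comp1_closed[OF s t(1)] G.dom.id1_closed[OF ab(1)]])
      (use G.map1_comp'[OF s t(1)] t(2) g(2) G.map1_id[OF ab(1)] in simp)
  moreover have "s \<odot>\<^bsub>A\<^esub> t = Id1 A b"
    by (rule G_faithful[OF G.dom.comp1_closed[OF t(1) s] G.dom.id1_closed[OF ab(2)]])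
      (use G.map1_comp'[OF t(1) s] t(2) g(3) G.map1_id[OF ab(2)] in simp)
  ultimately show ?thesis by (rule G.dom.invertible1I[OF s t(1)])
qed

text \<open>
  Applying \<open>G\<close> to \<open>\<epsilon>\<^bsub>F X\<^esub> \<circ> F \<eta>\<^sub>X\<close> and precomposing with \<open>\<eta>\<^sub>X\<close> gives \<open>\<eta>\<^sub>X\<close> by naturality and the first
  triangle identity.  As \<open>\<eta>\<^sub>X\<close> is invertible and \<open>G\<close> is faithful, the 1-cell is an identity.
\<close>

lemma second_triangle:
  assumes tri: "\<And>a. a \<in> Obj A \<Longrightarrow> map1 G (\<epsilon> a) \<odot>\<^bsub>E\<^esub> \<eta> (map0 G a) = Id1 E (map0 G a)"
    and X: "X \<in> Obj E"
  shows "\<epsilon> (map0 F X) \<odot>\<^bsub>A\<^esub> map1 F (\<eta> X) = Id1 A (map0 F X)"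
proof -
  note FX = F.map0_closed[OF X] and h = \<eta>_hom[OF X]
  note GFX = G.map0_closed[OF FX]
  note e = \<epsilon>_hom[OF FX] and Fh = F.map1_closed[OF h(1)] and h' = \<eta>_hom[OF GFX]
  note eh = G.dom.comp1_closed[OF Fh e(1)]
  note Ge = G.map1_closed[OF e(1)] and GFh = G.map1_closed[OF Fh]
  have "map1 G (\<epsilon> (map0 F X) \<odot>\<^bsub>A\<^esub> map1 F (\<eta> X)) \<odot>\<^bsub>E\<^esub> \<eta> X =
      map1 G (\<epsilon> (map0 F X)) \<odot>\<^bsub>E\<^esub> (map1 G (map1 F (\<eta> X)) \<odot>\<^bsub>E\<^esub> \<eta> X)"
    using G.map1_comp'[OF Fh e(1)] G.cod.comp1_assoc'[OF h(1) GFh Ge] by simp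
  also have "\<dots> = (map1 G (\<epsilon> (map0 F X)) \<odot>\<^bsub>E\<^esub> \<eta> (map0 G (map0 F X))) \<odot>\<^bsub>E\<^esub> \<eta> X"
    using \<eta>_natural[OF h(1)] G.cod.comp1_assoc'[OF h(1) h'(1) Ge] by simp
  also have "\<dots> = Id1 E (map0 G (map0 F X)) \<odot>\<^bsub>E\<^esub> \<eta> X" using tri[OF FX] by simp
  finally have "map1 G (\<epsilon> (map0 F X) \<odot>\<^bsub>A\<^esub> map1 F (\<eta> X)) = Id1 E (map0 G (map0 F X))"
    using G.cod.invertible1_cancel_right[OF h(1,2) G.map1_closed[OF eh] G.cod.id1_closed[OF GFX]] by simp
  then show ?thesis
    using G_faithful[OF eh G.dom.id1_closed[OF FX]] G.map1_id[OF FX] by simp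
qed

end

section \<open>From a marked lax cocone to an adjoint equivalence\<close>

context marked_lax_cocone
begin

text \<open>
  Pasting \<open>\<delta>\<^sub>p\<close> with \<open>\<sigma>\<close> gives a canonical 2-cell \<open>k\<^sub>X \<Rightarrow> p\<close> for every \<open>p : X \<rightarrow> U\<close>.  Its values at the chosen
  lifts are the components of the counit, before \<open>P\<close> is applied.
\<close>

definition mediator :: "'n \<Rightarrow> 'd" where
  "mediator p = (\<sigma> \<star> Id2 E p) \<cdot> \<delta> p"

lemma \<sigma>_prewhisker:
  assumes p: "p \<in> hom1 E X U"
  shows "\<sigma> \<star> Id2 E p \<in> hom2 E (k U \<odot> p) p"
  using prewhisker_closed[OF \<sigma>_closed hom1_D(1)[OF p]] hom1_D[OF p] hom1_D[OF k_closed[OF apex]]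
    comp1_id_left'[OF p] by simp

lemma mediator_closed:
  assumes p: "p \<in> hom1 E X U"
  shows "mediator p \<in> hom2 E (k X) p"
  unfolding mediator_def by (rule vcomp_closed[OF \<delta>_closed[OF p] \<sigma>_prewhisker[OF p]])

lemma mediator_invertible:
  assumes p: "p \<in> hom1 E X U" and M: "p \<in> M"
  shows "invertible2 E (mediator p)"
  unfolding mediator_def
  by (rule invertible2_vcomp[OF \<delta>_closed[OF p] \<delta>_marked[OF M hom1_D(1)[OF p]] \<sigma>_prewhisker[OF p]
        invertible2_prewhisker[OF \<sigma>_closed \<sigma>_invertible hom1_D(1)[OF p]]])
     (use hom1_D[OF p] hom1_D[OF k_closed[OF apex]] in simp)

text \<open>
  The 2-cell \<open>\<alpha>\<close> slides past \<open>\<sigma>\<close> by the exchange law and is then absorbed by naturality of \<open>\<delta>\<close>.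
\<close>

lemma mediator_natural:
  assumes p: "p \<in> hom1 E X U" and a: "\<alpha> \<in> hom2 E p p'"
  shows "\<alpha> \<cdot> mediator p = mediator p'"
proof -
  have p': "p' \<in> hom1 E X U" by (rule hom2_hom1[OF a p])
  have kU: "Cod E p = Dom E (k U)" using hom1_D[OF p] hom1_D[OF k_closed[OF apex]] by simp
  note k1 = hom1_D(1)[OF k_closed[OF apex]]
  note ka = postwhisker_closed[OF a k1 kU]
  have ex: "\<alpha> \<cdot> (\<sigma> \<star> Id2 E p) = (\<sigma> \<star> Id2 E p') \<cdot> (Id2 E (k U) \<star> \<alpha>)"
    using whisker_exchange[OF a \<sigma>_closed kU] postwhisker_id1[OF a] hom1_D[OF p] by simp
  have "\<alpha> \<cdot> mediator p = (\<alpha> \<cdot> (\<sigma> \<star> Id2 E p)) \<cdot> \<delta> p"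
    unfolding mediator_def using vcomp_assoc'[OF \<delta>_closed[OF p] \<sigma>_prewhisker[OF p] a] by simp
  also have "\<dots> = (\<sigma> \<star> Id2 E p') \<cdot> ((Id2 E (k U) \<star> \<alpha>) \<cdot> \<delta> p)"
    unfolding ex by (rule vcomp_assoc'[OF \<delta>_closed[OF p] ka \<sigma>_prewhisker[OF p']])
  also have "\<dots> = mediator p'"
    unfolding mediator_def using \<delta>_natural[OF a p] by simp
  finally show ?thesis .
qed

lemma mediator_comp:
  assumes q: "q \<in> hom1 E Y U" and g: "g \<in> hom1 E X Y"
  shows "(mediator q \<star> Id2 E g) \<cdot> \<delta> g = mediator (q \<odot> g)"
proof -
  note qg = comp1_closed[OF g q]
  note gD = hom1_D[OF g] and qD = hom1_D[OF q] and kU = hom1_D[OF k_closed[OF apex]]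
  have kY: "k Y \<in> hom1 E Y U" using k_closed cod_closed gD by auto
  have c: "Cod E g = Dom E (k Y)" using gD hom1_D[OF kY] by simp
  have dq: "\<delta> q \<star> Id2 E g \<in> hom2 E (k Y \<odot> g) (k U \<odot> (q \<odot> g))"
    using prewhisker_closed[OF \<delta>_closed[OF q] gD(1) c] comp1_assoc'[OF g q k_closed[OF apex]] by simp
  have "mediator q \<star> Id2 E g = ((\<sigma> \<star> Id2 E q) \<star> Id2 E g) \<cdot> (\<delta> q \<star> Id2 E g)"
    unfolding mediator_def by (rule prewhisker_vcomp[OF \<delta>_closed[OF q] \<sigma>_prewhisker[OF q] gD(1) c])
  also have "(\<sigma> \<star> Id2 E q) \<star> Id2 E g = \<sigma> \<star> Id2 E (q \<odot> g)"
    by (rule prewhisker_comp1[OF \<sigma>_closed gD(1) qD(1)]) (use gD qD kU in simp_all)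
  finally have "(mediator q \<star> Id2 E g) \<cdot> \<delta> g = (\<sigma> \<star> Id2 E (q \<odot> g)) \<cdot> ((\<delta> q \<star> Id2 E g) \<cdot> \<delta> g)"
    using vcomp_assoc'[OF \<delta>_closed[OF g] dq \<sigma>_prewhisker[OF qg]] by simp
  then show ?thesis unfolding mediator_def using \<delta>_comp[OF g q] by simp
qed

end

locale fibration_with_cocone =
  fibration_with_object E K P lift U +
  cocone: marked_lax_cocone E "cartesian_marking E K P" U k \<delta> \<sigma>
  for E :: "('p, 'n, 'd) two_cat" and K :: "('o, 'm, 'c) two_cat"
    and P :: "('p, 'n, 'd, 'o, 'm, 'c) two_map" and lift :: "'m \<Rightarrow> 'p \<Rightarrow> 'n"
    and U :: 'p and k :: "'p \<Rightarrow> 'n" and \<delta> :: "'n \<Rightarrow> 'd" and \<sigma> :: 'd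
begin

text \<open>
  The inverse of \<open>(-)\<^sup>*U\<close> classifies \<open>X\<close> by the 1-cell \<open>P k\<^sub>X\<close>, along which \<open>U\<close> pulls back to \<open>X\<close> up to
  isomorphism.
\<close>

definition classify1 :: "'n \<Rightarrow> ('m, 'c) slice1" where
  "classify1 x = Slice1 (map1 P (k (Dom E x))) (map1 P x) (map2 P (\<delta> x)) (map1 P (k (Cod E x)))"

definition classify :: "('p, 'n, 'd, 'm, ('m, 'c) slice1, ('m, 'c) slice2) two_map" where
  "classify = \<lparr>map0 = (\<lambda>X. map1 P (k X)), map1 = classify1,
     map2 = (\<lambda>\<alpha>. Slice2 (classify1 (Src E \<alpha>)) (map2 P \<alpha>) (classify1 (Tgt E \<alpha>)))\<rparr>"

lemma classify_simps [simp]: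
  "map0 classify X = map1 P (k X)"
  "map1 classify = classify1"
  "map2 classify \<alpha> = Slice2 (classify1 (Src E \<alpha>)) (map2 P \<alpha>) (classify1 (Tgt E \<alpha>))"
  by (simp_all add: classify_def)

lemma k_cartesian:
  assumes "X \<in> Obj E"
  shows "cartesian E K P (k X)"
  using cocone.k_marked[OF assms] by (simp add: cartesian_marking_def)

lemma Pk:
  assumes "X \<in> Obj E"
  shows "map1 P (k X) \<in> hom1 K (map0 P X) V" "map1 P (k X) \<in> One K"
    "Dom K (map1 P (k X)) = map0 P X" "Cod K (map1 P (k X)) = V"
  using map1_closed[OF cocone.k_closed[OF assms]] by (auto simp: hom1_def)

lemma P\<delta>:
  assumes x: "x \<in> hom1 E X Y"
  shows "map2 P (\<delta> x) \<in> hom2 K (map1 P (k X)) (map1 P (k Y) \<odot>\<^bsub>K\<^esub> map1 P x)"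
proof -
  have "Y \<in> Obj E" using hom1_D[OF x] dom.cod_closed by auto
  from map2_closed[OF cocone.\<delta>_closed[OF x]] map1_comp'[OF x cocone.k_closed[OF this]]
  show ?thesis by simp
qed

lemma classify1_One:
  assumes x: "x \<in> One E"
  shows "classify1 x \<in> slice_One K V"
  using P\<delta>[OF hom1_I[OF x refl refl]] Pk dom.dom_closed[OF x] dom.cod_closed[OF x]
    map1_closed[OF hom1_I[OF x refl refl]]
  by (simp add: classify1_def slice_One_iff)

lemma classify1_comp:
  assumes f: "f \<in> One E" and g: "g \<in> One E" and fg: "Cod E f = Dom E g"
  shows "classify1 (g \<odot>\<^bsub>E\<^esub> f) = slice_comp K (classify1 g) (classify1 f)"
proof -
  have f': "f \<in> hom1 E (Dom E f) (Dom E g)" and g': "g \<in> hom1 E (Dom E g) (Cod E g)"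
    using f g fg by (simp_all add: hom1_def)
  have c: "Cod E f = Dom E (k (Dom E g))"
    using fg hom1_D[OF cocone.k_closed[OF dom.dom_closed[OF g]]] by simp
  note w = dom.prewhisker_closed[OF cocone.\<delta>_closed[OF g'] f c]
  have "map2 P (\<delta> (g \<odot>\<^bsub>E\<^esub> f)) = (map2 P (\<delta> g) \<star>\<^bsub>K\<^esub> Id2 K (map1 P f)) \<cdot>\<^bsub>K\<^esub> map2 P (\<delta> f)"
    using cocone.\<delta>_comp[OF f' g'] map2_vcomp'[OF cocone.\<delta>_closed[OF f'] w]
      map2_prewhisker[OF cocone.\<delta>_closed[OF g'] f c] by simp
  then show ?thesis
    using dom.comp1_One[OF f g fg] map1_comp[OF f g fg] by (simp add: classify1_def slice_comp_def)
qed

lemma classify2_Two: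
  assumes a: "\<alpha> \<in> Two E"
  shows "map2 classify \<alpha> \<in> slice_Two K V"
proof -
  have a': "\<alpha> \<in> hom2 E (Src E \<alpha>) (Tgt E \<alpha>)" using a by (simp add: hom2_def)
  note p = dom.hom2_parallel[OF a']
  note x = hom1_I[OF p(1) refl refl]
  let ?k = "k (Cod E (Src E \<alpha>))"
  have kh: "?k \<in> hom1 E (Cod E (Src E \<alpha>)) U" using cocone.k_closed dom.cod_closed p by blast
  have c: "Cod E (Src E \<alpha>) = Dom E ?k" using hom1_D[OF kh] by simp
  note w = dom.postwhisker_closed[OF a' hom1_D(1)[OF kh] c]
  have "(Id2 K (map1 P ?k) \<star>\<^bsub>K\<^esub> map2 P \<alpha>) \<cdot>\<^bsub>K\<^esub> map2 P (\<delta> (Src E \<alpha>)) = map2 P (\<delta> (Tgt E \<alpha>))"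
    using cocone.\<delta>_natural[OF a' x] map2_vcomp'[OF cocone.\<delta>_closed[OF x] w]
      map2_postwhisker[OF a' hom1_D(1)[OF kh] c] by simp
  then show ?thesis
    using classify1_One[OF p(1)] classify1_One[OF p(2)] p map2_closed[OF a']
    by (simp add: slice_Two_iff) (simp add: classify1_def)
qed

lemma classify_functor: "enhanced_two_functor E S classify"
proof -
  interpret S: enhanced_two_category S by (rule cod.lax_slice_two_category)
  show ?thesis
  proof (unfold_locales, goal_cases)
    case (1 X) then show ?case using Pk by simp
  next
    case (2 f A B) then show ?case using classify1_One[of f] by (auto simp: hom1_def) (auto simp: classify1_def)
  next
    case (3 \<alpha> f g) then show ?case using classify2_Two[of \<alpha>] by (auto simp: hom2_def)
  next
    case (4 A)
    then show ?case
      using dom.id1_One[of A] cocone.\<delta>_id[of A] map1_id[of A] Pk[of A] map2_id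
        hom1_D[OF cocone.k_closed[of A]] by (simp add: classify1_def)
  next
    case (5 f g) then show ?case using classify1_comp by simp
  next
    case (6 f)
    then show ?case using hom2_D[OF dom.id2_closed[of f]] map2_id[of f] by (simp add: classify1_def)
  next
    case (7 \<alpha> \<beta>)
    then show ?case
      using hom2_D[OF dom.vcomp_closed[OF hom2_I[OF 7(1) refl refl] hom2_I[OF 7(2) 7(3)[symmetric] refl]]]
        map2_vcomp[of \<alpha> \<beta>] by simp
  next
    case (8 \<alpha> \<beta>)
    then have a: "\<alpha> \<in> hom2 E (Src E \<alpha>) (Tgt E \<alpha>)" "\<beta> \<in> hom2 E (Src E \<beta>) (Tgt E \<beta>)"
      by (simp_all add: hom2_def)
    note pa = dom.hom2_parallel[OF a(1)] and pb = dom.hom2_parallel[OF a(2)]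
    show ?case
      using 8 hom2_D[OF dom.hcomp_closed[OF a 8(3)]] map2_hcomp[of \<alpha> \<beta>] pa pb
        classify1_comp[of "Src E \<alpha>" "Src E \<beta>"] classify1_comp[of "Tgt E \<alpha>" "Tgt E \<beta>"]
      by simp
  next
    case (9 f)
    then have "f \<in> One E" using dom.tight_subset by auto
    from classify1_One[OF this] map1_tight[OF 9] show ?case by simp (simp add: classify1_def)
  qed
qed

lemma classify_over: "map_eq_on E (comp_map (slice_proj K) classify) P"
  using Pk by (simp add: map_eq_on_def comp_map_def classify1_def)

text \<open>The unit compares two cartesian 1-cells to \<open>U\<close> over \<open>P k\<^sub>X\<close>: the leg \<open>k\<^sub>X\<close> and the chosen lift.\<close>

definition unit1 :: "'p \<Rightarrow> 'n" where
  "unit1 X = (THE w. w \<in> hom1 E X (map0 G (map0 classify X)) \<and> map1 P w = Id1 K (map0 P X) \<and>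
     \<L> (map0 classify X) \<odot>\<^bsub>E\<^esub> w = k X)"

lemma unit1:
  assumes X: "X \<in> Obj E"
  shows "unit1 X \<in> hom1 E X (map0 G (map0 classify X))" "map1 P (unit1 X) = Id1 K (map0 P X)"
    "\<L> (map0 classify X) \<odot>\<^bsub>E\<^esub> unit1 X = k X" "invertible1 E (unit1 X)"
proof -
  note l = \<L>_hom[OF Pk(2,4)[OF X]] and kX = cocone.k_closed[OF X]
  have "\<exists>!w. w \<in> hom1 E X (map0 G (map0 classify X)) \<and> map1 P w = Id1 K (map0 P X) \<and>
      \<L> (map0 classify X) \<odot>\<^bsub>E\<^esub> w = k X"
    using vertical_comparison[OF kX l(2,1)] l(3) by simp
  from theI'[OF this]
  have *: "unit1 X \<in> hom1 E X (map0 G (map0 classify X)) \<and> map1 P (unit1 X) = Id1 K (map0 P X) \<and>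
      \<L> (map0 classify X) \<odot>\<^bsub>E\<^esub> unit1 X = k X" unfolding unit1_def .
  then show "unit1 X \<in> hom1 E X (map0 G (map0 classify X))" "map1 P (unit1 X) = Id1 K (map0 P X)"
    "\<L> (map0 classify X) \<odot>\<^bsub>E\<^esub> unit1 X = k X" by simp_all
  show "invertible1 E (unit1 X)"
    by (rule vertical_comparison_invertible[OF k_cartesian[OF X] kX l(2,1)]) (use * in simp_all)
qed

text \<open>
  Both sides lie over \<open>P x\<close>, and composing either with the chosen lift of \<open>P k\<^sub>Y\<close> gives \<open>k\<^sub>Y \<circ> x\<close>: on the
  left because \<open>\<delta>\<^sub>x\<close> is a lift of the 2-cell of \<open>F x\<close> that starts at \<open>k\<^sub>X\<close>.
\<close>

lemma unit1_natural:
  assumes x: "x \<in> hom1 E X Y"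
  shows "map1 G (map1 classify x) \<odot>\<^bsub>E\<^esub> unit1 X = unit1 Y \<odot>\<^bsub>E\<^esub> x"
proof -
  have X: "X \<in> Obj E" and Y: "Y \<in> Obj E" using hom1_D[OF x] dom.dom_closed dom.cod_closed by auto
  note uX = unit1[OF X] and uY = unit1[OF Y] and lY = \<L>_hom[OF Pk(2,4)[OF Y]]
  have s: "classify1 x \<in> slice_One K V" "slice_dom (classify1 x) = map1 P (k X)"
    "slice_cod (classify1 x) = map1 P (k Y)" "slice_arr (classify1 x) = map1 P x"
    "slice_cell (classify1 x) = map2 P (\<delta> x)"
    using classify1_One[of x] hom1_D[OF x] by (simp_all add: classify1_def)
  have g: "map1 G (classify1 x) \<in> hom1 E (map0 G (map0 classify X)) (map0 G (map0 classify Y))"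
    "map1 P (map1 G (classify1 x)) = map1 P x"
    using pullback1[OF s(1)] s by simp_all
  have "\<L> (map1 P (k Y)) \<odot>\<^bsub>E\<^esub> (map1 G (classify1 x) \<odot>\<^bsub>E\<^esub> unit1 X) = k Y \<odot>\<^bsub>E\<^esub> x"
    using pullback1_vertical[OF s(1), of "unit1 X" X "\<delta> x"] uX s cocone.\<delta>_closed[OF x] by simp
  moreover have "\<L> (map1 P (k Y)) \<odot>\<^bsub>E\<^esub> (unit1 Y \<odot>\<^bsub>E\<^esub> x) = k Y \<odot>\<^bsub>E\<^esub> x"
    using dom.comp1_assoc'[OF x uY(1), of "\<L> (map1 P (k Y))" U] lY(1) uY(3) by simp
  moreover have "map1 P (map1 G (classify1 x) \<odot>\<^bsub>E\<^esub> unit1 X) = map1 P x"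
    using map1_comp'[OF uX(1) g(1)] g(2) uX(2) cod.comp1_id_right'[OF map1_closed[OF x]] by simp
  moreover have "map1 P (unit1 Y \<odot>\<^bsub>E\<^esub> x) = map1 P x"
    using map1_comp'[OF x uY(1)] uY(2) cod.comp1_id_left'[OF map1_closed[OF x]] by simp
  ultimately show ?thesis
    using cartesian_cancel[OF lY(2,1), of "map1 G (classify1 x) \<odot>\<^bsub>E\<^esub> unit1 X" X "unit1 Y \<odot>\<^bsub>E\<^esub> x"]
      dom.comp1_closed[OF uX(1) g(1)] dom.comp1_closed[OF x uY(1)]
    by simp
qed

lemma unit1_two_natural: "two_natural E E id_map (comp_map G classify) unit1"
proof -
  interpret G: enhanced_two_functor S E G by (rule pullback_functor)
  interpret F: enhanced_two_functor E S classify by (rule classify_functor)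
  have "map2 G (map2 classify \<alpha>) \<star>\<^bsub>E\<^esub> Id2 E (unit1 (Dom E (Src E \<alpha>))) =
      Id2 E (unit1 (Cod E (Src E \<alpha>))) \<star>\<^bsub>E\<^esub> \<alpha>" if a: "\<alpha> \<in> Two E" for \<alpha>
  proof -
    have a': "\<alpha> \<in> hom2 E (Src E \<alpha>) (Tgt E \<alpha>)" using a by (simp add: hom2_def)
    note p = dom.hom2_parallel[OF a']
    let ?x = "Src E \<alpha>" and ?X = "Dom E (Src E \<alpha>)" and ?Y = "Cod E (Src E \<alpha>)"
    have X: "?X \<in> Obj E" and Y: "?Y \<in> Obj E" using p dom.dom_closed dom.cod_closed by auto
    note x = hom1_I[OF p(1) refl refl] and uX = unit1[OF X] and uY = unit1[OF Y]
    note Ga = G.map2_closed[OF F.map2_closed[OF a']]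
    note Gx = G.map1_closed[OF F.map1_closed[OF x]]
    have cX: "Cod E (unit1 ?X) = Dom E (map1 G (map1 classify ?x))"
      using hom1_D[OF uX(1)] hom1_D[OF Gx] by simp
    have cY: "Cod E ?x = Dom E (unit1 ?Y)" using hom1_D[OF uY(1)] by simp
    note l = dom.prewhisker_closed[OF Ga hom1_D(1)[OF uX(1)] cX]
    note r = dom.postwhisker_closed[OF a' hom1_D(1)[OF uY(1)] cY]
    have PG: "map2 P (map2 G (map2 classify \<alpha>)) = map2 P \<alpha>"
      using map2_pullback_over[OF classify2_Two[OF a]] by simp
    have "map2 P (map2 G (map2 classify \<alpha>) \<star>\<^bsub>E\<^esub> Id2 E (unit1 ?X)) = map2 P \<alpha>"
      using map2_prewhisker[OF Ga hom1_D(1)[OF uX(1)] cX] PG uX(2)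
        cod.prewhisker_id1[OF map2_closed[OF a']] map1_One[OF p(1)] by simp
    moreover have "map2 P (Id2 E (unit1 ?Y) \<star>\<^bsub>E\<^esub> \<alpha>) = map2 P \<alpha>"
      using map2_postwhisker[OF a' hom1_D(1)[OF uY(1)] cY] uY(2)
        cod.postwhisker_id1[OF map2_closed[OF a']] map1_One[OF p(1)] by simp
    ultimately show ?thesis
      using two_cell_unique[OF l[unfolded unit1_natural[OF x]] r] by simp
  qed
  then show ?thesis
    using unit1(1) unit1_natural[OF hom1_I[OF _ refl refl]]
    by (simp add: two_natural_def id_map_def comp_map_def)
qed

definition counit1 :: "'m \<Rightarrow> ('m, 'c) slice1" where
  "counit1 a = Slice1 (map0 classify (map0 G a)) (Id1 K (Dom K a)) (map2 P (cocone.mediator (\<L> a))) a"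

lemma counit1:
  assumes a: "a \<in> One K" "Cod K a = V"
  shows "counit1 a \<in> hom1 S (map0 classify (map0 G a)) a" "invertible1 S (counit1 a)"
    "cocone.mediator (\<L> a) \<in> hom2 E (k (map0 G a)) (\<L> a)"
    "map2 P (cocone.mediator (\<L> a)) \<in> hom2 K (map1 P (k (map0 G a))) a"
proof -
  note l = \<L>_hom[OF a]
  have l1: "\<L> a \<in> hom1 E (map0 G a) U" and X: "map0 G a \<in> Obj E" using l by simp_all
  show m: "cocone.mediator (\<L> a) \<in> hom2 E (k (map0 G a)) (\<L> a)"
    by (rule cocone.mediator_closed[OF l1])
  show Pm: "map2 P (cocone.mediator (\<L> a)) \<in> hom2 K (map1 P (k (map0 G a))) a"
    using map2_closed[OF m] l(3) by simp
  note pk = Pk[OF X]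
  have d: "Dom K a = Dom K (map1 P (k (map0 G a)))" using pk(3) l(4) by simp
  show "counit1 a \<in> hom1 S (map0 classify (map0 G a)) a"
    using cod.slice_vertical_One[OF d pk(4) a(2) pk(2) a(1)] Pm d
    by (simp add: counit1_def hom1_def)
  have "invertible2 K (map2 P (cocone.mediator (\<L> a)))"
    by (rule map_invertible2[OF m cocone.mediator_invertible[OF l1]])
      (use l(2) in \<open>simp add: cartesian_marking_def\<close>)
  then show "invertible1 S (counit1 a)"
    using cod.slice_vertical_invertible[OF Pm pk(4)] d by (simp add: counit1_def)
qed

text \<open>
  The equation holds in \<open>E\<close> before \<open>P\<close> is applied.  There, with \<open>\<Phi> : \<lambda>\<^sub>a \<Rightarrow> \<lambda>\<^sub>b \<circ> g\<close> the lift of the given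
  2-cell, it says that both sides are the mediator of \<open>\<lambda>\<^sub>b \<circ> g\<close>.
\<close>

lemma counit1_natural:
  assumes s: "s \<in> slice_One K V"
  shows "slice_comp K s (counit1 (slice_dom s)) = slice_comp K (counit1 (slice_cod s)) (classify1 (map1 G s))"
proof -
  note D = slice_One_D[OF s] and p = pullback1[OF s]
  let ?a = "slice_dom s" and ?b = "slice_cod s" and ?g = "map1 G s"
  note la = \<L>_hom[OF D(1,2)] and lb = \<L>_hom[OF D(3,4)]
  have la1: "\<L> ?a \<in> hom1 E (map0 G ?a) U" and lb1: "\<L> ?b \<in> hom1 E (map0 G ?b) U"
    using la lb by simp_all
  note ca = counit1[OF D(1,2)] and cb = counit1[OF D(3,4)]
  let ?\<Phi> = "cell_lift E P (\<L> ?a) (slice_cell s)"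
  note g = hom1_D[OF p(1)]
  have e: "?\<Phi> \<cdot>\<^bsub>E\<^esub> cocone.mediator (\<L> ?a) = (cocone.mediator (\<L> ?b) \<star>\<^bsub>E\<^esub> Id2 E ?g) \<cdot>\<^bsub>E\<^esub> \<delta> ?g"
    using cocone.mediator_natural[OF la1 p(3)] cocone.mediator_comp[OF lb1 p(1)] by simp
  have kb: "Cod E ?g = Dom E (k (map0 G ?b))"
    using g hom1_D[OF cocone.k_closed[of "map0 G ?b"]] lb(5) by simp
  note w = dom.prewhisker_closed[OF cb(3) g(1) kb]
  have l: "map2 P (?\<Phi> \<cdot>\<^bsub>E\<^esub> cocone.mediator (\<L> ?a)) = slice_cell s \<cdot>\<^bsub>K\<^esub> map2 P (cocone.mediator (\<L> ?a))"
    using map2_vcomp'[OF ca(3) p(3)] p(4) by simp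
  have r: "map2 P ((cocone.mediator (\<L> ?b) \<star>\<^bsub>E\<^esub> Id2 E ?g) \<cdot>\<^bsub>E\<^esub> \<delta> ?g) =
      (map2 P (cocone.mediator (\<L> ?b)) \<star>\<^bsub>K\<^esub> Id2 K (slice_arr s)) \<cdot>\<^bsub>K\<^esub> map2 P (\<delta> ?g)"
    using map2_vcomp'[OF cocone.\<delta>_closed[OF p(1)] w] map2_prewhisker[OF cb(3) g(1) kb] p(2) by simp
  have i: "slice_cell s \<star>\<^bsub>K\<^esub> Id2 K (Id1 K (Dom K ?a)) = slice_cell s"
    by (rule cod.prewhisker_id1[OF D(6) refl])
  show ?thesis
    using l r e i cod.comp1_id_left'[OF D(5)] cod.comp1_id_right'[OF D(5)] p(2) g
    by (simp add: slice_comp_def counit1_def classify1_def del: pullback_simps(2))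
qed

lemma counit1_two_natural: "two_natural S S (comp_map classify G) id_map counit1"
proof -
  interpret G: enhanced_two_functor S E G by (rule pullback_functor)
  have "HComp S \<tau> (Id2 S (counit1 (slice_dom (slice_src \<tau>)))) =
      HComp S (Id2 S (counit1 (slice_cod (slice_src \<tau>)))) (map2 classify (map2 G \<tau>))"
    if t: "\<tau> \<in> slice_Two K V" for \<tau>
  proof -
    note T = slice_Two_D[OF t] and D = slice_One_D[OF slice_Two_D(1)[OF t]]
    have g: "Src E (map2 G \<tau>) = map1 G (slice_src \<tau>)" "Tgt E (map2 G \<tau>) = map1 G (slice_tgt \<tau>)"
      using hom2_D[OF G.map2_closed[of \<tau> "slice_src \<tau>" "slice_tgt \<tau>"]] t by (simp_all add: hom2_def)
    have arr: "slice_arr (counit1 a) = Id1 K (Dom K a)" for a by (simp add: counit1_def)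
    have w: "slice_map \<tau> \<star>\<^bsub>K\<^esub> Id2 K (Id1 K (Dom K (slice_dom (slice_src \<tau>)))) = slice_map \<tau>"
      "Id2 K (Id1 K (Dom K (slice_cod (slice_src \<tau>)))) \<star>\<^bsub>K\<^esub> slice_map \<tau> = slice_map \<tau>"
      using cod.prewhisker_id1[OF T(5)] cod.postwhisker_id1[OF T(5)] hom1_D[OF D(5)] by simp_all
    show ?thesis
      using counit1_natural[OF T(1)] counit1_natural[OF T(2)] T g w map2_pullback_over[OF t]
      by (simp add: arr del: pullback_simps)
  qed
  then show ?thesis
    using counit1(1) counit1_natural
    by (simp add: two_natural_def id_map_def comp_map_def del: pullback_simps)
qed

text \<open>
  The mediator of \<open>\<lambda>\<^sub>a\<close> lies over the 2-cell of the counit, starts at \<open>k = \<lambda> \<circ> \<eta>\<close> and ends at \<open>\<lambda>\<^sub>a\<close>, so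
  the composite with \<open>\<lambda>\<^sub>a\<close> is \<open>\<lambda>\<^sub>a\<close>, which is cartesian.
\<close>

lemma first_triangle:
  assumes a: "a \<in> One K" "Cod K a = V"
  shows "map1 G (counit1 a) \<odot>\<^bsub>E\<^esub> unit1 (map0 G a) = Id1 E (map0 G a)"
proof -
  note l = \<L>_hom[OF a] and c = counit1[OF a]
  have l1: "\<L> a \<in> hom1 E (map0 G a) U" and X: "map0 G a \<in> Obj E" using l by simp_all
  note u = unit1[OF X]
  have s: "counit1 a \<in> slice_One K V" using c(1) by (simp add: hom1_def)
  have f: "slice_dom (counit1 a) = map0 classify (map0 G a)" "slice_cod (counit1 a) = a"
    "slice_arr (counit1 a) = Id1 K (Dom K a)" "slice_cell (counit1 a) = map2 P (cocone.mediator (\<L> a))"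
    by (simp_all add: counit1_def)
  have g: "map1 G (counit1 a) \<in> hom1 E (map0 G (map0 classify (map0 G a))) (map0 G a)"
    "map1 P (map1 G (counit1 a)) = Id1 K (Dom K a)"
    using pullback1(1,2)[OF s] f by simp_all
  have gu: "map1 G (counit1 a) \<odot>\<^bsub>E\<^esub> unit1 (map0 G a) \<in> hom1 E (map0 G a) (map0 G a)"
    by (rule dom.comp1_closed[OF u(1) g(1)])
  have d: "map0 P (map0 G a) = Dom K a" using l(4) by simp
  have "\<L> (slice_cod (counit1 a)) \<odot>\<^bsub>E\<^esub> (map1 G (counit1 a) \<odot>\<^bsub>E\<^esub> unit1 (map0 G a)) = \<L> a"
    by (rule pullback1_vertical[OF s _ u(2), of "cocone.mediator (\<L> a)"])
      (use f u(1,3) c(3) in simp_all)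
  then have "\<L> a \<odot>\<^bsub>E\<^esub> (map1 G (counit1 a) \<odot>\<^bsub>E\<^esub> unit1 (map0 G a)) = \<L> a \<odot>\<^bsub>E\<^esub> Id1 E (map0 G a)"
    unfolding f dom.comp1_id_right'[OF l1] .
  moreover have "map1 P (map1 G (counit1 a) \<odot>\<^bsub>E\<^esub> unit1 (map0 G a)) = map1 P (Id1 E (map0 G a))"
    using map1_comp'[OF u(1) g(1)] g(2) u(2) map1_id[OF X] d
      cod.comp1_id_left'[OF cod.id1_closed[OF cod.dom_closed[OF a(1)]]] by simp
  ultimately show ?thesis
    using cartesian_cancel[OF l(2) l1 gu dom.id1_closed[OF X]] by blast
qed

lemma inverse_over_classify: "inverse_over K S (slice_proj K) E P G classify unit1 counit1"
proof -
  have "map1 (slice_proj K) (counit1 a) = Id1 K (map0 (slice_proj K) a)" for a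
    by (simp add: counit1_def)
  then show ?thesis
    unfolding inverse_over_def
    using pullback_functor pullback_over classify_functor classify_over unit1_two_natural
      counit1_two_natural unit1(2,4) counit1(2) by simp
qed

lemma right_adjoint_equivalence: "right_adjoint_equivalence_over K S (slice_proj K) E P G"
proof -
  interpret eq: equivalence_data K S "slice_proj K" E P G classify unit1 counit1
    by unfold_locales (rule inverse_over_classify)
  have t1: "map1 G (counit1 a) \<odot>\<^bsub>E\<^esub> unit1 (map0 G a) = Id1 E (map0 G a)" if "a \<in> Obj S" for a
    using first_triangle that by simp
  show ?thesis
    unfolding right_adjoint_equivalence_over_def
    using inverse_over_classify t1 eq.second_triangle[OF t1] by blast
qed

end

section \<open>From an equivalence to a marked lax cocone\<close>

locale fibration_with_equivalence =
  fibration_with_object E K P lift U +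
  eq: equivalence_data K S "slice_proj K" E P G F \<eta> \<epsilon>
  for E :: "('p, 'n, 'd) two_cat" and K :: "('o, 'm, 'c) two_cat"
    and P :: "('p, 'n, 'd, 'o, 'm, 'c) two_map" and lift :: "'m \<Rightarrow> 'p \<Rightarrow> 'n" and U :: 'p
    and F :: "('p, 'n, 'd, 'm, ('m, 'c) slice1, ('m, 'c) slice2) two_map"
    and \<eta> :: "'p \<Rightarrow> 'n" and \<epsilon> :: "'m \<Rightarrow> ('m, 'c) slice1"
begin

lemma F0:
  assumes X: "X \<in> Obj E"
  shows "map0 F X \<in> One K" "Cod K (map0 F X) = V" "Dom K (map0 F X) = map0 P X"
  using eq.F.map0_closed[OF X] eq.F_over(1)[OF X] by simp_all

lemma F1:
  assumes x: "x \<in> hom1 E X Y"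
  shows "map1 F x \<in> slice_One K V" "slice_dom (map1 F x) = map0 F X"
    "slice_cod (map1 F x) = map0 F Y" "slice_arr (map1 F x) = map1 P x"
    "slice_cell (map1 F x) \<in> hom2 K (map0 F X) (map0 F Y \<odot>\<^bsub>K\<^esub> map1 P x)"
proof -
  show s: "map1 F x \<in> slice_One K V" "slice_dom (map1 F x) = map0 F X"
    "slice_cod (map1 F x) = map0 F Y" "slice_arr (map1 F x) = map1 P x"
    using eq.F.map1_closed[OF x] eq.F_over(2)[OF hom1_D(1)[OF x]] by (simp_all add: hom1_def)
  show "slice_cell (map1 F x) \<in> hom2 K (map0 F X) (map0 F Y \<odot>\<^bsub>K\<^esub> map1 P x)"
    using slice_One_D(6)[OF s(1)] s by simp
qed

definition cocone_leg :: "'p \<Rightarrow> 'n" where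
  "cocone_leg X = \<L> (map0 F X) \<odot>\<^bsub>E\<^esub> \<eta> X"

definition cocone_cell :: "'n \<Rightarrow> 'd" where
  "cocone_cell x = cell_lift E P (cocone_leg (Dom E x)) (slice_cell (map1 F x))"

lemma cocone_leg:
  assumes X: "X \<in> Obj E"
  shows "cocone_leg X \<in> hom1 E X U" "map1 P (cocone_leg X) = map0 F X"
    "cartesian E K P (cocone_leg X)"
proof -
  note f = F0[OF X]
  note l = \<L>_hom[OF f(1,2)] and h = eq.\<eta>_hom[OF X]
  have h1: "\<eta> X \<in> hom1 E X (Dom E (\<L> (map0 F X)))" using h(1) by simp
  show "cocone_leg X \<in> hom1 E X U"
    unfolding cocone_leg_def by (rule dom.comp1_closed[OF h1 l(1)])
  show "map1 P (cocone_leg X) = map0 F X"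
    unfolding cocone_leg_def using map1_comp'[OF h1 l(1)] l(3) h(3) cod.comp1_id_right[OF f(1)] f(3)
    by simp
  show "cartesian E K P (cocone_leg X)"
    unfolding cocone_leg_def
    by (rule cartesian_comp[OF l(2,1) cartesian_invertible1[OF h1 h(2)] h1])
qed

text \<open>
  By the naturality square of \<open>\<eta>\<close> at \<open>x\<close>, the lift ends at \<open>\<lambda>\<^bsub>F Y\<^esub> \<circ> G F x \<circ> \<eta>\<^sub>X = \<lambda>\<^bsub>F Y\<^esub> \<circ> \<eta>\<^sub>Y \<circ> x\<close>.
\<close>

lemma cocone_cell:
  assumes x: "x \<in> hom1 E X Y"
  shows "cocone_cell x \<in> hom2 E (cocone_leg X) (cocone_leg Y \<odot>\<^bsub>E\<^esub> x)"
    "map2 P (cocone_cell x) = slice_cell (map1 F x)"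
proof -
  have X: "X \<in> Obj E" and Y: "Y \<in> Obj E" using hom1_D[OF x] dom.dom_closed dom.cod_closed by auto
  note s = F1[OF x] and kX = cocone_leg[OF X] and lY = \<L>_hom[OF F0(1,2)[OF Y]]
  note hX = eq.\<eta>_hom[OF X] and hY = eq.\<eta>_hom[OF Y]
  have hY1: "\<eta> Y \<in> hom1 E Y (Dom E (\<L> (map0 F Y)))" using hY(1) by simp
  have "slice_cell (map1 F x) \<in> hom2 K (map1 P (cocone_leg X)) (map0 F Y \<odot>\<^bsub>K\<^esub> map1 P x)"
    using s(5) kX(2) by simp
  note c = cell_lift[OF hom1_D(1)[OF kX(1)] this]
  show P: "map2 P (cocone_cell x) = slice_cell (map1 F x)"
    unfolding cocone_cell_def using c(2) hom1_D(2)[OF x] by simp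
  have "\<L> (slice_cod (map1 F x)) \<odot>\<^bsub>E\<^esub> (map1 G (map1 F x) \<odot>\<^bsub>E\<^esub> \<eta> X) =
      Tgt E (cell_lift E P (cocone_leg X) (slice_cell (map1 F x)))"
    by (rule pullback1_vertical[OF s(1) _ hX(3) _ c(2)]) (use hX(1) s c(1) in \<open>simp_all add: cocone_leg_def\<close>)
  then have "\<L> (map0 F Y) \<odot>\<^bsub>E\<^esub> (\<eta> Y \<odot>\<^bsub>E\<^esub> x) = Tgt E (cell_lift E P (cocone_leg X) (slice_cell (map1 F x)))"
    unfolding eq.\<eta>_natural[OF x] s(3) .
  then have "cocone_leg Y \<odot>\<^bsub>E\<^esub> x = Tgt E (cell_lift E P (cocone_leg X) (slice_cell (map1 F x)))"
    unfolding cocone_leg_def using dom.comp1_assoc'[OF x hY1 lY(1)] by simp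
  then show "cocone_cell x \<in> hom2 E (cocone_leg X) (cocone_leg Y \<odot>\<^bsub>E\<^esub> x)"
    unfolding cocone_cell_def using c(1) hom1_D(2)[OF x] by simp
qed

text \<open>
  For cartesian \<open>x\<close>, the vertical 1-cell \<open>(1, \<phi>) : F X \<rightarrow> F Y \<circ> P x\<close> with the same 2-cell \<open>\<phi>\<close> as \<open>F x\<close>
  pulls back to the comparison of two cartesian 1-cells over \<open>F Y \<circ> P x\<close>: the chosen lift, and
  \<open>\<lambda>\<^bsub>F Y\<^esub> \<circ> G F x\<close>, where \<open>G F x\<close> is a conjugate of \<open>x\<close> by \<open>\<eta>\<close>.  So its image under \<open>G\<close> is invertible,
  and \<open>G\<close> is conservative.
\<close>

lemma cocone_cell_invertible:
  assumes x: "cartesian E K P x" "x \<in> hom1 E X Y"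
  shows "invertible2 E (cocone_cell x)"
proof -
  have X: "X \<in> Obj E" and Y: "Y \<in> Obj E" using hom1_D[OF x(2)] dom.dom_closed dom.cod_closed by auto
  note s = F1[OF x(2)] and fX = F0[OF X] and fY = F0[OF Y] and Px = map1_closed[OF x(2)]
  note lX = \<L>_hom[OF fX(1,2)] and lY = \<L>_hom[OF fY(1,2)]
  note hX = eq.\<eta>_hom[OF X] and hY = eq.\<eta>_hom[OF Y]
  let ?b = "map0 F Y \<odot>\<^bsub>K\<^esub> map1 P x" and ?\<phi> = "slice_cell (map1 F x)"
  have b: "?b \<in> One K" "Dom K ?b = Dom K (map0 F X)" "Cod K ?b = V"
    using cod.comp1_One[of "map1 P x" "map0 F Y"] hom1_D[OF Px] fX fY by simp_all
  define s' where "s' = Slice1 (map0 F X) (Id1 K (Dom K (map0 F X))) ?\<phi> ?b"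
  have s': "s' \<in> slice_One K V" "slice_dom s' = map0 F X" "slice_cod s' = ?b"
    "slice_arr s' = Id1 K (Dom K (map0 F X))" "slice_cell s' = ?\<phi>"
    using cod.slice_vertical_One[OF b(2) fX(2) b(3) fX(1) b(1)] s(5) by (simp_all add: s'_def)
  have s'h: "s' \<in> hom1 S (map0 F X) ?b" using s' by (simp add: hom1_def)
  note lb = \<L>_hom[OF b(1,3)]
  have w: "map1 G s' \<in> hom1 E (Dom E (\<L> (map0 F X))) (Dom E (\<L> ?b))"
    "map1 P (map1 G s') = Id1 K (Dom K (map0 F X))"
    using pullback1(1,2)[OF s'(1)] s' by simp_all
  have g: "map1 G (map1 F x) \<in> hom1 E (Dom E (\<L> (map0 F X))) (Dom E (\<L> (map0 F Y)))"
    using pullback1(1)[OF s(1)] s by simp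
  have eq1: "\<L> ?b \<odot>\<^bsub>E\<^esub> map1 G s' = \<L> (map0 F Y) \<odot>\<^bsub>E\<^esub> map1 G (map1 F x)"
    using hom2_D(3)[OF pullback1(3)[OF s'(1)]] hom2_D(3)[OF pullback1(3)[OF s(1)]] s' s by simp
  obtain h' where h': "h' \<in> hom1 E (map0 G (map0 F X)) X" "h' \<odot>\<^bsub>E\<^esub> \<eta> X = Id1 E X"
      "\<eta> X \<odot>\<^bsub>E\<^esub> h' = Id1 E (map0 G (map0 F X))"
    using dom.invertible1E[OF hX(2,1)] .
  have hX1: "\<eta> X \<in> hom1 E X (Dom E (\<L> (map0 F X)))" and hY1: "\<eta> Y \<in> hom1 E Y (Dom E (\<L> (map0 F Y)))"
    and h'1: "h' \<in> hom1 E (Dom E (\<L> (map0 F X))) X"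
    using hX(1) hY(1) h'(1) by simp_all
  have "map1 G (map1 F x) = map1 G (map1 F x) \<odot>\<^bsub>E\<^esub> (\<eta> X \<odot>\<^bsub>E\<^esub> h')"
    using h'(3) dom.comp1_id_right'[OF g] by simp
  also have "\<dots> = (\<eta> Y \<odot>\<^bsub>E\<^esub> x) \<odot>\<^bsub>E\<^esub> h'"
    using dom.comp1_assoc'[OF h'1 hX1 g] eq.\<eta>_natural[OF x(2)] by simp
  finally have conj: "map1 G (map1 F x) = (\<eta> Y \<odot>\<^bsub>E\<^esub> x) \<odot>\<^bsub>E\<^esub> h'" .
  have h'i: "invertible1 E h'" using dom.invertible1I[OF h'(1) hX(1)] h'(2,3) by blast
  have cg: "cartesian E K P (map1 G (map1 F x))"
    unfolding conj
    by (rule cartesian_comp[OF cartesian_comp[OF cartesian_invertible1[OF hY1 hY(2)] hY1 x]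
          dom.comp1_closed[OF x(2) hY1] cartesian_invertible1[OF h'1 h'i] h'1])
  have "invertible1 E (map1 G s')"
    by (rule vertical_comparison_invertible[OF cartesian_comp[OF lY(2,1) cg g]
          dom.comp1_closed[OF g lY(1)] lb(2,1) w(1) _ eq1])
      (use w(2) lX(4) in simp)
  then have "invertible1 S s'" by (rule eq.G_conservative[OF s'h])
  then have "invertible2 K ?\<phi>"
    using cod.slice_vertical_invertible[OF s(5) fX(2)] by (simp add: s'_def)
  then show ?thesis
    using invertible2_lift[OF cocone_cell(1)[OF x(2)]] cocone_cell(2)[OF x(2)] by simp
qed

text \<open>
  As \<open>G\<close> sends \<open>id\<close> to \<open>U\<close> itself, fullness gives a 1-cell \<open>(1, \<rho>) : F U \<rightarrow> id\<close> of the slice that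
  \<open>G\<close> maps to \<open>\<eta>\<^sub>U\<^sup>-\<^sup>1\<close>.  This choice makes the lift of \<open>\<rho>\<close> end exactly at the identity of \<open>U\<close>, where the
  counit would give only an isomorphic 1-cell.
\<close>

lemma cocone_point:
  "\<exists>\<sigma>. \<sigma> \<in> hom2 E (cocone_leg U) (Id1 E U) \<and> invertible2 E \<sigma>"
proof -
  note f = F0[OF U_Obj] and h = eq.\<eta>_hom[OF U_Obj] and kU = cocone_leg[OF U_Obj]
  let ?b = "Id1 K V"
  have V: "V \<in> Obj K" by (rule map0_closed[OF U_Obj])
  note b = cod.id1_One[OF V]
  have lb: "\<L> ?b = Id1 E U" by (rule lift_id[OF U_Obj])
  have Gb: "map0 G ?b = U" using dom.id1_One[OF U_Obj] by (simp add: lb)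
  obtain h' where h': "h' \<in> hom1 E (map0 G (map0 F U)) U" "h' \<odot>\<^bsub>E\<^esub> \<eta> U = Id1 E U"
      "\<eta> U \<odot>\<^bsub>E\<^esub> h' = Id1 E (map0 G (map0 F U))"
    using dom.invertible1E[OF h(2,1)] .
  have "h' \<in> hom1 E (map0 G (map0 F U)) (map0 G ?b)" using h'(1) unfolding Gb .
  from eq.G_full[OF this eq.F.map0_closed[OF U_Obj]]
  obtain s where s: "s \<in> hom1 S (map0 F U) ?b" "map1 G s = h'"
    using b by auto
  have s1: "s \<in> slice_One K V" "slice_dom s = map0 F U" "slice_cod s = ?b"
    using s(1) by (simp_all add: hom1_def)
  have Ph': "map1 P h' \<in> hom1 K V V"
    using map1_closed[OF h'(1)] \<L>_hom(4)[OF f(1,2)] f(3) by simp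
  have "map1 P h' \<odot>\<^bsub>K\<^esub> map1 P (\<eta> U) = Id1 K V"
    using map1_comp'[OF h(1) h'(1)] h'(2) map1_id[OF U_Obj] by simp
  then have "map1 P h' = Id1 K V"
    using h(3) cod.comp1_id_right'[OF Ph'] by simp
  then have arr: "slice_arr s = Id1 K V" using pullback1(2)[OF s1(1)] s(2) by simp
  define \<rho> where "\<rho> = slice_cell s"
  have s': "s = Slice1 (map0 F U) (Id1 K (Dom K (map0 F U))) \<rho> ?b"
    using s1 arr f(3) by (cases s) (simp add: \<rho>_def)
  have r: "\<rho> \<in> hom2 K (map0 F U) ?b"
    using slice_One_D(6)[OF s1(1)] s1 arr cod.comp1_id_left'[OF cod.id1_closed[OF V]] by (simp add: \<rho>_def)
  have "invertible1 E (map1 G s)"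
    unfolding s(2) using dom.invertible1I[OF h'(1) h(1)] h'(2,3) by blast
  then have "invertible1 S s" by (rule eq.G_conservative[OF s(1)])
  then have ri: "invertible2 K \<rho>"
    using cod.slice_vertical_invertible[OF r f(2)] s' by simp
  have r': "\<rho> \<in> hom2 K (map1 P (cocone_leg U)) ?b" using r kU(2) by simp
  note c = cell_lift[OF hom1_D(1)[OF kU(1)] r']
  have "\<L> (slice_cod s) \<odot>\<^bsub>E\<^esub> (map1 G s \<odot>\<^bsub>E\<^esub> \<eta> U) = Tgt E (cell_lift E P (cocone_leg U) \<rho>)"
    by (rule pullback1_vertical[OF s1(1) _ h(3), of "cell_lift E P (cocone_leg U) \<rho>"])
      (use h(1) s1 c in \<open>simp_all add: cocone_leg_def \<rho>_def\<close>)
  then have "Tgt E (cell_lift E P (cocone_leg U) \<rho>) = Id1 E U"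
    using s1(3) s(2) lb h'(2) dom.comp1_id_left'[OF dom.id1_closed[OF U_Obj]] by simp
  then have "cell_lift E P (cocone_leg U) \<rho> \<in> hom2 E (cocone_leg U) (Id1 E U)" using c(1) by simp
  then show ?thesis using invertible2_lift[OF _ ] ri c(2) by metis
qed

lemma equivalence_cocone:
  "\<exists>\<sigma>. marked_lax_cocone E (cartesian_marking E K P) U cocone_leg cocone_cell \<sigma>"
proof -
  obtain \<sigma> where \<sigma>: "\<sigma> \<in> hom2 E (cocone_leg U) (Id1 E U)" "invertible2 E \<sigma>"
    using cocone_point by blast
  have "marked_lax_cocone E (cartesian_marking E K P) U cocone_leg cocone_cell \<sigma>"
  proof (unfold_locales, goal_cases)
    case 1 show ?case by (rule U_Obj)
  next
    case (2 X) then show ?case by (rule cocone_leg(1))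
  next
    case (3 X) then show ?case using cocone_leg(3) by (simp add: cartesian_marking_def)
  next
    case (4 x X Y) then show ?case by (rule cocone_cell(1))
  next
    case (5 X)
    note k = cocone_leg[OF 5] and i = dom.id1_closed[OF 5]
    show ?case
      by (rule two_cell_unique[OF cocone_cell(1)[OF i] dom.id2_closed[OF hom1_D(1)[OF k(1)]]])
        (use cocone_cell(2)[OF i] eq.F.map1_id[OF 5] map2_id[OF hom1_D(1)[OF k(1)]] k(2) in simp)
  next
    case (6 x X Y y Z)
    have Y: "Y \<in> Obj E" and Z: "Z \<in> Obj E"
      using hom1_D[OF 6(2)] dom.dom_closed dom.cod_closed by auto
    note yx = dom.comp1_closed[OF 6] and cx = cocone_cell[OF 6(1)] and cy = cocone_cell[OF 6(2)]
    have c: "Cod E x = Dom E (cocone_leg Y)" using hom1_D[OF 6(1)] hom1_D[OF cocone_leg(1)[OF Y]] by simp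
    note w = dom.prewhisker_closed[OF cy(1) hom1_D(1)[OF 6(1)] c]
    have w': "cocone_cell y \<star>\<^bsub>E\<^esub> Id2 E x \<in> hom2 E (cocone_leg Y \<odot>\<^bsub>E\<^esub> x) (cocone_leg Z \<odot>\<^bsub>E\<^esub> (y \<odot>\<^bsub>E\<^esub> x))"
      using w dom.comp1_assoc'[OF 6 cocone_leg(1)[OF Z]] by simp
    show ?case
      by (rule two_cell_unique[OF cocone_cell(1)[OF yx] dom.vcomp_closed[OF cx(1) w']])
        (use cocone_cell(2)[OF yx] eq.F.map1_comp'[OF 6] map2_vcomp'[OF cx(1) w'] cx(2) cy(2)
          map2_prewhisker[OF cy(1) hom1_D(1)[OF 6(1)] c] F1(4)[OF 6(1)] in simp)
  next
    case (7 \<alpha> x x' X Y)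
    have Y: "Y \<in> Obj E" using hom1_D[OF 7(2)] dom.cod_closed by auto
    note x' = dom.hom2_hom1[OF 7] and k = cocone_leg[OF Y]
    note cx = cocone_cell[OF 7(2)] and cx' = cocone_cell[OF x']
    have c: "Cod E x = Dom E (cocone_leg Y)" using hom1_D[OF 7(2)] hom1_D[OF k(1)] by simp
    note w = dom.postwhisker_closed[OF 7(1) hom1_D(1)[OF k(1)] c]
    have "map2 F \<alpha> \<in> slice_Two K V" "slice_src (map2 F \<alpha>) = map1 F x" "slice_tgt (map2 F \<alpha>) = map1 F x'"
      using eq.F.map2_closed[OF 7(1)] by (simp_all add: hom2_def)
    then have "(Id2 K (map0 F Y) \<star>\<^bsub>K\<^esub> map2 P \<alpha>) \<cdot>\<^bsub>K\<^esub> slice_cell (map1 F x) = slice_cell (map1 F x')"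
      using slice_Two_D(6)[of "map2 F \<alpha>" K V] F1(3)[OF 7(2)] eq.F_over(3)[OF hom2_D(1)[OF 7(1)]] by simp
    then show ?case
      by (intro two_cell_unique[OF dom.vcomp_closed[OF cx(1) w] cx'(1)])
        (use map2_vcomp'[OF cx(1) w] map2_postwhisker[OF 7(1) hom1_D(1)[OF k(1)] c] k(2) cx(2) cx'(2) in simp)
  next
    case (8 x)
    then show ?case
      using cocone_cell_invertible[OF _ hom1_I[OF 8(2) refl refl]] by (simp add: cartesian_marking_def)
  next
    case 9 show ?case by (rule \<sigma>(1))
  next
    case 10 show ?case by (rule \<sigma>(2))
  qed
  then show ?thesis by blast
qed

end

section \<open>The equivalence of the two conditions\<close>

theorem theorem4p18:
  fixes K :: "('o, 'm, 'c) two_cat" and E :: "('p, 'n, 'd) two_cat"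
    and P :: "('p, 'n, 'd, 'o, 'm, 'c) two_map" and lift :: "'m \<Rightarrow> 'p \<Rightarrow> 'n" and U :: 'p
  assumes "enhanced_two_category K"
    and "enhanced_discrete_two_fibration E K P lift"
    and "U \<in> Obj E"
  shows "(marked_lax_terminal E (cartesian_marking E K P) U \<longleftrightarrow>
      equivalence_over K (lax_slice K (map0 P U)) (slice_proj K) E P (pullback E P lift U)) \<and>
    (marked_lax_terminal E (cartesian_marking E K P) U \<longleftrightarrow>
      right_adjoint_equivalence_over K (lax_slice K (map0 P U)) (slice_proj K) E P
        (pullback E P lift U))"
proof -
  interpret fibration_with_object E K P lift U
    using assms(2,3) by (simp add: fibration_with_object_def fibration_with_object_axioms_def)
  let ?M = "cartesian_marking E K P"
  have "right_adjoint_equivalence_over K S (slice_proj K) E P G" if "marked_lax_terminal E ?M U"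
  proof -
    obtain k \<delta> \<sigma> where "marked_lax_cocone E ?M U k \<delta> \<sigma>"
      using dom.marked_lax_terminal_imp_cocone[OF U_Obj \<open>marked_lax_terminal E ?M U\<close>] by blast
    then interpret cocone: marked_lax_cocone E ?M U k \<delta> \<sigma> .
    interpret fibration_with_cocone E K P lift U k \<delta> \<sigma> by unfold_locales
    show ?thesis by (rule right_adjoint_equivalence)
  qed
  moreover have "equivalence_over K S (slice_proj K) E P G"
    if "right_adjoint_equivalence_over K S (slice_proj K) E P G"
    using that by (auto simp: right_adjoint_equivalence_over_def equivalence_over_def)
  moreover have "marked_lax_terminal E ?M U" if equiv: "equivalence_over K S (slice_proj K) E P G"
  proof -
    obtain F \<eta> \<epsilon> where inv: "inverse_over K S (slice_proj K) E P G F \<eta> \<epsilon>"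
      using equiv by (auto simp: equivalence_over_def)
    interpret fibration_with_equivalence E K P lift U F \<eta> \<epsilon>
      by unfold_locales (rule inv)
    obtain \<sigma> where "marked_lax_cocone E ?M U cocone_leg cocone_cell \<sigma>"
      using equivalence_cocone by blast
    then interpret cocone: marked_lax_cocone E ?M U cocone_leg cocone_cell \<sigma> .
    have "invertible1 E (Id1 E U)"
      using dom.id1_closed[OF U_Obj] dom.comp1_id_left' by (intro dom.invertible1I) auto
    then have "Id1 E U \<in> ?M"
      using cartesian_invertible1[OF dom.id1_closed[OF U_Obj]] by (simp add: cartesian_marking_def)
    then show ?thesis
      using cocone.marked_lax_terminal cartesian_One by (auto simp: cartesian_marking_def)
  qed
  ultimately show ?thesis by blast
qed

end
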